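(* In each of the following instances, the action of $A$ on $X$ is $2$-distinguishable: (i) $X$ is a finitely generated infinite group and $A=\operatorname{Aut}(X)$; (ii) $X$ is a finite-dimensional vector space over an infinite field and $A$ is the group of all invertible linear transformations of $X$; (iii) $X$ is countable and $A\leq\operatorname{Sym}(X)$ is an infinite, subdegree-finite permutation group having a finite base; (iv) $X$ is the vertex set of a locally finite, connected map $M$ having at least one vertex of valence at least $3$, and $A=\operatorname{Aut}(M)$ is infinite; (v) $X$ is countable and $A\leq\operatorname{Sym}(X)$ is an infinite, subdegree-finite permutation group with a cyclic point-stabilizer; (vi) $X$ is countable and $A\leq\operatorname{Sym}(X)$ is an infinite, subdegree-finite Frobenius group.
   Context: A group $A$ acting faithfully on $X$ is $2$-distinguishable if there is a coloring of $X$ with $2$ colors that is preserved by no nonidentity element of $A$ (an element $a$ preserves a coloring if $ax$ and $x$ have the same color for all $x$). $A\leq\operatorname{Sym}(X)$ is subdegree-finite if for every $x\in X$ all orbits of the stabilizer $A_x$ on $X$ are finite. A base of $A$ is a subset $Y\subseteq X$ whose pointwise stabilizer $\bigcap_{y\in Y}A_y$ is trivial. A Frobenius group is a non-regular transitive permutation group in which only the identity fixes two points. A map is a cellular embedding of a graph in a surface; $\operatorname{Aut}(M)$ is the group of automorphisms of the underlying graph that preserve the embedding (i.e. map faces to faces), acting on the vertex set. *)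

theory Defs
  imports "HOL-Analysis.Analysis" "HOL-Algebra.Group_Action" "HOL-Algebra.Elementary_Groups"
begin

section \<open>Group actions\<close>

text \<open>
  Actions are those of the library (locale \<^locale>\<open>group_action\<close>): a group \<open>A\<close> with a map
  \<open>\<phi>\<close> into \<open>BijGroup X\<close>, the symmetric group of the set \<open>X\<close>.  The elements of \<open>BijGroup X\<close> are the
  bijections of \<open>X\<close> that take the value \<^const>\<open>undefined\<close> outside \<open>X\<close>, so equality in \<open>BijGroup X\<close> is
  equality on \<open>X\<close>.  A permutation group acts by \<open>\<lambda>a. a\<close>.
\<close>

abbreviation perm_group :: "'x set \<Rightarrow> ('x \<Rightarrow> 'x) set \<Rightarrow> ('x \<Rightarrow> 'x) monoid" where
  "perm_group X A \<equiv> (BijGroup X)\<lparr>carrier := A\<rparr>"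

definition two_distinguishable ::
    "('a, 'm) monoid_scheme \<Rightarrow> 'x set \<Rightarrow> ('a \<Rightarrow> 'x \<Rightarrow> 'x) \<Rightarrow> bool" where
  "two_distinguishable A X \<phi> \<longleftrightarrow>
     faithful_action A X \<phi> \<and>
     (\<exists>c :: 'x \<Rightarrow> bool. \<forall>a \<in> carrier A. (\<forall>x\<in>X. c (\<phi> a x) = c x) \<longrightarrow> a = \<one>\<^bsub>A\<^esub>)"

definition subdegree_finite ::
    "('a, 'm) monoid_scheme \<Rightarrow> 'x set \<Rightarrow> ('a \<Rightarrow> 'x \<Rightarrow> 'x) \<Rightarrow> bool" where
  "subdegree_finite A X \<phi> \<longleftrightarrow>
     (\<forall>x\<in>X. \<forall>y\<in>X. finite (orbit (A\<lparr>carrier := stabilizer A \<phi> x\<rparr>) \<phi> y))"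

text \<open>The intersection with \<^term>\<open>carrier A\<close> matters only for \<open>Y = {}\<close>.\<close>

definition is_base ::
    "('a, 'm) monoid_scheme \<Rightarrow> 'x set \<Rightarrow> ('a \<Rightarrow> 'x \<Rightarrow> 'x) \<Rightarrow> 'x set \<Rightarrow> bool" where
  "is_base A X \<phi> Y \<longleftrightarrow> Y \<subseteq> X \<and> carrier A \<inter> (\<Inter>y\<in>Y. stabilizer A \<phi> y) = {\<one>\<^bsub>A\<^esub>}"

definition regular_action ::
    "('a, 'm) monoid_scheme \<Rightarrow> 'x set \<Rightarrow> ('a \<Rightarrow> 'x \<Rightarrow> 'x) \<Rightarrow> bool" where
  "regular_action A X \<phi> \<longleftrightarrow>
     transitive_action A X \<phi> \<and> (\<forall>x\<in>X. stabilizer A \<phi> x = {\<one>\<^bsub>A\<^esub>})"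

definition frobenius_action ::
    "('a, 'm) monoid_scheme \<Rightarrow> 'x set \<Rightarrow> ('a \<Rightarrow> 'x \<Rightarrow> 'x) \<Rightarrow> bool" where
  "frobenius_action A X \<phi> \<longleftrightarrow>
     transitive_action A X \<phi> \<and> \<not> regular_action A X \<phi> \<and>
     (\<forall>a\<in>carrier A. \<forall>x\<in>X. \<forall>y\<in>X. x \<noteq> y \<and> \<phi> a x = x \<and> \<phi> a y = y \<longrightarrow> a = \<one>\<^bsub>A\<^esub>)"


section \<open>Groups and vector spaces\<close>

definition finitely_generated_group :: "('g, 'm) monoid_scheme \<Rightarrow> bool" where
  "finitely_generated_group G \<longleftrightarrow>
     group G \<and> (\<exists>T. finite T \<and> T \<subseteq> carrier G \<and> generate G T = carrier G)"

definition general_linear_group ::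
    "('k::field \<Rightarrow> 'v::ab_group_add \<Rightarrow> 'v) \<Rightarrow> ('v \<Rightarrow> 'v) monoid" where
  "general_linear_group smul =
     perm_group UNIV {f. Vector_Spaces.linear smul smul f \<and> bij f}"


section \<open>Graphs\<close>

locale simple_graph =
  fixes V :: "'v set" and E :: "'v set set"
  assumes edge_ends: "e \<in> E \<Longrightarrow> \<exists>u\<in>V. \<exists>w\<in>V. u \<noteq> w \<and> e = {u, w}"

definition valence :: "'v set set \<Rightarrow> 'v \<Rightarrow> nat" where
  "valence E v = card {e\<in>E. v \<in> e}"

definition locally_finite_graph :: "'v set \<Rightarrow> 'v set set \<Rightarrow> bool" where
  "locally_finite_graph V E \<longleftrightarrow> (\<forall>v\<in>V. finite {e\<in>E. v \<in> e})"

definition connected_graph :: "'v set \<Rightarrow> 'v set set \<Rightarrow> bool" where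
  "connected_graph V E \<longleftrightarrow> V \<noteq> {} \<and> (\<forall>u\<in>V. \<forall>w\<in>V. (u, w) \<in> {(a, b). {a, b} \<in> E}\<^sup>*)"

definition graph_automorphisms :: "'v set \<Rightarrow> 'v set set \<Rightarrow> ('v \<Rightarrow> 'v) set" where
  "graph_automorphisms V E =
     {g \<in> Bij V. \<forall>u\<in>V. \<forall>w\<in>V. {g u, g w} \<in> E \<longleftrightarrow> {u, w} \<in> E}"


section \<open>Maps on surfaces\<close>

text \<open>Surfaces are connected and without boundary, but need not be compact or orientable.\<close>

definition surface :: "'s topology \<Rightarrow> bool" where
  "surface S \<longleftrightarrow>
     connected_space S \<and> Hausdorff_space S \<and> second_countable S \<and>
     (\<forall>x\<in>topspace S. \<exists>U. openin S U \<and> x \<in> U \<and>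
        subtopology S U homeomorphic_space (euclidean :: complex topology))"

definition graph_image :: "'v set \<Rightarrow> 'v set set \<Rightarrow> ('v \<Rightarrow> 's) \<Rightarrow> ('v set \<Rightarrow> 's set) \<Rightarrow> 's set" where
  "graph_image V E pt ar = pt ` V \<union> (\<Union>e\<in>E. ar e)"

definition map_faces ::
    "'s topology \<Rightarrow> 'v set \<Rightarrow> 'v set set \<Rightarrow> ('v \<Rightarrow> 's) \<Rightarrow> ('v set \<Rightarrow> 's set) \<Rightarrow> 's set set" where
  "map_faces S V E pt ar =
     connected_components_of (subtopology S (topspace S - graph_image V E pt ar))"

text \<open>
  The graph \<open>(V, E)\<close> is drawn in \<open>S\<close> with the vertex \<open>v\<close> at the point \<open>pt v\<close> and the edge \<open>e\<close> along
  the arc \<open>ar e\<close>.  Together, the assumptions up to \<open>weak_topology\<close> say that the drawing is a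
  homeomorphism of the geometric realisation of \<open>(V, E)\<close>, as a 1-dimensional cell complex, onto the
  subspace \<open>graph_image V E pt ar\<close> of \<open>S\<close>; \<open>weak_topology\<close> excludes, for example, edges that
  accumulate at a vertex not incident with them.  The last assumption is that the embedding is
  cellular; in particular the image of the graph is then closed in \<open>S\<close>.
\<close>

locale cellular_map = simple_graph V E
  for S :: "'s topology" and V :: "'v set" and E :: "'v set set"
    and pt :: "'v \<Rightarrow> 's" and ar :: "'v set \<Rightarrow> 's set" +
  assumes surface: "surface S"
    and vertex_points: "inj_on pt V" "pt ` V \<subseteq> topspace S"
    and edge_arcs: "e \<in> E \<Longrightarrow>
          \<exists>\<gamma>. embedding_map (top_of_set {0..1::real}) S \<gamma> \<and> \<gamma> ` {0..1} = ar e \<and> \<gamma> ` {0, 1} = pt ` e"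
    and arc_meets_vertices: "e \<in> E \<Longrightarrow> ar e \<inter> pt ` V = pt ` e"
    and arcs_meet: "\<lbrakk>e \<in> E; e' \<in> E; e \<noteq> e'\<rbrakk> \<Longrightarrow> ar e \<inter> ar e' = pt ` (e \<inter> e')"
    and weak_topology: "\<lbrakk>C \<subseteq> graph_image V E pt ar; \<And>e. e \<in> E \<Longrightarrow> closedin S (C \<inter> ar e)\<rbrakk>
          \<Longrightarrow> closedin (subtopology S (graph_image V E pt ar)) C"
    and faces_are_discs: "F \<in> map_faces S V E pt ar \<Longrightarrow>
          subtopology S F homeomorphic_space top_of_set (ball (0::complex) 1)"

text \<open>
  A graph automorphism preserves the embedding if it is induced by a homeomorphism of the surface
  that carries vertices, edges and faces to vertices, edges and faces.
\<close>

definition map_automorphism_group ::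
    "'s topology \<Rightarrow> 'v set \<Rightarrow> 'v set set \<Rightarrow> ('v \<Rightarrow> 's) \<Rightarrow> ('v set \<Rightarrow> 's set) \<Rightarrow> ('v \<Rightarrow> 'v) monoid" where
  "map_automorphism_group S V E pt ar =
     perm_group V {g \<in> graph_automorphisms V E.
       \<exists>h. homeomorphic_map S S h \<and>
         (\<forall>v\<in>V. h (pt v) = pt (g v)) \<and>
         (\<forall>e\<in>E. h ` ar e = ar (g ` e)) \<and>
         (\<forall>F\<in>map_faces S V E pt ar. h ` F \<in> map_faces S V E pt ar)}"

end

theory Submission
  imports Defs "HOL-Algebra.Multiplicative_Group"
begin

text \<open>
  A countable permutation group in which every nonidentity element moves infinitely many points is
  2-distinguishable: list its elements \<open>a\<^sub>n\<close> and give \<open>x\<^sub>n\<close> and \<open>a\<^sub>n x\<^sub>n\<close> different colours, where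
  both points are fresh.  In (i) a nonidentity automorphism fixes a proper subgroup, whose complement
  is infinite.  In (iii) all point stabilisers are finite; if \<open>a \<noteq> 1\<close> had finite support, its
  conjugates by most elements would lie in one finite stabiliser, so its centraliser would be infinite
  and act on the finite support with finite stabilisers.  In (vi) any two points form a base.  In (v)
  the new case is an infinite cyclic stabiliser of \<open>x\<close>; it contains no nonidentity element of finite
  support.  If the orbit of \<open>x\<close> is infinite, neither does the group; if it is finite, colouring \<open>x\<close>
  differently from the rest of its orbit reduces the problem to the stabiliser.  In (ii) the colour
  class is a union of finite sets of multiples of the basis vectors, with distinct sizes and without
  multiplicative symmetries.

  In (iv) a vertex of valence at least 3 and its neighbours form a base.  The combinatorics of the
  rotation at a vertex is read off from locally constant functions on the complement of unions of
  arcs.  By the Jordan curve theorem and Janiszewski's theorem, such functions see exactly two sides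
  of an arc at an interior point, and only one side at an endpoint.  A homeomorphism that fixes three
  arcs at a point preserves the sides of each; if it fixes an arc and its sides, it fixes all arcs at
  both endpoints and their sides, and this spreads over the connected graph.
\<close>

section \<open>Permutation groups and the motion lemma\<close>

text \<open>In (iv) the edges are merely topological arcs, in a surface that need not be orientable.
  No rotation system, product neighbourhood or global choice of sides is given, and the
  homeomorphism that induces an automorphism fixes arcs only as sets. Hence a side of
  \<open>K\<close> at \<open>p\<close> is encoded as a germ: a truth value, locally constant off
  \<open>K\<close> near \<open>p\<close>. Such germs make sense for arbitrary arcs, are carried
  along by charts and homeomorphisms, and are unique up to negation wherever there are two sides.
  Everything then comes down to signs: each is computed near one point, is constant along a
  connected piece of an arc, and is determined because a side function takes both values. The cyclic
  order of three arcs at \<open>p\<close> becomes the value that a side function of two of them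
  takes on the third.

  The obstacle is at the ends of an edge, where only one side remains. A side function along a whole
  edge is produced only when further edges continue it at both ends, so leaves get separate
  treatment when rigidity is spread over the graph.\<close>

lemma coloring_of_infinite_motion:
  fixes A :: "('x \<Rightarrow> 'x) set"
  assumes "countable A" "finite F"
    and inj: "\<And>a. a \<in> A \<Longrightarrow> inj_on a X"
    and motion: "\<And>a. a \<in> A \<Longrightarrow> infinite {x\<in>X. a x \<noteq> x}"
  shows "\<exists>c :: 'x \<Rightarrow> bool. (\<forall>y\<in>F. c y = c0 y) \<and> (\<forall>a\<in>A. \<exists>x\<in>X. c (a x) \<noteq> c x)"
proof (cases "A = {}")
  case True
  then show ?thesis by (intro exI [of _ c0]) auto
next
  case False
  define a where "a = from_nat_into A"
  have aA: "a n \<in> A" for n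
    by (simp add: a_def False from_nat_into)
  \<comment> \<open>A state pairs the finite set of points used so far with the next witness. It
    starts from \<open>F\<close>, so no witness and no image of one ever meets the prescribed
    part.\<close>
  define P where "P n s \<longleftrightarrow> finite (fst s) \<and> F \<subseteq> fst s \<and> snd s \<in> X \<and> a n (snd s) \<noteq> snd s
      \<and> snd s \<notin> fst s \<and> a n (snd s) \<notin> fst s" for n and s :: "'x set \<times> 'x"
  define Q where "Q n s s' \<longleftrightarrow> fst s' = fst s \<union> {snd s, a n (snd s)}"
    for n and s s' :: "'x set \<times> 'x"
  have fresh: "\<exists>x. P n (U, x)" if "finite U" "F \<subseteq> U" for n U
  proof -
    have "finite {x\<in>X. a n x \<in> U}"
      using finite_vimage_IntI [OF \<open>finite U\<close> inj [OF aA]]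
      by (rule rev_finite_subset) auto
    then have "infinite ({x\<in>X. a n x \<noteq> x} - (U \<union> {x\<in>X. a n x \<in> U}))"
      using motion [OF aA] \<open>finite U\<close> by (simp add: Diff_infinite_finite)
    then obtain x where "x \<in> {x\<in>X. a n x \<noteq> x} - (U \<union> {x\<in>X. a n x \<in> U})"
      using infinite_imp_nonempty by blast
    then show ?thesis
      using that unfolding P_def by auto
  qed
  obtain s where s: "\<And>n. P n (s n)" "\<And>n. Q n (s n) (s (Suc n))"
  proof -
    have "\<exists>s. P 0 s"
      using fresh [of F] \<open>finite F\<close> by blast
    moreover have "\<exists>s'. P (Suc n) s' \<and> Q n s s'" if "P n s" for n s
    proof -
      have "finite (fst s \<union> {snd s, a n (snd s)})" "F \<subseteq> fst s \<union> {snd s, a n (snd s)}"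
        using that by (auto simp: P_def)
      from fresh [OF this, of "Suc n"] show ?thesis
        by (auto simp: Q_def intro: exI)
    qed
    ultimately show ?thesis
      using that dependent_nat_choice [of P Q] by blast
  qed
  define x where "x n = snd (s n)" for n
  have mono: "fst (s m) \<union> {x m, a m (x m)} \<subseteq> fst (s n)" if "m < n" for m n
    using that
  proof (induction n)
    case (Suc n)
    have "fst (s (Suc n)) = fst (s n) \<union> {x n, a n (x n)}"
      using s(2) [of n] by (simp add: Q_def x_def)
    then show ?case
      using Suc by (cases "m = n") auto
  qed auto
  have new: "x n \<notin> fst (s n)" "a n (x n) \<notin> fst (s n)" "a n (x n) \<noteq> x n" "x n \<in> X"
    "F \<subseteq> fst (s n)" for n
    using s(1) [of n] by (auto simp: P_def x_def)
  \<comment> \<open>Outside \<open>F\<close> exactly the witnesses get the colour true. The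
    prescribed values on \<open>F\<close> serve the case of a finite orbit under a group with a
    cyclic stabiliser, where one point has to be singled out in advance.\<close>
  define c where "c y = (if y \<in> F then c0 y else y \<in> range x)" for y
  \<comment> \<open>For \<open>m\<close> different from \<open>n\<close>, the later of the two
    stages avoids the points used by the earlier one; for \<open>m = n\<close>, the witness is
    moved.\<close>
  have "a n (x n) \<noteq> x m" for n m
    using mono [of n m] mono [of m n] new [of n] new [of m] by (metis insertCI linorder_neqE_nat subsetD UnCI)
  then have "c (x n) \<and> \<not> c (a n (x n))" for n
    using new [of n] by (auto simp: c_def)
  moreover have "\<exists>n. b = a n" if "b \<in> A" for b
    using that \<open>countable A\<close> by (metis a_def from_nat_into_surj)
  ultimately have "\<forall>b\<in>A. \<exists>x\<in>X. c (b x) \<noteq> c x"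
    using new(4) by metis
  then show ?thesis
    by (intro exI [of _ c]) (auto simp: c_def)
qed

section \<open>Subgroups of the symmetric group of a set\<close>

locale permutation_group =
  fixes X :: "'x set" and A :: "('x \<Rightarrow> 'x) set"
  assumes subgroup_Bij: "subgroup A (BijGroup X)"
begin

abbreviation "G \<equiv> perm_group X A"

lemma Bij: "a \<in> A \<Longrightarrow> a \<in> Bij X"
  using subgroup.mem_carrier [OF subgroup_Bij] by (simp add: BijGroup_def)

lemma bij: "a \<in> A \<Longrightarrow> bij_betw a X X"
  using Bij by (simp add: Bij_def)

lemma closed [simp, intro]: "a \<in> A \<Longrightarrow> x \<in> X \<Longrightarrow> a x \<in> X"
  using bij bij_betwE by blast

lemma eq_iff: "a \<in> A \<Longrightarrow> x \<in> X \<Longrightarrow> y \<in> X \<Longrightarrow> a x = a y \<longleftrightarrow> x = y"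
  by (meson bij bij_betw_imp_inj_on inj_on_eq_iff)

lemma eqI: "a \<in> A \<Longrightarrow> b \<in> A \<Longrightarrow> (\<And>x. x \<in> X \<Longrightarrow> a x = b x) \<Longrightarrow> a = b"
  using Bij by (metis Bij_imp_extensional extensionalityI)

lemma group: "group G"
  by (rule subgroup.subgroup_is_group [OF subgroup_Bij group_BijGroup])

lemma one: "\<one>\<^bsub>G\<^esub> = (\<lambda>x\<in>X. x)"
  by (simp add: BijGroup_def)

lemma one_mem: "(\<lambda>x\<in>X. x) \<in> A"
  using subgroup.one_closed [OF subgroup_Bij] by (simp add: BijGroup_def)

lemma one_iff: "a \<in> A \<Longrightarrow> a = \<one>\<^bsub>G\<^esub> \<longleftrightarrow> (\<forall>x\<in>X. a x = x)"
  unfolding one using eqI [OF _ one_mem, of a] by (metis restrict_apply')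

lemma mult: "a \<in> A \<Longrightarrow> b \<in> A \<Longrightarrow> a \<otimes>\<^bsub>G\<^esub> b = compose X a b"
  using Bij by (simp add: BijGroup_def)

lemma compose_mem: "a \<in> A \<Longrightarrow> b \<in> A \<Longrightarrow> compose X a b \<in> A"
  using subgroup.m_closed [OF subgroup_Bij, of a b] Bij by (simp add: BijGroup_def)

lemma inverse:
  assumes "a \<in> A"
  obtains b where "b \<in> A" "\<And>x. x \<in> X \<Longrightarrow> b (a x) = x" "\<And>x. x \<in> X \<Longrightarrow> a (b x) = x"
proof
  let ?b = "\<lambda>x\<in>X. inv_into X a x"
  show "?b \<in> A"
    using subgroup.m_inv_closed [OF subgroup_Bij assms] inv_BijGroup [OF Bij [OF assms]] by simp
  show "\<And>x. x \<in> X \<Longrightarrow> ?b (a x) = x" "\<And>x. x \<in> X \<Longrightarrow> a (?b x) = x"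
    using bij [OF assms] by (auto simp: assms bij_betw_inv_into_left bij_betw_inv_into_right)
qed

lemma faithful_action: "faithful_action G X (\<lambda>a. a)"
proof -
  have "(\<lambda>a. a) \<in> hom G (BijGroup X)"
    using subgroup.subset [OF subgroup_Bij] by (auto simp: hom_def)
  then have "group_hom G (BijGroup X) (\<lambda>a. a)"
    by (simp add: group group_BijGroup group_hom_axioms_def group_hom_def)
  then show ?thesis
    by (simp add: faithful_action_axioms.intro faithful_action_def group_action.intro)
qed

lemma two_distinguishableI:
  fixes c :: "'x \<Rightarrow> bool"
  assumes "\<And>a x. a \<in> A \<Longrightarrow> \<forall>x\<in>X. c (a x) = c x \<Longrightarrow> x \<in> X \<Longrightarrow> a x = x"
  shows "two_distinguishable G X (\<lambda>a. a)"
proof -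
  have "a = \<one>\<^bsub>G\<^esub>" if "a \<in> A" "\<forall>x\<in>X. c (a x) = c x" for a
    using assms [OF that] one_iff [OF that(1)] by blast
  then show ?thesis
    unfolding two_distinguishable_def using faithful_action by (intro conjI exI [of _ c]) auto
qed

lemma two_distinguishable_of_infinite_motion:
  assumes "countable A"
    and motion: "\<And>a x. a \<in> A \<Longrightarrow> x \<in> X \<Longrightarrow> a x \<noteq> x \<Longrightarrow> infinite {x\<in>X. a x \<noteq> x}"
  shows "two_distinguishable G X (\<lambda>a. a)"
proof -
  let ?A = "{a\<in>A. \<exists>x\<in>X. a x \<noteq> x}"
  obtain c :: "'x \<Rightarrow> bool" where c: "\<forall>a\<in>?A. \<exists>x\<in>X. c (a x) \<noteq> c x"
  proof -
    have "\<exists>c :: 'x \<Rightarrow> bool. (\<forall>y\<in>{}. c y = undefined y) \<and> (\<forall>a\<in>?A. \<exists>x\<in>X. c (a x) \<noteq> c x)"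
    proof (rule coloring_of_infinite_motion)
      show "countable ?A"
        by (rule countable_subset [OF _ \<open>countable A\<close>]) auto
      show "inj_on a X" if "a \<in> ?A" for a
        using that bij bij_betw_imp_inj_on by blast
    qed (use motion in auto)
    then show ?thesis using that by blast
  qed
  then show ?thesis
    by (intro two_distinguishableI [of c]) blast
qed

text \<open>A nonempty transporter is a coset of the stabiliser. The form of an inclusion covers the
  empty one too, so finiteness and countability both pass from the stabiliser to all
  transporters.\<close>

lemma transporter_subset:
  assumes x: "x \<in> X"
  shows "\<exists>b. {a\<in>A. a x = y} \<subseteq> compose X b ` {a\<in>A. a x = x}"
proof (cases "{a\<in>A. a x = y} = {}")
  case False
  then obtain a where a: "a \<in> A" "a x = y" by blast
  obtain b where b: "b \<in> A" "\<And>x. x \<in> X \<Longrightarrow> b (a x) = x" "\<And>x. x \<in> X \<Longrightarrow> a (b x) = x"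
    using inverse [OF a(1)] by blast
  have "c \<in> compose X a ` {a\<in>A. a x = x}" if c: "c \<in> A" "c x = y" for c
  proof
    show "c = compose X a (compose X b c)"
      using a b c by (intro eqI compose_mem) (auto simp: compose_def)
    show "compose X b c \<in> {a\<in>A. a x = x}"
      using a b c x by (auto simp: compose_mem) (auto simp: compose_def)
  qed
  then show ?thesis
    by (intro exI [of _ a]) auto
next
  case True
  then show ?thesis
    unfolding True by simp
qed

lemma finite_transporter:
  assumes "x \<in> X" "finite {a\<in>A. a x = x}" shows "finite {a\<in>A. a x = y}"
proof -
  obtain b where "{a\<in>A. a x = y} \<subseteq> compose X b ` {a\<in>A. a x = x}"
    using transporter_subset [OF assms(1)] ..
  then show ?thesis
    by (rule finite_subset) (intro finite_imageI assms(2))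
qed

lemma countable_transporter:
  assumes "x \<in> X" "countable {a\<in>A. a x = x}" shows "countable {a\<in>A. a x = y}"
proof -
  obtain b where "{a\<in>A. a x = y} \<subseteq> compose X b ` {a\<in>A. a x = x}"
    using transporter_subset [OF assms(1)] ..
  then show ?thesis
    by (rule countable_subset) (intro countable_image assms(2))
qed

text \<open>Elements of \<open>A\<close> are thus coded by their restrictions to \<open>Y\<close>.
  For finite \<open>Y\<close> and countable \<open>X\<close> this makes \<open>A\<close> countable;
  together with finite suborbits it makes the point stabilisers finite.\<close>

lemma base_determines:
  assumes base: "is_base G X (\<lambda>a. a) Y" and "a \<in> A" "b \<in> A" "\<And>y. y \<in> Y \<Longrightarrow> a y = b y"
  shows "a = b"
proof -
  have Y: "Y \<subseteq> X" using base by (simp add: is_base_def)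
  obtain b' where b': "b' \<in> A" "\<And>x. x \<in> X \<Longrightarrow> b' (b x) = x" "\<And>x. x \<in> X \<Longrightarrow> b (b' x) = x"
    using inverse [OF \<open>b \<in> A\<close>] by blast
  let ?c = "compose X b' a"
  have "?c \<in> A \<inter> (\<Inter>y\<in>Y. stabilizer G (\<lambda>a. a) y)"
    using assms b' Y compose_mem [of b' a] by (auto simp: stabilizer_def compose_eq subset_iff)
  then have "?c = \<one>\<^bsub>G\<^esub>"
    using base by (auto simp: is_base_def)
  then have "?c x = x" if "x \<in> X" for x
    using that by (simp add: one)
  then have "b' (a x) = x" if "x \<in> X" for x
    using that by (metis compose_eq)
  then show ?thesis
    using assms b' by (intro eqI) (metis closed)+
qed

lemma is_baseI:
  assumes "Y \<subseteq> X" "\<And>a x. a \<in> A \<Longrightarrow> \<forall>y\<in>Y. a y = y \<Longrightarrow> x \<in> X \<Longrightarrow> a x = x"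
  shows "is_base G X (\<lambda>a. a) Y"
  unfolding is_base_def
proof (intro conjI equalityI subsetI)
  fix a assume "a \<in> carrier G \<inter> (\<Inter>y\<in>Y. stabilizer G (\<lambda>a. a) y)"
  then show "a \<in> {\<one>\<^bsub>G\<^esub>}"
    using assms one_iff by (auto simp: stabilizer_def)
next
  fix a assume "a \<in> {\<one>\<^bsub>G\<^esub>}"
  then show "a \<in> carrier G \<inter> (\<Inter>y\<in>Y. stabilizer G (\<lambda>a. a) y)"
    using one_mem one \<open>Y \<subseteq> X\<close> by (auto simp: stabilizer_def)
qed (use assms in auto)

text \<open>The centraliser of \<open>a\<close> itself is not formed; elements of one coset of it
  do: infinitely many \<open>b\<close> share a single conjugate of \<open>a\<close>. A point moved
  by that conjugate is sent by each of these \<open>b\<close> to a point moved by \<open>a\<close>,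
  whereas only finitely many elements of \<open>A\<close> send a given point into a finite
  set.\<close>

lemma two_distinguishable_of_finite_base:
  assumes "countable X" "infinite A" and sub: "subdegree_finite G X (\<lambda>a. a)"
    and "finite Y" and base: "is_base G X (\<lambda>a. a) Y"
  shows "two_distinguishable G X (\<lambda>a. a)"
proof (rule two_distinguishable_of_infinite_motion)
  have Y: "Y \<subseteq> X" using base by (simp add: is_base_def)
  have inj: "inj_on (\<lambda>a. restrict a Y) A"
    by (intro inj_onI base_determines [OF base]) (metis restrict_apply')+
  have "countable ((\<lambda>a. restrict a Y) ` A)"
    by (rule countable_subset [OF _ countable_PiE [of Y "\<lambda>_. X"]])
      (use Y \<open>finite Y\<close> \<open>countable X\<close> in auto)
  then show "countable A"
    using inj by (rule countable_image_inj_on)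
  have stab: "finite {a\<in>A. a x = x}" if "x \<in> X" for x
  proof -
    let ?S = "{a\<in>A. a x = x}" and ?O = "\<lambda>y. {a y |a. a \<in> A \<and> a x = x}"
    have "finite (?O y)" if "y \<in> Y" for y
    proof -
      have "finite (orbit (G\<lparr>carrier := stabilizer G (\<lambda>a. a) x\<rparr>) (\<lambda>a. a) y)"
        using sub that Y \<open>x \<in> X\<close> unfolding subdegree_finite_def by blast
      then show ?thesis
        by (simp add: orbit_def stabilizer_def)
    qed
    then have "finite (PiE Y ?O)"
      using \<open>finite Y\<close> by (simp add: finite_PiE)
    moreover have "(\<lambda>a. restrict a Y) ` ?S \<subseteq> PiE Y ?O"
      by (auto simp: restrict_def split: if_splits)
    ultimately have "finite ((\<lambda>a. restrict a Y) ` ?S)"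
      by (rule finite_subset [rotated])
    then show ?thesis
      by (rule finite_imageD [OF _ inj_on_subset [OF inj]]) auto
  qed
  have few: "finite {a\<in>A. a x \<in> F}" if "finite F" "x \<in> X" for x F
  proof -
    have "{a\<in>A. a x \<in> F} = (\<Union>y\<in>F. {a\<in>A. a x = y})" by auto
    then show ?thesis
      using that stab finite_transporter by auto
  qed
  fix a s assume a: "a \<in> A" and s: "s \<in> X" "a s \<noteq> s"
  show "infinite {x\<in>X. a x \<noteq> x}"
  proof
    let ?S = "{x\<in>X. a x \<noteq> x}"
    assume "finite ?S"
    \<comment> \<open>Leaving out the \<open>b\<close> that bring \<open>s\<close> into the support
      of \<open>a\<close> ensures that the conjugate of \<open>a\<close> by \<open>b\<close> fixes
      \<open>s\<close>.\<close>
    then have D: "infinite (A - {b\<in>A. b s \<in> ?S})" (is "infinite ?D")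
      by (rule Diff_infinite_finite [OF few [OF _ \<open>s \<in> X\<close>] \<open>infinite A\<close>])
    have "\<exists>c\<in>A. c s = s \<and> (\<forall>x\<in>X. b (c x) = a (b x))" if "b \<in> ?D" for b
    proof -
      have "b \<in> A" using that by blast
      then obtain b' where b': "b' \<in> A" "\<And>x. x \<in> X \<Longrightarrow> b' (b x) = x" "\<And>x. x \<in> X \<Longrightarrow> b (b' x) = x"
        using inverse [of b] by blast
      show ?thesis
        by (rule bexI [of _ "compose X b' (compose X a b)"])
          (use that s b' a in \<open>auto intro: compose_mem simp: compose_eq\<close>)
    qed
    then have "\<forall>b\<in>?D. \<exists>c. c \<in> A \<and> c s = s \<and> (\<forall>x\<in>X. b (c x) = a (b x))"
      by blast
    then obtain cj where cj: "\<And>b. b \<in> ?D \<Longrightarrow> cj b \<in> A \<and> cj b s = s \<and> (\<forall>x\<in>X. b (cj b x) = a (b x))"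
      unfolding bchoice_iff by blast
    have "finite (cj ` ?D)"
      using cj by (intro finite_subset [OF _ stab [OF \<open>s \<in> X\<close>]]) auto
    then obtain b0 where b0: "b0 \<in> ?D" "infinite {b\<in>?D. cj b = cj b0}"
      using pigeonhole_infinite [OF D] by blast
    have "b0 \<in> A"
      using b0(1) by blast
    then have "s \<in> b0 ` X"
      using bij s(1) by (simp add: bij_betw_def)
    \<comment> \<open>The common conjugate moves \<open>x\<close>, because \<open>b0\<close> carries
      \<open>x\<close> to \<open>s\<close>, which \<open>a\<close> moves.\<close>
    then obtain x where x: "x \<in> X" "b0 x = s" by blast
    have "b0 (cj b0 x) = a s"
      using cj [OF b0(1)] x by blast
    then have "cj b0 x \<noteq> x"
      using s x by metis
    have "b x \<in> ?S" if "b \<in> ?D" "cj b = cj b0" for b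
    proof -
      have "cj b x \<noteq> x" "cj b \<in> A" "b \<in> A" "b (cj b x) = a (b x)"
        using that cj [OF that(1)] x \<open>cj b0 x \<noteq> x\<close> by auto
      then have "a (b x) \<noteq> b x"
        using eq_iff [of b "cj b x" x] x by auto
      then show ?thesis
        using \<open>b \<in> A\<close> x by simp
    qed
    then have "{b\<in>?D. cj b = cj b0} \<subseteq> {b\<in>A. b x \<in> ?S}"
      by blast
    then show False
      using b0(2) few [OF \<open>finite ?S\<close> \<open>x \<in> X\<close>] finite_subset by blast
  qed
qed

lemma infinite_points:
  assumes "infinite A" shows "infinite X"
proof
  assume "finite X"
  then have "finite (PiE X (\<lambda>_. X))"
    by (simp add: finite_PiE)
  moreover have "A \<subseteq> PiE X (\<lambda>_. X)"
    using Bij by (auto simp: PiE_def Bij_def)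
  ultimately show False
    using assms finite_subset by blast
qed

section \<open>Frobenius groups\<close>

lemma two_distinguishable_of_frobenius:
  assumes "countable X" "infinite A" and sub: "subdegree_finite G X (\<lambda>a. a)"
    and frob: "frobenius_action G X (\<lambda>a. a)"
  shows "two_distinguishable G X (\<lambda>a. a)"
proof -
  obtain Y where Y: "Y \<subseteq> X" "finite Y" "card Y = 2"
    using infinite_points [OF \<open>infinite A\<close>] by (meson infinite_arbitrarily_large)
  then obtain x y where xy: "Y = {x, y}" "x \<noteq> y"
    by (meson card_2_iff)
  have "is_base G X (\<lambda>a. a) Y"
  proof (rule is_baseI)
    fix a z assume "a \<in> A" "\<forall>y\<in>Y. a y = y" "z \<in> X"
    then have "a = \<one>\<^bsub>G\<^esub>"
      using frob xy Y unfolding frobenius_action_def by auto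
    then show "a z = z"
      using one_iff \<open>a \<in> A\<close> \<open>z \<in> X\<close> by blast
  qed (fact Y)
  then show ?thesis
    using assms Y two_distinguishable_of_finite_base by blast
qed

text \<open>By injectivity such an element maps the part of \<open>S\<close> in \<open>X\<close>
  into itself, and it is determined by its restriction there. Consequently an element of infinite
  order cannot have finite support.\<close>

lemma finite_supported:
  assumes "finite S"
  shows "finite {a\<in>A. \<forall>x\<in>X - S. a x = x}" (is "finite ?F")
proof -
  have inj: "inj_on (\<lambda>a. restrict a (X \<inter> S)) ?F"
  proof (intro inj_onI eqI)
    fix a b x assume *: "a \<in> ?F" "b \<in> ?F" "restrict a (X \<inter> S) = restrict b (X \<inter> S)" "x \<in> X"
    then show "a x = b x"
      by (cases "x \<in> S") (force dest: fun_cong [of _ _ x])+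
  qed auto
  have "a x \<in> S" if "a \<in> ?F" "x \<in> X \<inter> S" for a x
    using that by (metis (mono_tags, lifting) DiffI IntD1 IntD2 closed eq_iff mem_Collect_eq)
  then have "(\<lambda>a. restrict a (X \<inter> S)) ` ?F \<subseteq> PiE (X \<inter> S) (\<lambda>_. X \<inter> S)"
    by (auto simp: restrict_def split: if_splits)
  moreover have "finite (PiE (X \<inter> S) (\<lambda>_. X \<inter> S))"
    using assms by (simp add: finite_PiE)
  ultimately have "finite ((\<lambda>a. restrict a (X \<inter> S)) ` ?F)"
    by (rule finite_subset)
  then show ?thesis
    by (rule finite_imageD [OF _ inj])
qed

section \<open>Cyclic point stabilisers\<close>

lemma subgroup_stabilizer:
  assumes "x \<in> X" shows "subgroup {a\<in>A. a x = x} G"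
proof
  show "{a\<in>A. a x = x} \<subseteq> carrier G" by auto
  show "a \<otimes>\<^bsub>G\<^esub> b \<in> {a\<in>A. a x = x}" if "a \<in> {a\<in>A. a x = x}" "b \<in> {a\<in>A. a x = x}" for a b
    using that assms mult compose_mem by (simp add: compose_eq)
  show "\<one>\<^bsub>G\<^esub> \<in> {a\<in>A. a x = x}"
    using one one_mem assms by simp
  fix a assume a: "a \<in> {a\<in>A. a x = x}"
  then obtain b where b: "b \<in> A" "\<And>x. x \<in> X \<Longrightarrow> b (a x) = x"
    using inverse by (metis (mono_tags, lifting) mem_Collect_eq)
  have "compose X b a = \<one>\<^bsub>G\<^esub>"
    using a b by (subst one_iff) (auto simp: compose_eq compose_mem)
  then have "inv\<^bsub>G\<^esub> a = b"
    using a b mult group.inv_equality [OF group, of b a] by simp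
  then show "inv\<^bsub>G\<^esub> a \<in> {a\<in>A. a x = x}"
    using a b assms by (metis (mono_tags, lifting) mem_Collect_eq)
qed

lemma two_distinguishable_of_cyclic_stabilizer:
  assumes "countable X" "infinite A" and sub: "subdegree_finite G X (\<lambda>a. a)"
    and x: "x \<in> X" and cyc: "cyclic_group (G\<lparr>carrier := stabilizer G (\<lambda>a. a) x\<rparr>)"
  shows "two_distinguishable G X (\<lambda>a. a)"
proof (cases "finite {a\<in>A. a x = x}")
  case True
  \<comment> \<open>\<open>mv a\<close> is a point moved by \<open>a\<close>, or any point of
    \<open>X\<close> if there is none. Over the finite stabiliser of \<open>x\<close> these points,
    together with \<open>x\<close>, form a finite base.\<close>
  have "\<exists>y\<in>X. (\<exists>y\<in>X. a y \<noteq> y) \<longrightarrow> a y \<noteq> y" for a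
    using x by blast
  then obtain mv where mv: "\<And>a. mv a \<in> X" "\<And>a y. y \<in> X \<Longrightarrow> a y \<noteq> y \<Longrightarrow> a (mv a) \<noteq> mv a"
    by metis
  have "is_base G X (\<lambda>a. a) (insert x (mv ` {a\<in>A. a x = x}))"
    using mv x by (intro is_baseI) auto
  then show ?thesis
    using assms True by (intro two_distinguishable_of_finite_base) auto
next
  case False
  let ?S = "{a\<in>A. a x = x}"
  let ?H = "G\<lparr>carrier := ?S\<rparr>"
  have S: "stabilizer G (\<lambda>a. a) x = ?S"
    by (simp add: stabilizer_def)
  interpret H: group ?H
    by (rule subgroup.subgroup_is_group [OF subgroup_stabilizer [OF x] group])
  obtain g where g: "g \<in> ?S" and range: "?S = range (\<lambda>n::int. g [^]\<^bsub>?H\<^esub> n)"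
    using cyc H.cyclic_group unfolding S by auto
  have "inj (\<lambda>n::int. g [^]\<^bsub>?H\<^esub> n)"
    using H.infinite_cyclic_subgroup_int [of g] H.carrier_subgroup_generated_by_singleton [of g] g False range
    by (auto simp: inj_def)
  have count: "countable ?S"
    by (subst range) (rule countable_image, simp)
  have pow_fix: "(a [^]\<^bsub>?H\<^esub> n) y = y" if "a \<in> ?S" "y \<in> X" "a y = y" for a y and n :: nat
  proof (induction n)
    case 0
    then show ?case using that one by (simp add: H.nat_pow_0)
  next
    case (Suc n)
    have "a [^]\<^bsub>?H\<^esub> n \<in> ?S"
      using H.nat_pow_closed [of a n] that by simp
    then show ?case
      using Suc that mult by (simp add: compose_eq)
  qed
  have motion: "infinite {y\<in>X. a y \<noteq> y}" if a: "a \<in> ?S" "z \<in> X" "a z \<noteq> z" for a z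
  proof
    assume fin: "finite {y\<in>X. a y \<noteq> y}"
    obtain k :: int where k: "a = g [^]\<^bsub>?H\<^esub> k"
      using range a(1) by blast
    have "a \<noteq> \<one>\<^bsub>?H\<^esub>"
      using a one by auto
    then have "k \<noteq> 0"
      using k by auto
    \<comment> \<open>The powers of \<open>a\<close> are powers of \<open>g\<close> with exponents
      \<open>k * n\<close>, hence pairwise distinct, and each of them moves only points that
      \<open>a\<close> moves.\<close>
    have "a [^]\<^bsub>?H\<^esub> n = g [^]\<^bsub>?H\<^esub> (k * int n)" for n :: nat
      using g k H.int_pow_pow [of g k "int n"] by (simp add: int_pow_int)
    then have "inj (\<lambda>n::nat. a [^]\<^bsub>?H\<^esub> n)"
      by (intro injI) (use injD [OF \<open>inj (\<lambda>n::int. g [^]\<^bsub>?H\<^esub> n)\<close>] \<open>k \<noteq> 0\<close> in fastforce)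
    then have "infinite (range (\<lambda>n::nat. a [^]\<^bsub>?H\<^esub> n))"
      using finite_imageD infinite_UNIV_nat by blast
    moreover have "range (\<lambda>n::nat. a [^]\<^bsub>?H\<^esub> n) \<subseteq> {b\<in>A. \<forall>y\<in>X - {y\<in>X. a y \<noteq> y}. b y = y}"
    proof (clarify, intro CollectI conjI ballI)
      fix n :: nat
      show "a [^]\<^bsub>?H\<^esub> n \<in> A"
        using H.nat_pow_closed [of a n] a(1) by simp
      show "(a [^]\<^bsub>?H\<^esub> n) y = y" if "y \<in> X - {y\<in>X. a y \<noteq> y}" for y
        using pow_fix [OF a(1), of y n] that by blast
    qed
    ultimately show False
      using finite_supported [OF fin] finite_subset by blast
  qed
  let ?O = "(\<lambda>a. a x) ` A"
  show ?thesis
  proof (cases "finite ?O")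
    case True
    let ?A = "{a\<in>?S. \<exists>y\<in>X. a y \<noteq> y}"
    obtain c where c: "\<forall>y\<in>?O. c y = (y = x)" "\<forall>a\<in>?A. \<exists>y\<in>X. c (a y) \<noteq> c y"
    proof -
      have "\<exists>c :: 'x \<Rightarrow> bool. (\<forall>y\<in>?O. c y = (y = x)) \<and> (\<forall>a\<in>?A. \<exists>y\<in>X. c (a y) \<noteq> c y)"
      proof (rule coloring_of_infinite_motion)
        show "countable ?A"
          by (rule countable_subset [OF _ count]) auto
        show "inj_on a X" if "a \<in> ?A" for a
          using that bij bij_betw_imp_inj_on by blast
        show "infinite {y\<in>X. a y \<noteq> y}" if a: "a \<in> ?A" for a
        proof -
          obtain z where "z \<in> X" "a z \<noteq> z" "a \<in> ?S"
            using a by blast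
          then show ?thesis
            by (intro motion)
        qed
      qed (rule True)
      then show ?thesis by (elim exE conjE) (rule that)
    qed
    have "x \<in> ?O"
      using one_mem x by (force intro: image_eqI [of _ _ "\<lambda>x\<in>X. x"])
    then have "a \<in> ?S" if "a \<in> A" "\<forall>y\<in>X. c (a y) = c y" for a
    proof -
      have "a x \<in> ?O"
        using that by blast
      then have "a x = x"
        using c(1) that(2) x \<open>x \<in> ?O\<close> by metis
      then show ?thesis
        using that by blast
    qed
    then show ?thesis
      using c(2) by (intro two_distinguishableI [of c]) blast
  next
    case False
    show ?thesis
    proof (rule two_distinguishable_of_infinite_motion)
      have A: "A = (\<Union>y\<in>X. {a\<in>A. a x = y})"
        using x by auto
      have "countable (\<Union>y\<in>X. {a\<in>A. a x = y})"
        by (rule countable_UN [OF \<open>countable X\<close> countable_transporter [OF x count]])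
      then show "countable A"
        by (subst A)
      fix a z assume a: "a \<in> A" and z: "z \<in> X" "a z \<noteq> z"
      show "infinite {y\<in>X. a y \<noteq> y}"
      proof
        assume fin: "finite {y\<in>X. a y \<noteq> y}"
        \<comment> \<open>The finite support cannot contain the infinite orbit, so \<open>a\<close>
          fixes some \<open>b x\<close>. Conjugation by \<open>b\<close> brings \<open>a\<close>
          into the stabiliser of \<open>x\<close> and carries its support to another finite
          set.\<close>
        then have "\<not> ?O \<subseteq> {y\<in>X. a y \<noteq> y}"
          using False finite_subset by blast
        then obtain y where "y \<in> ?O" "y \<notin> {y\<in>X. a y \<noteq> y}" by blast
        then obtain b where b: "b \<in> A" "a (b x) = b x"
          using x by blast
        obtain b' where b': "b' \<in> A" "\<And>x. x \<in> X \<Longrightarrow> b' (b x) = x" "\<And>x. x \<in> X \<Longrightarrow> b (b' x) = x"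
          using inverse [OF b(1)] by blast
        let ?c = "compose X b' (compose X a b)"
        have c: "?c y = b' (a (b y))" if "y \<in> X" for y
          using that a b b' by (simp add: compose_eq)
        have "?c \<in> ?S"
          using a b b' x c by (auto intro: compose_mem)
        moreover have "?c (b' z) \<noteq> b' z"
          using c [of "b' z"] a b' z by (simp add: eq_iff)
        moreover have "{y\<in>X. ?c y \<noteq> y} \<subseteq> b' ` {y\<in>X. a y \<noteq> y}"
        proof
          fix y assume "y \<in> {y\<in>X. ?c y \<noteq> y}"
          then have "b y \<in> {y\<in>X. a y \<noteq> y}" "y = b' (b y)"
            using c a b b' by auto
          then show "y \<in> b' ` {y\<in>X. a y \<noteq> y}" by blast
        qed
        ultimately show False
          using motion [of ?c "b' z"] b' z fin by (meson closed finite_imageI finite_subset)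
      qed
    qed
  qed
qed

end

section \<open>Automorphism groups and general linear groups\<close>

lemma (in group) countable_generate:
  assumes T: "T \<subseteq> carrier G" "countable T"
  shows "countable (generate G T)"
proof -
  let ?L = "lists (T \<union> m_inv G ` T)"
  let ?p = "\<lambda>xs. foldr (\<otimes>) xs \<one>"
  have p: "?p xs \<in> carrier G" if "xs \<in> ?L" for xs
    using that T by (induction xs) auto
  have append: "?p (xs @ ys) = ?p xs \<otimes> ?p ys" if "xs \<in> ?L" "ys \<in> ?L" for xs ys
    using that
  proof (induction xs)
    case (Cons x xs)
    then have "x \<in> carrier G" using T by auto
    then show ?case
      using Cons p by (simp add: m_assoc)
  qed (use p in simp)
  have "x \<in> ?p ` ?L" if "x \<in> generate G T" for x
    using that
  proof induction
    case one
    show ?case by (rule image_eqI [of _ _ "[]"]) auto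
  next
    case (incl h)
    then show ?case using T by (intro image_eqI [of _ _ "[h]"]) auto
  next
    case (inv h)
    then show ?case using T by (intro image_eqI [of _ _ "[inv h]"]) auto
  next
    case (eng h1 h2)
    then obtain xs ys where *: "xs \<in> ?L" "ys \<in> ?L" "h1 = ?p xs" "h2 = ?p ys" by blast
    then have "xs @ ys \<in> ?L" by simp
    moreover have "h1 \<otimes> h2 = ?p (xs @ ys)"
      unfolding append [OF *(1,2)] *(3,4) ..
    ultimately show ?case
      by (rule rev_image_eqI)
  qed
  then have "generate G T \<subseteq> ?p ` ?L" by blast
  then show ?thesis
    by (rule countable_subset) (use T in simp)
qed

lemma (in group) hom_eq_on_generate:
  assumes "T \<subseteq> carrier G" "a \<in> hom G G" "b \<in> hom G G" "\<And>x. x \<in> T \<Longrightarrow> a x = b x"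
    and "x \<in> generate G T"
  shows "a x = b x"
proof -
  interpret a: group_hom G G a using assms by unfold_locales
  interpret b: group_hom G G b using assms by unfold_locales
  show ?thesis
    using assms(5)
  proof induction
    case (inv h)
    then have "h \<in> carrier G" using assms by auto
    then show ?case using inv assms by simp
  next
    case (eng h1 h2)
    then have "h1 \<in> carrier G" "h2 \<in> carrier G"
      using generate_in_carrier [OF assms(1)] by auto
    then show ?case using eng by simp
  qed (use assms in auto)
qed

lemma two_distinguishable_AutoGroup:
  fixes G (structure)
  assumes fg: "finitely_generated_group G" and inf: "infinite (carrier G)"
  shows "two_distinguishable (AutoGroup G) (carrier G) (\<lambda>a. a)"
proof -
  interpret group G using fg by (simp add: finitely_generated_group_def)
  obtain T where T: "finite T" "T \<subseteq> carrier G" "generate G T = carrier G"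
    using fg by (auto simp: finitely_generated_group_def)
  have count: "countable (carrier G)"
    using countable_generate [of T] T by (simp add: countable_finite)
  interpret perm: permutation_group "carrier G" "auto G"
    by (rule permutation_group.intro) (rule subgroup_auto)
  show ?thesis
    unfolding AutoGroup_def
  proof (rule perm.two_distinguishable_of_infinite_motion)
    have inj: "inj_on (\<lambda>a. restrict a T) (auto G)"
    proof (intro inj_onI perm.eqI)
      fix a b x assume *: "a \<in> auto G" "b \<in> auto G" "restrict a T = restrict b T" "x \<in> carrier G"
      then show "a x = b x"
        using hom_eq_on_generate [OF T(2), of a b x] T(3)
        by (metis IntD1 auto_def restrict_apply')
    qed
    have "(\<lambda>a. restrict a T) ` auto G \<subseteq> PiE T (\<lambda>_. carrier G)"
      using T(2) by (auto simp: restrict_def split: if_splits)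
    then have "countable ((\<lambda>a. restrict a T) ` auto G)"
      by (rule countable_subset) (use T count in \<open>auto intro: countable_PiE\<close>)
    then show "countable (auto G)"
      using inj by (rule countable_image_inj_on)
    fix a x assume a: "a \<in> auto G" and x: "x \<in> carrier G" "a x \<noteq> x"
    have hom: "a (u \<otimes> v) = a u \<otimes> a v" if "u \<in> carrier G" "v \<in> carrier G" for u v
      using a that hom_mult [of a G G u v] by (simp add: auto_def)
    let ?S = "{y \<in> carrier G. a y \<noteq> y}"
    show "infinite ?S"
    proof
      assume fin: "finite ?S"
      let ?H = "carrier G - ?S"
      \<comment> \<open>Translation by a moved \<open>x\<close> sends fixed elements to moved ones,
        injectively. With finitely many moved elements there would be finitely many fixed ones as
        well, and the whole group would be finite.\<close>
      have "(\<lambda>h. h \<otimes> x) ` ?H \<subseteq> ?S"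
        using x hom a perm.closed by auto
      moreover have "inj_on (\<lambda>h. h \<otimes> x) ?H"
        using x by (auto intro!: inj_onI)
      ultimately have "finite ?H"
        using fin by (meson finite_imageD finite_subset)
      then show False
        using fin inf by (metis (no_types, lifting) Diff_infinite_finite)
    qed
  qed
qed

section \<open>General linear groups over infinite fields\<close>

lemma scaling_rigid_subset_exists:
  assumes inf: "infinite (UNIV :: 'k::field set)"
  shows "\<exists>T :: 'k set. finite T \<and> card T = n + 3 \<and> 0 \<notin> T \<and> (\<forall>s. (*) s ` T = T \<longrightarrow> s = 1)"
proof -
  \<comment> \<open>Two elements are needed besides the new one, \<open>t\<close>: a scalar that
    sends no element of \<open>T0\<close> into \<open>T0\<close> would send all of them to the
    single point \<open>t\<close>. The free parameter \<open>n\<close> lets different basis vectors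
    receive sets of different sizes.\<close>
  obtain T0 :: "'k set" where T0: "finite T0" "card T0 = n + 2" "T0 \<subseteq> UNIV - {0}"
    using infinite_arbitrarily_large [of "UNIV - {0::'k}" "n + 2"] inf by (metis infinite_remove)
  \<comment> \<open>A symmetry \<open>s\<close> other than 1 would be a quotient of two elements of
    \<open>T0\<close>, and \<open>t\<close>, which it moves, would be \<open>s\<close> times an
    element of \<open>T0\<close>. \<open>Z\<close> collects all such products, with
    \<open>T0\<close> and 0.\<close>
  define Z where "Z = insert 0 (T0 \<union> (\<lambda>(x, y, z). x / y * z) ` (T0 \<times> T0 \<times> T0))"
  have "finite Z"
    using T0 by (simp add: Z_def)
  then obtain t where t: "t \<notin> Z"
    using inf ex_new_if_finite by blast
  have "t \<noteq> 0" "t \<notin> T0"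
    using t by (auto simp: Z_def)
  have "s = 1" if s: "(*) s ` insert t T0 = insert t T0" for s
  proof (rule ccontr)
    assume "s \<noteq> 1"
    have "s \<noteq> 0"
    proof
      assume "s = 0"
      then have "(*) s ` insert t T0 \<subseteq> {0}" by auto
      then show False
        using s \<open>t \<noteq> 0\<close> by auto
    qed
    have "\<exists>x\<in>T0. s * x \<in> T0"
    proof (rule ccontr)
      assume "\<not> (\<exists>x\<in>T0. s * x \<in> T0)"
      then have "(*) s ` T0 \<subseteq> {t}"
        using s by auto
      then have "card ((*) s ` T0) \<le> 1"
        using card_mono [of "{t}"] by auto
      moreover have "card ((*) s ` T0) = card T0"
        using \<open>s \<noteq> 0\<close> by (intro card_image) (auto simp: inj_on_def)
      ultimately show False
        using T0 by simp
    qed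
    then obtain x y where xy: "x \<in> T0" "y \<in> T0" "y = s * x" by blast
    obtain z where "z \<in> insert t T0" "t = s * z"
      using s by blast
    then have z: "z \<in> T0" "t = s * z"
      using \<open>s \<noteq> 1\<close> \<open>t \<noteq> 0\<close> by auto
    have "x \<noteq> 0"
      using xy T0 by auto
    then have "t = y / x * z"
      using xy z by simp
    then have "t \<in> (\<lambda>(x, y, z). x / y * z) ` (T0 \<times> T0 \<times> T0)"
      using xy z by (intro image_eqI [of _ _ "(y, x, z)"]) auto
    then show False
      using t by (simp add: Z_def)
  qed
  then show ?thesis
    using T0 \<open>t \<noteq> 0\<close> \<open>t \<notin> T0\<close> by (intro exI [of _ "insert t T0"]) auto
qed

lemma two_distinguishable_general_linear_group:
  fixes smul :: "'k::field \<Rightarrow> 'v::ab_group_add \<Rightarrow> 'v"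
  assumes inf: "infinite (UNIV :: 'k set)" and fd: "finite_dimensional_vector_space smul B"
  shows "two_distinguishable (general_linear_group smul) (UNIV :: 'v set) (\<lambda>a. a)"
proof -
  interpret finite_dimensional_vector_space smul B by (fact fd)
  interpret vector_space_pair smul smul by unfold_locales
  let ?GL = "{f. Vector_Spaces.linear smul smul f \<and> bij f}"
  have GL: "inv\<^bsub>BijGroup UNIV\<^esub> f \<in> ?GL" if f: "f \<in> ?GL" for f
  proof -
    let ?g = "inv_into UNIV f"
    have "f \<in> Bij UNIV"
      using that by (simp add: Bij_def)
    then have "inv\<^bsub>BijGroup UNIV\<^esub> f = ?g"
      by (simp add: inv_BijGroup restrict_UNIV)
    moreover have "Vector_Spaces.linear smul smul ?g"
    proof -
      obtain g where g: "Vector_Spaces.linear smul smul g" "g \<circ> f = id"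
        using linear_injective_left_inverse [of f] f bij_is_inj by blast
      have "g = ?g"
      proof (intro ext)
        fix x
        have "f (?g x) = x"
          using f by (simp add: bij_is_surj surj_f_inv_f)
        then show "g x = ?g x"
          using fun_cong [OF g(2), of "?g x"] by simp
      qed
      then show ?thesis
        using g by simp
    qed
    ultimately show ?thesis
      using that by (simp add: bij_imp_bij_inv)
  qed
  interpret perm: permutation_group UNIV ?GL
  proof (rule permutation_group.intro, unfold subgroup_def, intro conjI allI impI)
    show "?GL \<subseteq> carrier (BijGroup UNIV)"
      by (auto simp: BijGroup_def Bij_def)
    show "f \<otimes>\<^bsub>BijGroup UNIV\<^esub> g \<in> ?GL" if "f \<in> ?GL" "g \<in> ?GL" for f g
    proof -
      have "f \<otimes>\<^bsub>BijGroup UNIV\<^esub> g = f \<circ> g"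
        using that by (simp add: BijGroup_def Bij_def compose_def fun_eq_iff)
      then show ?thesis
        using that by (auto intro: Vector_Spaces.linear_compose bij_comp)
    qed
    show "\<one>\<^bsub>BijGroup UNIV\<^esub> \<in> ?GL"
      using linear_id by (simp add: BijGroup_def restrict_UNIV id_def [symmetric])
  qed (use GL in auto)
  obtain idx :: "'v \<Rightarrow> nat" where idx: "inj_on idx B"
    using finite_Basis finite_imp_inj_to_nat_seg by metis
  obtain T :: "nat \<Rightarrow> 'k set" where T: "\<And>n. finite (T n)" "\<And>n. card (T n) = n + 3"
      "\<And>n. 0 \<notin> T n" "\<And>n s. (*) s ` T n = T n \<Longrightarrow> s = 1"
    using scaling_rigid_subset_exists [OF inf] by metis
  define c where "c v \<longleftrightarrow> (\<exists>b\<in>B. \<exists>t\<in>T (idx b). v = smul t b)" for v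
  have line: "b = b' \<and> t = t'" if "b \<in> B" "b' \<in> B" "t \<noteq> 0" "smul t b = smul t' b'" for b b' t t'
  proof -
    have "b = b'"
    proof (rule ccontr)
      assume "b \<noteq> b'"
      have "b = smul (inverse t) (smul t b)"
        using \<open>t \<noteq> 0\<close> by simp
      also have "\<dots> = smul (inverse t * t') b'"
        using that by simp
      also have "\<dots> \<in> span (B - {b})"
        using that \<open>b \<noteq> b'\<close> by (intro span_scale span_base) auto
      finally show False
        using independent_Basis that dependent_def by blast
    qed
    moreover have "b \<noteq> 0"
      using independent_Basis that dependent_zero by blast
    ultimately show ?thesis
      using that by auto
  qed
  have c_line: "c (smul s b) \<longleftrightarrow> s \<in> T (idx b)" if "b \<in> B" for s b
  proof
    assume "c (smul s b)"
    then obtain b' t where "b' \<in> B" "t \<in> T (idx b')" "smul t b' = smul s b"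
      unfolding c_def by metis
    then show "s \<in> T (idx b)"
      using line [of b' b t s] T(3) that by metis
  qed (use that in \<open>auto simp: c_def\<close>)
  show ?thesis
    unfolding general_linear_group_def
  proof (rule perm.two_distinguishableI [of c])
    fix f x assume f: "f \<in> ?GL" and c: "\<forall>v\<in>UNIV. c (f v) = c v"
    then have lin: "Vector_Spaces.linear smul smul f" by simp
    have "f b = b" if b: "b \<in> B" for b
    proof -
      have "card (T (idx b)) \<noteq> 0"
        using T(2) by simp
      then obtain t where t: "t \<in> T (idx b)"
        by (metis card.empty ex_in_conv)
      then have "c (f (smul t b))"
        using c c_line b by simp
      then obtain b' t' where b': "b' \<in> B" "smul t (f b) = smul t' b'" "t' \<in> T (idx b')"
        unfolding c_def linear_scale [OF lin] by metis
      define s where "s = inverse t * t'"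
      have "t \<noteq> 0" "t' \<noteq> 0"
        using t b' T(3) by metis+
      then have "s \<noteq> 0"
        by (simp add: s_def)
      have "f b = smul (inverse t) (smul t (f b))"
        using \<open>t \<noteq> 0\<close> by simp
      then have fb: "f b = smul s b'"
        using b' by (simp add: s_def)
      \<comment> \<open>\<open>f\<close> matches the coloured multiples of \<open>b\<close> with
        those of \<open>b'\<close>, so multiplication by \<open>s\<close> carries one set of scalars
        onto the other. Equal sizes then force \<open>b = b'\<close>, and rigidity of the set forces
        \<open>s = 1\<close>.\<close>
      have iff: "r * s \<in> T (idx b') \<longleftrightarrow> r \<in> T (idx b)" for r
        using c c_line [OF b, of r] c_line [OF b'(1), of "r * s"] linear_scale [OF lin, of r b] fb
        by (metis UNIV_I scale_scale)
      have img: "(*) s ` T (idx b) = T (idx b')"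
      proof (intro equalityI subsetI)
        fix r assume "r \<in> T (idx b')"
        then have "r / s \<in> T (idx b)"
          using iff [of "r / s"] \<open>s \<noteq> 0\<close> by simp
        then show "r \<in> (*) s ` T (idx b)"
          using \<open>s \<noteq> 0\<close> by (intro image_eqI [of _ _ "r / s"]) auto
      qed (use iff in \<open>auto simp: mult.commute\<close>)
      moreover have "card ((*) s ` T (idx b)) = card (T (idx b))"
        using \<open>s \<noteq> 0\<close> by (intro card_image) (auto simp: inj_on_def)
      ultimately have "idx b = idx b'"
        using T(2) by (metis add_right_cancel)
      then have "b = b'"
        using idx b b' by (meson inj_onD)
      then have "s = 1"
        using img T(4) by blast
      then show ?thesis
        using fb \<open>b = b'\<close> by simp
    qed
    then show "f x = x"
      using linear_eq_on [OF lin linear_id, of x B] span_Basis by auto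
  qed
qed

section \<open>Sides of a set at a point\<close>

text \<open>Only the germ of \<sigma> at \<open>p\<close> matters, and only off \<open>K\<close>.
  Being written with filters alone, the notion is carried along by any map that matches
  neighbourhood filters, without bookkeeping of open sets.\<close>

definition constant_off :: "'s topology \<Rightarrow> 's set \<Rightarrow> 's \<Rightarrow> ('s \<Rightarrow> bool) \<Rightarrow> bool" where
  "constant_off T K p \<sigma> \<longleftrightarrow>
     (\<forall>\<^sub>F x in nhdsin T p. x \<notin> K \<longrightarrow> (\<forall>\<^sub>F y in nhdsin T x. y \<notin> K \<longrightarrow> \<sigma> y = \<sigma> x))"

text \<open>Without the second clause constant functions would qualify. It puts \<open>p\<close> in
  the closure of both the true and the false side.\<close>

definition side_function :: "'s topology \<Rightarrow> 's set \<Rightarrow> 's \<Rightarrow> ('s \<Rightarrow> bool) \<Rightarrow> bool" where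
  "side_function T K p \<sigma> \<longleftrightarrow>
     constant_off T K p \<sigma> \<and> (\<forall>b. \<exists>\<^sub>F x in nhdsin T p. x \<notin> K \<and> \<sigma> x = b)"

text \<open>The first clause gives at least two local sides, the second at most two. The first is
  asked at all points of \<open>K\<close> near \<open>p\<close>, so that side functions at
  neighbouring points can be compared.\<close>

definition two_sided :: "'s topology \<Rightarrow> 's set \<Rightarrow> 's \<Rightarrow> bool" where
  "two_sided T K p \<longleftrightarrow>
     (\<exists>\<sigma>. (\<forall>\<^sub>F q in nhdsin T p. q \<in> K \<longrightarrow> side_function T K q \<sigma>) \<and>
          (\<forall>\<tau>. constant_off T K p \<tau> \<longrightarrow> (\<exists>\<phi>. \<forall>\<^sub>F x in nhdsin T p. x \<notin> K \<longrightarrow> \<tau> x = \<phi> (\<sigma> x))))"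

definition one_sided :: "'s topology \<Rightarrow> 's set \<Rightarrow> 's \<Rightarrow> bool" where
  "one_sided T K p \<longleftrightarrow>
     (\<forall>\<tau>. constant_off T K p \<tau> \<longrightarrow> (\<exists>b. \<forall>\<^sub>F x in nhdsin T p. x \<notin> K \<longrightarrow> \<tau> x = b))"

lemma nhdsin_euclidean: "nhdsin euclidean = nhds"
  by (rule ext, rule filter_eqI) (simp add: eventually_nhdsin eventually_nhds)

section \<open>Arcs in the plane\<close>

text \<open>Janiszewski's theorem, applied to \<open>K\<close> and \<open>L \<union> - N\<close>.\<close>

lemma locally_connected_complement:
  fixes K :: "complex set"
  assumes K: "compact K" and L: "closed L" "connected L" "L \<subseteq> K" "p \<notin> L"
    and N: "open N" "p \<in> N" "K - L \<subseteq> N"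
  shows "\<forall>\<^sub>F x in nhds p. \<forall>\<^sub>F y in nhds p. connected_component (- K) x y \<longrightarrow> connected_component (N - K) x y"
proof -
  have "open (N - L)" "p \<in> N - L"
    using L N by auto
  then obtain e where e: "e > 0" "ball p e \<subseteq> N - L"
    using open_contains_ball by blast
  have *: "connected_component (N - K) x y"
    if xy: "x \<in> ball p e" "y \<in> ball p e" "connected_component (- K) x y" for x y
  proof -
    \<comment> \<open>This intersection is connected, as Janiszewski's theorem requires; it holds
      because the rest of \<open>K\<close> lies in \<open>N\<close>. The ball joins \<open>x\<close>
      to \<open>y\<close> off the second closed set.\<close>
    have "K \<inter> (L \<union> - N) = L"
      using L N by blast
    moreover have "closed (L \<union> - N)"
      using L N by (simp add: closed_Compl closed_Un)
    moreover have "connected_component (- (L \<union> - N)) x y"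
      using e xy by (intro connected_componentI [of "ball p e"]) auto
    ultimately have "connected_component (- (K \<union> (L \<union> - N))) x y"
      using Janiszewski [of K "L \<union> - N" x y] K xy \<open>connected L\<close> by simp
    moreover have "- (K \<union> (L \<union> - N)) = N - K"
      using L by blast
    ultimately show ?thesis by simp
  qed
  have "\<forall>\<^sub>F x in nhds p. x \<in> ball p e"
    using e by (intro eventually_nhds_in_open) auto
  then show ?thesis
    by (rule eventually_mono) (use \<open>\<forall>\<^sub>F x in nhds p. x \<in> ball p e\<close> * in \<open>auto elim: eventually_mono\<close>)
qed

lemma constant_on_component:
  fixes K :: "'a::topological_space set"
  assumes const: "\<And>x. x \<in> N - K \<Longrightarrow> \<forall>\<^sub>F y in nhds x. y \<notin> K \<longrightarrow> \<tau> y = \<tau> x"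
    and "connected_component (N - K) x y"
  shows "\<tau> x = (\<tau> y :: bool)"
proof -
  obtain C where C: "connected C" "C \<subseteq> N - K" "x \<in> C" "y \<in> C"
    using assms(2) by (auto simp: connected_component_def)
  have "\<tau> constant_on C"
  proof (rule locally_constant_imp_constant [OF C(1)])
    fix a assume "a \<in> C"
    then have "a \<in> N - K"
      using C by blast
    from const [OF this] obtain U where U: "open U" "a \<in> U" "\<forall>y\<in>U. y \<notin> K \<longrightarrow> \<tau> y = \<tau> a"
      by (auto simp: eventually_nhds)
    show "\<exists>T. openin (top_of_set C) T \<and> a \<in> T \<and> (\<forall>x\<in>T. \<tau> x = \<tau> a)"
      using U C \<open>a \<in> C\<close> by (intro exI [of _ "C \<inter> U"]) auto
  qed
  then show ?thesis
    using C by (auto simp: constant_on_def)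
qed

text \<open>Otherwise the inverse of the parametrisation would map a nonempty open set of the plane
  continuously and injectively into the line. It follows that an arc is the frontier of its
  complement.\<close>

lemma interior_arc_image:
  fixes \<gamma> :: "real \<Rightarrow> complex"
  assumes "arc \<gamma>" shows "interior (path_image \<gamma>) = {}"
proof (rule ccontr)
  assume ne: "interior (path_image \<gamma>) \<noteq> {}"
  obtain h where h: "homeomorphism {0..1} (path_image \<gamma>) \<gamma> h"
    using homeomorphism_arc [OF assms] by metis
  have "continuous_on (path_image \<gamma>) h" "inj_on h (path_image \<gamma>)"
    using h by (auto simp: homeomorphism_def inj_on_def) metis
  then have "DIM(complex) \<le> DIM(real)"
    using ne interior_subset [of "path_image \<gamma>"]
    by (intro invariance_of_dimension [of "interior (path_image \<gamma>)" h])
      (auto intro: continuous_on_subset inj_on_subset)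
  then show False by simp
qed

text \<open>This puts \<open>\<gamma> r\<close> on a Jordan curve. The complement of the arc is open
  and connected, with the arc as its frontier. Frontier points accessible from the complement are
  dense, so one can be found on each side of \<open>r\<close>, and the two are joined through the
  complement; which parameters \<open>s\<close> and \<open>t\<close> occur does not matter.\<close>

lemma arc_extends_to_closed_curve:
  fixes \<gamma> :: "real \<Rightarrow> complex"
  assumes \<gamma>: "arc \<gamma>" and r: "0 < r" "r < 1"
  obtains s t \<delta> where "0 \<le> s" "s < r" "r < t" "t \<le> 1" "arc \<delta>" "pathstart \<delta> = \<gamma> t" "pathfinish \<delta> = \<gamma> s"
    "path_image \<delta> \<inter> path_image \<gamma> \<subseteq> {\<gamma> s, \<gamma> t}"
proof -
  let ?K = "path_image \<gamma>"
  have clo: "closed ?K"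
    using \<gamma> by (simp add: closed_arc_image)
  have front: "frontier (- ?K) = ?K"
    using interior_arc_image [OF \<gamma>] clo unfolding frontier_complement by (simp add: frontier_def)
  obtain h where h: "homeomorphism {0..1} ?K \<gamma> h"
    using homeomorphism_arc [OF \<gamma>] by metis
  have *: "openin (top_of_set ?K) (\<gamma> ` ({0..1} \<inter> U))" if "open U" for U
    using homeomorphism_imp_open_map [OF h, of "{0..1} \<inter> U"] that by auto
  have "openin (top_of_set (frontier (- ?K))) (\<gamma> ` ({0..1} \<inter> {r<..}))"
    "openin (top_of_set (frontier (- ?K))) (\<gamma> ` ({0..1} \<inter> {..<r}))"
    unfolding front by (intro * open_greaterThan open_lessThan)+
  moreover have "\<gamma> ` ({0..1} \<inter> {r<..}) \<noteq> {}" "\<gamma> ` ({0..1} \<inter> {..<r}) \<noteq> {}"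
    using r by (auto simp: disjoint_iff intro: bexI [of _ 0] exI [of _ 1])
  moreover have inj: "inj_on \<gamma> {0..1}"
    using \<gamma> by (simp add: arc_def)
  moreover have "\<gamma> ` ({0..1} \<inter> {r<..}) \<noteq> \<gamma> ` ({0..1} \<inter> {..<r})"
  proof
    assume eq: "\<gamma> ` ({0..1} \<inter> {r<..}) = \<gamma> ` ({0..1} \<inter> {..<r})"
    have "\<gamma> 1 \<in> \<gamma> ` ({0..1} \<inter> {r<..})" using r by auto
    then obtain u where "u \<in> {0..1}" "u < r" "\<gamma> 1 = \<gamma> u"
      unfolding eq by auto
    then show False
      using inj_onD [OF inj, of 1 u] r by auto
  qed
  ultimately obtain \<delta> where \<delta>: "arc \<delta>" "pathstart \<delta> \<in> \<gamma> ` ({0..1} \<inter> {r<..})"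
      "pathfinish \<delta> \<in> \<gamma> ` ({0..1} \<inter> {..<r})" "\<delta> ` {0<..<1} \<subseteq> - ?K"
    using dense_accessible_frontier_point_pairs [of "- ?K"] clo connected_arc_complement [OF \<gamma>]
    by (metis DIM_complex open_Compl order_refl)
  then obtain s t where st: "0 \<le> s" "s < r" "r < t" "t \<le> 1" "pathstart \<delta> = \<gamma> t" "pathfinish \<delta> = \<gamma> s"
    by auto
  have "path_image \<delta> = insert (\<delta> 0) (insert (\<delta> 1) (\<delta> ` {0<..<1}))"
  proof -
    have "{0..1::real} = insert 0 (insert 1 {0<..<1})" by auto
    then show ?thesis by (simp add: path_image_def)
  qed
  then have "path_image \<delta> \<inter> ?K \<subseteq> {\<gamma> s, \<gamma> t}"
    using \<delta>(4) st(5,6) by (auto simp: pathstart_def pathfinish_def)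
  then show ?thesis
    using that \<delta>(1) st by blast
qed

lemma constant_off_nhds:
  assumes "constant_off euclidean K p \<sigma>"
  obtains N where "open N" "p \<in> N" "\<And>x. x \<in> N - K \<Longrightarrow> \<forall>\<^sub>F y in nhds x. y \<notin> K \<longrightarrow> \<sigma> y = \<sigma> x"
  using assms unfolding constant_off_def nhdsin_euclidean eventually_nhds [of _ p] by auto

lemma arc_image_near:
  fixes \<gamma> :: "real \<Rightarrow> 'a::real_normed_vector"
  assumes "arc \<gamma>" "open N" "\<gamma> r \<in> N" "0 \<le> r" "r \<le> 1"
  obtains d where "d > 0" "\<And>u. \<lbrakk>0 \<le> u; u \<le> 1; \<bar>u - r\<bar> < d\<rbrakk> \<Longrightarrow> \<gamma> u \<in> N"
proof -
  have "continuous_on {0..1} \<gamma>"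
    using assms by (simp add: arc_def path_def)
  then have "\<exists>U. open U \<and> U \<inter> {0..1} = \<gamma> -` N \<inter> {0..1}"
    using \<open>open N\<close> unfolding continuous_on_open_invariant by blast
  then obtain U where U: "open U" "U \<inter> {0..1} = \<gamma> -` N \<inter> {0..1}" by blast
  have "r \<in> \<gamma> -` N \<inter> {0..1}"
    using assms by simp
  then have "r \<in> U"
    unfolding U(2) [symmetric] by blast
  then obtain d where "d > 0" "ball r d \<subseteq> U"
    using U open_contains_ball by blast
  have "\<gamma> u \<in> N" if "0 \<le> u" "u \<le> 1" "\<bar>u - r\<bar> < d" for u
  proof -
    have "u \<in> U \<inter> {0..1}"
      using that \<open>ball r d \<subseteq> U\<close> by (auto simp: dist_real_def abs_minus_commute)
    then show ?thesis
      unfolding U(2) by simp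
  qed
  then show ?thesis
    using that \<open>d > 0\<close> by blast
qed

text \<open>A planar arc does not separate the plane. With a tail of the arc as the connected set
  \<open>L\<close>, Janiszewski's theorem localises this: points off the arc that are close to its
  start are joined off the arc inside any given neighbourhood, so a locally constant function has
  only one value there.\<close>

theorem one_sided_arc_start:
  fixes \<gamma> :: "real \<Rightarrow> complex"
  assumes \<gamma>: "arc \<gamma>"
  shows "one_sided euclidean (path_image \<gamma>) (\<gamma> 0)"
  unfolding one_sided_def
proof (intro allI impI)
  fix \<tau> assume const: "constant_off euclidean (path_image \<gamma>) (\<gamma> 0) \<tau>"
  let ?K = "path_image \<gamma>"
  obtain N where N: "open N" "\<gamma> 0 \<in> N" and
    \<tau>: "\<And>x. x \<in> N - ?K \<Longrightarrow> \<forall>\<^sub>F y in nhds x. y \<notin> ?K \<longrightarrow> \<tau> y = \<tau> x"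
    using constant_off_nhds [OF const] by blast
  obtain d where d: "d > 0" "\<And>u. \<lbrakk>0 \<le> u; u \<le> 1; \<bar>u - 0\<bar> < d\<rbrakk> \<Longrightarrow> \<gamma> u \<in> N"
    using arc_image_near [OF \<gamma> N] by auto
  define e where "e = min (d / 2) 1"
  have e: "0 < e" "e \<le> 1" "e < d"
    using d by (auto simp: e_def)
  have inj: "inj_on \<gamma> {0..1}" and cont: "continuous_on {0..1} \<gamma>"
    using \<gamma> by (auto simp: arc_def path_def)
  have cont': "continuous_on {e..1} \<gamma>"
    by (rule continuous_on_subset [OF cont]) (use e in auto)
  have "closed (\<gamma> ` {e..1})" "connected (\<gamma> ` {e..1})"
    using compact_continuous_image [OF cont'] connected_continuous_image [OF cont']
    by (auto intro: compact_imp_closed)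
  moreover have "\<gamma> ` {e..1} \<subseteq> ?K"
    using e by (auto simp: path_image_def)
  moreover have "\<gamma> 0 \<notin> \<gamma> ` {e..1}"
  proof
    assume "\<gamma> 0 \<in> \<gamma> ` {e..1}"
    then obtain u where "u \<in> {e..1}" "\<gamma> 0 = \<gamma> u" by blast
    then show False
      using inj_onD [OF inj, of 0 u] e by auto
  qed
  moreover have "?K - \<gamma> ` {e..1} \<subseteq> N"
  proof
    fix x assume "x \<in> ?K - \<gamma> ` {e..1}"
    then obtain u where "u \<in> {0..1}" "x = \<gamma> u" "x \<notin> \<gamma> ` {e..1}"
      by (auto simp: path_image_def)
    then show "x \<in> N"
      using d(2) [of u] e by (cases "e \<le> u") auto
  qed
  ultimately have near: "\<forall>\<^sub>F x in nhds (\<gamma> 0). \<forall>\<^sub>F y in nhds (\<gamma> 0).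
      connected_component (- ?K) x y \<longrightarrow> connected_component (N - ?K) x y"
    using N by (intro locally_connected_complement [of _ "\<gamma> ` {e..1}"] compact_arc_image \<gamma>)
  have conn: "connected_component (- ?K) x y" if "x \<notin> ?K" "y \<notin> ?K" for x y
    using connected_arc_complement [OF \<gamma>] that by (auto simp: connected_component_def)
  have "\<exists>b. \<forall>\<^sub>F x in nhds (\<gamma> 0). x \<notin> ?K \<longrightarrow> \<tau> x = b"
  proof (cases "\<exists>\<^sub>F x in nhds (\<gamma> 0). x \<notin> ?K")
    case True
    from frequently_eventually_conj [OF True near]
    obtain x where x: "x \<notin> ?K" "\<forall>\<^sub>F y in nhds (\<gamma> 0).
      connected_component (- ?K) x y \<longrightarrow> connected_component (N - ?K) x y"
      using frequently_ex by blast
    have "\<forall>\<^sub>F y in nhds (\<gamma> 0). y \<notin> ?K \<longrightarrow> \<tau> y = \<tau> x"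
      using x(2)
    proof (rule eventually_mono, intro impI)
      fix y assume "y \<notin> ?K" "connected_component (- ?K) x y \<longrightarrow> connected_component (N - ?K) x y"
      then show "\<tau> y = \<tau> x"
        using constant_on_component [OF \<tau>, where x = x and y = y] conn x by blast
    qed
    then show ?thesis by blast
  next
    case False
    then have "\<forall>\<^sub>F x in nhds (\<gamma> 0). x \<notin> ?K \<longrightarrow> \<tau> x = True"
      by (simp add: not_frequently eventually_mono)
    then show ?thesis by blast
  qed
  then show "\<exists>b. \<forall>\<^sub>F x in nhdsin euclidean (\<gamma> 0). x \<notin> ?K \<longrightarrow> \<tau> x = b"
    by (simp add: nhdsin_euclidean)
qed

text \<open>A subarc around \<open>\<gamma> r\<close> is closed up to a Jordan curve, and \<sigma>
  tells one complementary component from the other. There are at least two sides because each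
  component has the whole curve as its frontier, and at most two because points near
  \<open>\<gamma> r\<close> in the same component are already joined close to
  \<open>\<gamma> r\<close>.\<close>

theorem two_sided_arc_interior:
  fixes \<gamma> :: "real \<Rightarrow> complex"
  assumes \<gamma>: "arc \<gamma>" and r: "0 < r" "r < 1"
  shows "two_sided euclidean (path_image \<gamma>) (\<gamma> r)"
proof -
  let ?K = "path_image \<gamma>" and ?p = "\<gamma> r"
  obtain s t \<delta> where st: "0 \<le> s" "s < r" "r < t" "t \<le> 1"
    and \<delta>: "arc \<delta>" "pathstart \<delta> = \<gamma> t" "pathfinish \<delta> = \<gamma> s" "path_image \<delta> \<inter> ?K \<subseteq> {\<gamma> s, \<gamma> t}"
    using arc_extends_to_closed_curve [OF \<gamma> r] by metis
  have inj: "inj_on \<gamma> {0..1}" and cont: "continuous_on {0..1} \<gamma>"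
    using \<gamma> by (auto simp: arc_def path_def)
  let ?J = "path_image (subpath s t \<gamma> +++ \<delta>)"
  have sub: "path_image (subpath s t \<gamma>) = \<gamma> ` {s..t}"
    using st by (simp add: path_image_subpath)
  have subK: "\<gamma> ` {a..b} \<subseteq> ?K" if "0 \<le> a" "b \<le> 1" for a b
    using that by (auto simp: path_image_def)
  have J: "?J = \<gamma> ` {s..t} \<union> path_image \<delta>"
    using \<delta> by (simp add: path_image_join sub)
  have simple: "simple_path (subpath s t \<gamma> +++ \<delta>)"
    using \<gamma> \<delta> st subK [of s t] sub by (intro simple_path_join_loop arc_subpath_arc) auto
  have loop: "pathfinish (subpath s t \<gamma> +++ \<delta>) = pathstart (subpath s t \<gamma> +++ \<delta>)"
    using \<delta> by simp
  obtain I O' where IO: "open I" "connected I" "open O'" "connected O'" "I \<inter> O' = {}" "I \<union> O' = - ?J"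
      "frontier I = ?J" "frontier O' = ?J"
    using Jordan_curve [OF simple loop] by metis
  define \<sigma> where "\<sigma> x \<longleftrightarrow> x \<in> I" for x
  have far: "?p \<notin> \<gamma> ` {0..s} \<union> \<gamma> ` {t..1} \<union> path_image \<delta>"
  proof
    assume "?p \<in> \<gamma> ` {0..s} \<union> \<gamma> ` {t..1} \<union> path_image \<delta>"
    moreover have "?p \<in> ?K"
      using r by (simp add: path_image_def)
    moreover have "\<gamma> s \<in> \<gamma> ` {0..s}" "\<gamma> t \<in> \<gamma> ` {t..1}"
      using st by auto
    ultimately have "?p \<in> \<gamma> ` {0..s} \<union> \<gamma> ` {t..1}"
      using \<delta>(4) by auto
    then obtain u where "u \<in> {0..s} \<union> {t..1}" "\<gamma> r = \<gamma> u" by blast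
    then show False
      using inj_onD [OF inj, of r u] st r by auto
  qed
  have comp: "compact (\<gamma> ` {a..b})" "connected (\<gamma> ` {a..b})" if "0 \<le> a" "b \<le> 1" for a b
    by (intro compact_continuous_image connected_continuous_image continuous_on_subset [OF cont];
        use that in auto)+
  \<comment> \<open>On \<open>M\<close>, away from the remaining ends of the arc and from the
    closing arc \<delta>, the arc and the Jordan curve coincide.\<close>
  define M where "M = - (\<gamma> ` {0..s} \<union> \<gamma> ` {t..1} \<union> path_image \<delta>)"
  have "closed (\<gamma> ` {0..s})" "closed (\<gamma> ` {t..1})" "closed (path_image \<delta>)"
    using comp [of 0 s] comp [of t 1] st \<delta>(1) by (simp_all add: compact_imp_closed closed_arc_image)
  then have M: "open M" "?p \<in> M"
    using far unfolding M_def by (auto simp only: intro!: open_Compl closed_Un)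
  have KJ: "x \<in> ?K \<longleftrightarrow> x \<in> ?J" if "x \<in> M" for x
  proof -
    have "{0..1} = {0..s} \<union> {s..t} \<union> {t..1}"
      using st by auto
    then have "?K = \<gamma> ` {0..s} \<union> \<gamma> ` {s..t} \<union> \<gamma> ` {t..1}"
      unfolding path_image_def by (metis image_Un)
    then show ?thesis
      using that J by (auto simp: M_def)
  qed
  have const: "\<forall>\<^sub>F y in nhds x. y \<notin> ?K \<longrightarrow> \<sigma> y = \<sigma> x" if "x \<in> M - ?K" for x
  proof -
    have "x \<in> I \<union> O'"
      unfolding IO(6) using that KJ [of x] by simp
    then consider "x \<in> I" | "x \<in> O'"
      by blast
    then show ?thesis
    proof cases
      case 1
      then show ?thesis
        using IO(1) by (intro eventually_mono [OF eventually_nhds_in_open [of I]]) (auto simp: \<sigma>_def)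
    next
      case 2
      then show ?thesis
        using IO by (intro eventually_mono [OF eventually_nhds_in_open [of O']]) (auto simp: \<sigma>_def)
    qed
  qed
  have side: "side_function euclidean ?K q \<sigma>" if q: "q \<in> M" "q \<in> ?K" for q
    unfolding side_function_def constant_off_def nhdsin_euclidean
  proof (intro conjI allI)
    show "\<forall>\<^sub>F x in nhds q. x \<notin> ?K \<longrightarrow> (\<forall>\<^sub>F y in nhds x. y \<notin> ?K \<longrightarrow> \<sigma> y = \<sigma> x)"
      using const q M by (intro eventually_mono [OF eventually_nhds_in_open [of M]]) auto
    fix b
    have "q \<in> frontier I" "q \<in> frontier O'"
      using IO q KJ by auto
    then have clos: "q \<in> closure I" "q \<in> closure O'"
      by (auto simp: frontier_def)
    have "\<exists>x\<in>U. x \<notin> ?K \<and> \<sigma> x = b" if "open U" "q \<in> U" for U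
    proof -
      have "open (U \<inter> M)" "q \<in> U \<inter> M"
        using that M q by auto
      then have "\<exists>x\<in>I. x \<in> U \<inter> M" "\<exists>x\<in>O'. x \<in> U \<inter> M"
        using clos closure_iff_nhds_not_empty [of q] by blast+
      then obtain x y where xy: "x \<in> I" "x \<in> U" "x \<in> M" "y \<in> O'" "y \<in> U" "y \<in> M"
        by blast
      then have "x \<notin> ?K" "\<sigma> x" "y \<notin> ?K" "\<not> \<sigma> y"
        using IO(5,6) KJ by (auto simp: \<sigma>_def)
      then show ?thesis
        using xy by (cases b) auto
    qed
    then show "\<exists>\<^sub>F x in nhds q. x \<notin> ?K \<and> \<sigma> x = b"
      unfolding frequently_def eventually_nhds by blast
  qed
  have "\<exists>\<phi>. \<forall>\<^sub>F x in nhds ?p. x \<notin> ?K \<longrightarrow> \<tau> x = \<phi> (\<sigma> x)"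
    if \<tau>: "constant_off euclidean ?K ?p \<tau>" for \<tau>
  proof -
    obtain N0 where N0: "open N0" "?p \<in> N0" and
      \<tau>0: "\<And>x. x \<in> N0 - ?K \<Longrightarrow> \<forall>\<^sub>F y in nhds x. y \<notin> ?K \<longrightarrow> \<tau> y = \<tau> x"
      using constant_off_nhds [OF \<tau>] by blast
    define N where "N = N0 \<inter> M"
    have N: "open N" "?p \<in> N"
      using N0 M by (auto simp: N_def)
    have \<tau>': "\<forall>\<^sub>F y in nhds x. y \<notin> ?J \<longrightarrow> \<tau> y = \<tau> x" if "x \<in> N - ?J" for x
    proof -
      have "\<forall>\<^sub>F y in nhds x. y \<notin> ?K \<longrightarrow> \<tau> y = \<tau> x"
        using \<tau>0 [of x] that KJ by (auto simp: N_def)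
      moreover have "\<forall>\<^sub>F y in nhds x. y \<in> M"
        using M that by (intro eventually_nhds_in_open) (auto simp: N_def)
      ultimately show ?thesis
        by eventually_elim (use KJ in blast)
    qed
    obtain d where d: "d > 0" "\<And>u. \<lbrakk>0 \<le> u; u \<le> 1; \<bar>u - r\<bar> < d\<rbrakk> \<Longrightarrow> \<gamma> u \<in> N"
      using arc_image_near [OF \<gamma> N] r by auto
    \<comment> \<open>The averages keep \<open>s1\<close> and \<open>t1\<close> strictly between
      \<open>s\<close> and \<open>t\<close>; the bounds with \<open>d / 2\<close> keep the piece
      between them inside \<open>N\<close>.\<close>
    define s1 where "s1 = max ((s + r) / 2) (r - d / 2)"
    define t1 where "t1 = min ((t + r) / 2) (r + d / 2)"
    have st1: "s < s1" "s1 < r" "r < t1" "t1 < t" "r - d < s1" "t1 < r + d"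
      using d st by (auto simp: s1_def t1_def less_max_iff_disj min_less_iff_disj)
    \<comment> \<open>\<open>L\<close> is the Jordan curve without a short open piece around
      \<open>\<gamma> r\<close>. It stays connected because \<delta> joins the two remaining pieces
      of the arc.\<close>
    define L where "L = \<gamma> ` {s..s1} \<union> (path_image \<delta> \<union> \<gamma> ` {t1..t})"
    have inK: "\<gamma> s \<in> path_image \<delta>" "\<gamma> t \<in> path_image \<delta>"
      using \<delta>(2,3) by (metis pathfinish_in_path_image pathstart_in_path_image)+
    have "closed L"
      using comp [of s s1] comp [of t1 t] st st1 \<delta>(1)
      by (auto simp: L_def compact_imp_closed closed_arc_image intro!: closed_Un)
    moreover have "connected L"
      unfolding L_def
    proof (intro connected_Un)
      show "connected (path_image \<delta>)"
        using \<delta>(1) by (simp add: connected_arc_image)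
      show "path_image \<delta> \<inter> \<gamma> ` {t1..t} \<noteq> {}"
        using inK st1 by auto
      have "\<gamma> s \<in> \<gamma> ` {s..s1}"
        using st1 by auto
      then show "\<gamma> ` {s..s1} \<inter> (path_image \<delta> \<union> \<gamma> ` {t1..t}) \<noteq> {}"
        using inK by blast
    qed (use comp [of s s1] comp [of t1 t] st st1 in auto)
    moreover have "L \<subseteq> ?J"
      using st1 st by (auto simp: L_def J)
    moreover have "?p \<notin> L"
    proof
      assume "?p \<in> L"
      then have "?p \<in> \<gamma> ` {s..s1} \<union> \<gamma> ` {t1..t}"
        using far by (auto simp: L_def)
      then obtain u where "u \<in> {s..s1} \<union> {t1..t}" "\<gamma> r = \<gamma> u" by blast
      then show False
        using inj_onD [OF inj, of r u] st st1 r by auto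
    qed
    moreover have "?J - L \<subseteq> N"
    proof
      fix x assume x: "x \<in> ?J - L"
      then obtain u where "u \<in> {s..t}" "x = \<gamma> u" "\<not> u \<le> s1" "\<not> t1 \<le> u"
        by (force simp: J L_def)
      then show "x \<in> N"
        using d(2) [of u] st st1 by (auto simp: abs_less_iff)
    qed
    ultimately have near: "\<forall>\<^sub>F x in nhds ?p. \<forall>\<^sub>F y in nhds ?p.
        connected_component (- ?J) x y \<longrightarrow> connected_component (N - ?J) x y"
      using N simple by (intro locally_connected_complement [of _ L] compact_simple_path_image)
    have conn: "connected_component (- ?J) x y" if "x \<notin> ?J" "y \<notin> ?J" "\<sigma> x = \<sigma> y" for x y
    proof -
      have "x \<in> I \<and> y \<in> I \<or> x \<in> O' \<and> y \<in> O'"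
        using that IO(6) by (auto simp: \<sigma>_def)
      then show ?thesis
        using IO(2,4,6) unfolding connected_component_def by blast
    qed
    have vals: "\<exists>v. \<forall>\<^sub>F y in nhds ?p. y \<notin> ?K \<longrightarrow> \<sigma> y = b \<longrightarrow> \<tau> y = v" for b
    proof -
      have pK: "?p \<in> ?K"
        using r by (auto simp: path_image_def)
      have "\<exists>\<^sub>F x in nhds ?p. x \<notin> ?K \<and> \<sigma> x = b"
        using side [OF M(2) pK] by (simp add: side_function_def nhdsin_euclidean)
      from frequently_eventually_conj [OF this eventually_conj [OF near eventually_nhds_in_open [OF M]]]
      obtain x where x: "x \<notin> ?K" "\<sigma> x = b" "x \<in> M" "\<forall>\<^sub>F y in nhds ?p.
        connected_component (- ?J) x y \<longrightarrow> connected_component (N - ?J) x y"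
        using frequently_ex by blast
      have "\<forall>\<^sub>F y in nhds ?p. y \<notin> ?K \<longrightarrow> \<sigma> y = b \<longrightarrow> \<tau> y = \<tau> x"
        using x(4) eventually_nhds_in_open [OF M]
      proof (eventually_elim, intro impI)
        fix y assume "connected_component (- ?J) x y \<longrightarrow> connected_component (N - ?J) x y"
          "y \<in> M" "y \<notin> ?K" "\<sigma> y = b"
        then show "\<tau> y = \<tau> x"
          using constant_on_component [OF \<tau>', where x = x and y = y] conn [of x y] x KJ by blast
      qed
      then show ?thesis by blast
    qed
    then obtain \<phi> where "\<And>b. \<forall>\<^sub>F y in nhds ?p. y \<notin> ?K \<longrightarrow> \<sigma> y = b \<longrightarrow> \<tau> y = \<phi> b"
      by metis
    from this [of True] this [of False]
    have "\<forall>\<^sub>F x in nhds ?p. x \<notin> ?K \<longrightarrow> \<tau> x = \<phi> (\<sigma> x)"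
      by eventually_elim metis
    then show ?thesis by blast
  qed
  moreover have "\<forall>\<^sub>F q in nhds ?p. q \<in> ?K \<longrightarrow> side_function euclidean ?K q \<sigma>"
    using side M by (intro eventually_mono [OF eventually_nhds_in_open [of M]]) auto
  ultimately show ?thesis
    unfolding two_sided_def nhdsin_euclidean by blast
qed

section \<open>Neighbourhood filters\<close>

lemma eventually_eventually_nhdsin:
  assumes "\<forall>\<^sub>F x in nhdsin T p. P x"
  shows "\<forall>\<^sub>F x in nhdsin T p. P x \<and> (\<forall>\<^sub>F y in nhdsin T x. P y)"
proof (cases "p \<in> topspace T")
  case True
  then obtain N where N: "openin T N" "p \<in> N" "\<forall>x\<in>N. P x"
    using assms by (auto simp: eventually_nhdsin)
  have "P x \<and> (\<forall>\<^sub>F y in nhdsin T x. P y)" if "x \<in> N" for x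
    using N that by (auto simp: eventually_nhdsin)
  then show ?thesis
    using N by (auto simp: eventually_nhdsin)
qed (simp add: eventually_nhdsin)

lemma eventually_nhdsin_self:
  "\<forall>\<^sub>F x in nhdsin T p. P x \<Longrightarrow> p \<in> topspace T \<Longrightarrow> P p"
  by (auto simp: eventually_nhdsin)

lemma eventually_nhdsin_open:
  "openin T N \<Longrightarrow> p \<in> N \<Longrightarrow> \<forall>\<^sub>F x in nhdsin T p. x \<in> N"
  by (auto simp: eventually_nhdsin)

lemma eventually_nhdsin_topspace: "\<forall>\<^sub>F x in nhdsin T p. x \<in> topspace T"
  by (auto simp: eventually_nhdsin)

lemma constant_off_cong:
  assumes "\<forall>\<^sub>F x in nhdsin T p. (x \<in> K \<longleftrightarrow> x \<in> K') \<and> (x \<notin> K \<longrightarrow> \<sigma> x = \<sigma>' x)"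
    and "constant_off T K p \<sigma>"
  shows "constant_off T K' p \<sigma>'"
  using eventually_eventually_nhdsin [OF assms(1)] assms(2)
  unfolding constant_off_def
proof eventually_elim
  case (elim x)
  show ?case
  proof
    assume x: "x \<notin> K'"
    then have "\<forall>\<^sub>F y in nhdsin T x. y \<notin> K \<longrightarrow> \<sigma> y = \<sigma> x"
      using elim by blast
    moreover have "\<forall>\<^sub>F y in nhdsin T x. (y \<in> K \<longleftrightarrow> y \<in> K') \<and> (y \<notin> K \<longrightarrow> \<sigma> y = \<sigma>' y)"
      and "\<sigma> x = \<sigma>' x"
      using elim x by blast+
    ultimately show "\<forall>\<^sub>F y in nhdsin T x. y \<notin> K' \<longrightarrow> \<sigma>' y = \<sigma>' x"
      by (auto elim: eventually_elim2)
  qed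
qed

lemma side_function_cong:
  assumes "\<forall>\<^sub>F x in nhdsin T p. (x \<in> K \<longleftrightarrow> x \<in> K') \<and> (x \<notin> K \<longrightarrow> \<sigma> x = \<sigma>' x)"
    and "side_function T K p \<sigma>"
  shows "side_function T K' p \<sigma>'"
  unfolding side_function_def
proof (intro conjI allI)
  show "constant_off T K' p \<sigma>'"
    using constant_off_cong [OF assms(1)] assms(2) by (simp add: side_function_def)
  fix b
  have "\<exists>\<^sub>F x in nhdsin T p. x \<notin> K \<and> \<sigma> x = b"
    using assms(2) by (simp add: side_function_def)
  from frequently_eventually_conj [OF this assms(1)]
  show "\<exists>\<^sub>F x in nhdsin T p. x \<notin> K' \<and> \<sigma>' x = b"
    by (rule frequently_elim1) auto
qed

lemma two_sided_cong:
  assumes eq: "\<forall>\<^sub>F x in nhdsin T p. x \<in> K \<longleftrightarrow> x \<in> K'" and "two_sided T K p"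
  shows "two_sided T K' p"
proof -
  obtain \<sigma> where \<sigma>: "\<forall>\<^sub>F q in nhdsin T p. q \<in> K \<longrightarrow> side_function T K q \<sigma>"
    and uniq: "\<And>\<tau>. constant_off T K p \<tau> \<Longrightarrow> \<exists>\<phi>. \<forall>\<^sub>F x in nhdsin T p. x \<notin> K \<longrightarrow> \<tau> x = \<phi> (\<sigma> x)"
    using assms(2) by (auto simp: two_sided_def)
  have "\<forall>\<^sub>F q in nhdsin T p. q \<in> K' \<longrightarrow> side_function T K' q \<sigma>"
    using \<sigma> eventually_eventually_nhdsin [OF eq]
  proof eventually_elim
    case (elim q)
    then show ?case
      using side_function_cong [where T = T and p = q and K = K and K' = K' and \<sigma> = \<sigma> and \<sigma>' = \<sigma>] by simp
  qed
  moreover have "\<exists>\<phi>. \<forall>\<^sub>F x in nhdsin T p. x \<notin> K' \<longrightarrow> \<tau> x = \<phi> (\<sigma> x)" if "constant_off T K' p \<tau>" for \<tau>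
  proof -
    have "constant_off T K p \<tau>"
      using constant_off_cong [where T = T and p = p and K = K' and K' = K and \<sigma> = \<tau> and \<sigma>' = \<tau>] that eq by (simp add: eq_commute)
    then obtain \<phi> where "\<forall>\<^sub>F x in nhdsin T p. x \<notin> K \<longrightarrow> \<tau> x = \<phi> (\<sigma> x)"
      using uniq by blast
    with eq have "\<forall>\<^sub>F x in nhdsin T p. x \<notin> K' \<longrightarrow> \<tau> x = \<phi> (\<sigma> x)"
      by eventually_elim auto
    then show ?thesis by blast
  qed
  ultimately show ?thesis
    unfolding two_sided_def by blast
qed

lemma one_sided_cong:
  assumes eq: "\<forall>\<^sub>F x in nhdsin T p. x \<in> K \<longleftrightarrow> x \<in> K'" and "one_sided T K p"
  shows "one_sided T K' p"
  unfolding one_sided_def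
proof (intro allI impI)
  fix \<tau> assume "constant_off T K' p \<tau>"
  then have "constant_off T K p \<tau>"
    using constant_off_cong [where T = T and p = p and K = K' and K' = K and \<sigma> = \<tau> and \<sigma>' = \<tau>] eq by (simp add: eq_commute)
  then obtain b where "\<forall>\<^sub>F x in nhdsin T p. x \<notin> K \<longrightarrow> \<tau> x = b"
    using assms(2) unfolding one_sided_def by blast
  with eq have "\<forall>\<^sub>F x in nhdsin T p. x \<notin> K' \<longrightarrow> \<tau> x = b"
    by eventually_elim auto
  then show "\<exists>b. \<forall>\<^sub>F x in nhdsin T p. x \<notin> K' \<longrightarrow> \<tau> x = b" by blast
qed

text \<open>The transfer of sides knows a chart through this identity, and through injectivity where
  a function has to be pushed forward. With the whole space as \<open>U\<close> the identity also
  covers self-homeomorphisms.\<close>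

lemma nhdsin_homeomorphic_map:
  assumes f: "homeomorphic_map T (subtopology S U) f" and U: "openin S U" and z: "z \<in> topspace T"
  shows "nhdsin S (f z) = filtermap f (nhdsin T z)"
proof (rule filter_eqI)
  fix P
  have sub: "topspace (subtopology S U) = U"
    using U openin_subset [of S U] by (simp add: Int_absorb1)
  have fz: "f ` topspace T = U"
    using homeomorphic_imp_surjective_map [OF f] sub by simp
  show "eventually P (nhdsin S (f z)) \<longleftrightarrow> eventually P (filtermap f (nhdsin T z))"
  proof
    assume "eventually P (nhdsin S (f z))"
    then obtain V where V: "openin S V" "f z \<in> V" "\<forall>x\<in>V. P x"
      using fz U z by (auto simp: eventually_nhdsin dest: openin_subset)
    have "openin (subtopology S U) (U \<inter> V)"
      using V by (simp add: openin_subtopology_Int2)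
    then have "openin T {w \<in> topspace T. f w \<in> U \<inter> V}"
      using homeomorphic_imp_continuous_map [OF f] openin_continuous_map_preimage by blast
    then show "eventually P (filtermap f (nhdsin T z))"
      unfolding eventually_filtermap eventually_nhdsin
      using V z fz by (intro disjI2 exI [of _ "{w \<in> topspace T. f w \<in> U \<inter> V}"]) auto
  next
    assume "eventually P (filtermap f (nhdsin T z))"
    then obtain W where W: "openin T W" "z \<in> W" "\<forall>w\<in>W. P (f w)"
      using z by (auto simp: eventually_filtermap eventually_nhdsin)
    have "openin (subtopology S U) (f ` W)"
      using homeomorphic_imp_open_map [OF f] W by (auto simp: open_map_def)
    then have "openin S (f ` W)"
      using U by (simp add: openin_open_subtopology)
    then show "eventually P (nhdsin S (f z))"
      unfolding eventually_nhdsin using W by (intro disjI2 exI [of _ "f ` W"]) auto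
  qed
qed

section \<open>Transfer of sides along maps that match neighbourhood filters\<close>

context
  fixes S :: "'s topology" and T :: "'t topology" and f :: "'t \<Rightarrow> 's"
  assumes nhdsin_f: "\<And>z. z \<in> topspace T \<Longrightarrow> nhdsin S (f z) = filtermap f (nhdsin T z)"
begin

lemma constant_off_transfer:
  assumes "z \<in> topspace T"
  shows "constant_off S K (f z) \<sigma> \<longleftrightarrow> constant_off T (f -` K) z (\<sigma> \<circ> f)"
proof -
  have "constant_off S K (f z) \<sigma> \<longleftrightarrow>
      (\<forall>\<^sub>F w in nhdsin T z. f w \<notin> K \<longrightarrow> (\<forall>\<^sub>F y in nhdsin S (f w). y \<notin> K \<longrightarrow> \<sigma> y = \<sigma> (f w)))"
    by (simp add: constant_off_def nhdsin_f assms eventually_filtermap)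
  also have "\<dots> \<longleftrightarrow> (\<forall>\<^sub>F w in nhdsin T z. f w \<notin> K \<longrightarrow> (\<forall>\<^sub>F y in nhdsin T w. f y \<notin> K \<longrightarrow> \<sigma> (f y) = \<sigma> (f w)))"
    by (rule eventually_cong [OF eventually_nhdsin_topspace]) (simp add: nhdsin_f eventually_filtermap)
  finally show ?thesis
    by (simp add: constant_off_def)
qed

lemma side_function_transfer:
  assumes "z \<in> topspace T"
  shows "side_function S K (f z) \<sigma> \<longleftrightarrow> side_function T (f -` K) z (\<sigma> \<circ> f)"
  unfolding side_function_def constant_off_transfer [OF assms]
  by (simp add: nhdsin_f assms frequently_filtermap)

lemma one_sided_transfer:
  assumes z: "z \<in> topspace T" and "one_sided T (f -` K) z"
  shows "one_sided S K (f z)"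
  unfolding one_sided_def
proof (intro allI impI)
  fix \<tau> assume "constant_off S K (f z) \<tau>"
  then obtain b where "\<forall>\<^sub>F x in nhdsin T z. f x \<notin> K \<longrightarrow> \<tau> (f x) = b"
    using assms(2) unfolding one_sided_def constant_off_transfer [OF z] by fastforce
  then show "\<exists>b. \<forall>\<^sub>F x in nhdsin S (f z). x \<notin> K \<longrightarrow> \<tau> x = b"
    by (auto simp: nhdsin_f z eventually_filtermap)
qed

lemma two_sided_transfer:
  assumes z: "z \<in> topspace T" and inj: "inj_on f (topspace T)" and "two_sided T (f -` K) z"
  shows "two_sided S K (f z)"
proof -
  obtain \<sigma> where \<sigma>: "\<forall>\<^sub>F q in nhdsin T z. q \<in> f -` K \<longrightarrow> side_function T (f -` K) q \<sigma>"
    and uniq: "\<And>\<tau>. constant_off T (f -` K) z \<tau> \<Longrightarrow>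
        \<exists>\<phi>. \<forall>\<^sub>F x in nhdsin T z. x \<notin> f -` K \<longrightarrow> \<tau> x = \<phi> (\<sigma> x)"
    using assms(3) by (auto simp: two_sided_def)
  \<comment> \<open>Outside the image of \<open>f\<close> the values are arbitrary; near
    \<open>f z\<close> only points of the image occur.\<close>
  define \<sigma>' where "\<sigma>' = \<sigma> \<circ> inv_into (topspace T) f"
  have \<sigma>': "(\<sigma>' \<circ> f) w = \<sigma> w" if "w \<in> topspace T" for w
    using inj that by (simp add: \<sigma>'_def)
  have "\<forall>\<^sub>F q in nhdsin T z. f q \<in> K \<longrightarrow> side_function S K (f q) \<sigma>'"
    using \<sigma> eventually_nhdsin_topspace
  proof eventually_elim
    case (elim q)
    have "\<forall>\<^sub>F x in nhdsin T q. \<sigma> x = (\<sigma>' \<circ> f) x"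
      using eventually_nhdsin_topspace [of T q] by eventually_elim (rule \<sigma>' [symmetric])
    then show ?case
      using elim side_function_cong [where T = T and p = q and K = "f -` K" and K' = "f -` K" and \<sigma> = \<sigma> and \<sigma>' = "\<sigma>' \<circ> f"]
      by (simp add: side_function_transfer eventually_mono)
  qed
  then have "\<forall>\<^sub>F q in nhdsin S (f z). q \<in> K \<longrightarrow> side_function S K q \<sigma>'"
    by (simp add: nhdsin_f z eventually_filtermap)
  moreover have "\<exists>\<phi>. \<forall>\<^sub>F x in nhdsin S (f z). x \<notin> K \<longrightarrow> \<tau> x = \<phi> (\<sigma>' x)"
    if \<tau>: "constant_off S K (f z) \<tau>" for \<tau>
  proof -
    obtain \<phi> where "\<forall>\<^sub>F x in nhdsin T z. x \<notin> f -` K \<longrightarrow> (\<tau> \<circ> f) x = \<phi> (\<sigma> x)"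
      using uniq \<tau> unfolding constant_off_transfer [OF z] by blast
    then have "\<forall>\<^sub>F x in nhdsin T z. f x \<notin> K \<longrightarrow> \<tau> (f x) = \<phi> (\<sigma>' (f x))"
      using eventually_nhdsin_topspace [of T z] by eventually_elim (use \<sigma>' in auto)
    then show ?thesis
      by (auto simp: nhdsin_f z eventually_filtermap)
  qed
  ultimately show ?thesis
    unfolding two_sided_def by blast
qed

end

section \<open>Arcs in a surface\<close>

definition arc_between :: "'s topology \<Rightarrow> 's set \<Rightarrow> 's \<Rightarrow> 's \<Rightarrow> bool" where
  "arc_between S K p q \<longleftrightarrow>
     (\<exists>\<gamma>. embedding_map (top_of_set {0..1::real}) S \<gamma> \<and> \<gamma> ` {0..1} = K \<and> \<gamma> 0 = p \<and> \<gamma> 1 = q)"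

lemma embedding_map_interval:
  assumes "embedding_map (top_of_set {0..1::real}) S \<gamma>"
  shows "continuous_map (top_of_set {0..1}) S \<gamma>" "inj_on \<gamma> {0..1}" "\<And>u. u \<in> {0..1} \<Longrightarrow> \<gamma> u \<in> topspace S"
proof -
  have "homeomorphic_map (top_of_set {0..1::real}) (subtopology S (\<gamma> ` {0..1})) \<gamma>"
    using assms by (simp add: embedding_map_def)
  then show "continuous_map (top_of_set {0..1}) S \<gamma>" "inj_on \<gamma> {0..1}"
    using homeomorphic_imp_continuous_map homeomorphic_imp_injective_map
    by (fastforce simp: continuous_map_in_subtopology)+
  then show "\<And>u. u \<in> {0..1} \<Longrightarrow> \<gamma> u \<in> topspace S"
    by (auto simp: continuous_map_def Pi_iff)
qed

lemma embedding_map_interval_iff: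
  assumes "Hausdorff_space S"
  shows "embedding_map (top_of_set {0..1::real}) S \<gamma> \<longleftrightarrow>
    continuous_map (top_of_set {0..1}) S \<gamma> \<and> inj_on \<gamma> {0..1}"
proof
  assume "continuous_map (top_of_set {0..1}) S \<gamma> \<and> inj_on \<gamma> {0..1}"
  then show "embedding_map (top_of_set {0..1::real}) S \<gamma>"
    using assms by (intro continuous_imp_embedding_map) (auto intro: compact_space_subtopology)
qed (use embedding_map_interval in blast)

text \<open>The order of \<open>a\<close> and \<open>b\<close> is free, so that reversal of an arc
  is the case of 1 and 0.\<close>

lemma arc_between_subarc:
  assumes H: "Hausdorff_space S" and \<gamma>: "embedding_map (top_of_set {0..1::real}) S \<gamma>"
    and ab: "a \<in> {0..1}" "b \<in> {0..1}" "a \<noteq> b"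
  shows "arc_between S (\<gamma> ` closed_segment a b) (\<gamma> a) (\<gamma> b)"
  unfolding arc_between_def
proof (intro exI conjI)
  let ?l = "\<lambda>t. (1 - t) * a + t * b"
  have img: "?l ` {0..1} = closed_segment a b"
    by (simp add: closed_segment_def image_def) (auto simp: mult.commute)
  have sub: "closed_segment a b \<subseteq> {0..1}"
    using ab by (intro closed_segment_subset) auto
  have "continuous_map (top_of_set {0..1}) (top_of_set {0..1}) ?l"
    using img sub by (auto simp: continuous_map_in_subtopology intro!: continuous_intros)
  moreover have "inj_on ?l {0..1}"
  proof (rule inj_onI)
    fix s t assume "(1 - s) * a + s * b = (1 - t) * a + t * b"
    then have "(s - t) * (b - a) = 0" by (simp add: algebra_simps)
    then show "s = t" using ab by simp
  qed
  ultimately show "embedding_map (top_of_set {0..1}) S (\<gamma> \<circ> ?l)"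
    using embedding_map_interval(1,2) [OF \<gamma>] img sub unfolding embedding_map_interval_iff [OF H]
    by (intro conjI continuous_map_compose [of _ "top_of_set {0..1}"] comp_inj_on)
      (auto intro: inj_on_subset)
  show "(\<gamma> \<circ> ?l) ` {0..1} = \<gamma> ` closed_segment a b"
    using img by (metis image_comp)
qed auto

lemma arc_between_commute:
  assumes "Hausdorff_space S" "arc_between S K p q" shows "arc_between S K q p"
proof -
  obtain \<gamma> where \<gamma>: "embedding_map (top_of_set {0..1::real}) S \<gamma>" "\<gamma> ` {0..1} = K" "\<gamma> 0 = p" "\<gamma> 1 = q"
    using assms by (auto simp: arc_between_def)
  then show ?thesis
    using arc_between_subarc [OF assms(1) \<gamma>(1), of 1 0] by (simp add: closed_segment_eq_real_ivl)
qed

lemma arc_between_split: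
  assumes H: "Hausdorff_space S" and K: "arc_between S K p q" and x: "x \<in> K - {p, q}"
  obtains K1 K2 where "arc_between S K1 x p" "arc_between S K2 x q" "K1 \<union> K2 = K" "K1 \<inter> K2 = {x}"
proof -
  obtain \<gamma> where \<gamma>: "embedding_map (top_of_set {0..1::real}) S \<gamma>" "\<gamma> ` {0..1} = K" "\<gamma> 0 = p" "\<gamma> 1 = q"
    using K by (auto simp: arc_between_def)
  then obtain r where r: "r \<in> {0..1}" "x = \<gamma> r" "r \<noteq> 0" "r \<noteq> 1"
    using x by blast
  have inj: "inj_on \<gamma> {0..1}"
    using embedding_map_interval [OF \<gamma>(1)] by blast
  show ?thesis
  proof
    show "arc_between S (\<gamma> ` {0..r}) x p" "arc_between S (\<gamma> ` {r..1}) x q"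
      using arc_between_subarc [OF H \<gamma>(1), of r 0] arc_between_subarc [OF H \<gamma>(1), of r 1] r \<gamma>
      by (simp_all add: closed_segment_eq_real_ivl split: if_splits)
    have "{0..1} = {0..r} \<union> {r..1}"
      using r by auto
    then show "\<gamma> ` {0..r} \<union> \<gamma> ` {r..1} = K"
      using \<gamma>(2) by (metis image_Un)
    have "\<gamma> ` {0..r} \<inter> \<gamma> ` {r..1} = \<gamma> ` ({0..r} \<inter> {r..1})"
      using inj_on_image_Int [OF inj, of "{0..r}" "{r..1}"] r by simp
    moreover have "{0..r} \<inter> {r..1} = {r}"
      using r by auto
    ultimately show "\<gamma> ` {0..r} \<inter> \<gamma> ` {r..1} = {x}"
      using r by simp
  qed
qed

lemma arc_between_topspace:
  assumes "arc_between S K p q" shows "K \<subseteq> topspace S" "p \<in> K" "q \<in> K" "p \<noteq> q"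
proof -
  obtain \<gamma> where \<gamma>: "embedding_map (top_of_set {0..1::real}) S \<gamma>" "\<gamma> ` {0..1} = K" "\<gamma> 0 = p" "\<gamma> 1 = q"
    using assms by (auto simp: arc_between_def)
  show "K \<subseteq> topspace S"
    using embedding_map_interval(3) [OF \<gamma>(1)] \<gamma>(2) by blast
  show "p \<in> K" "q \<in> K"
    using \<gamma> by (auto intro: rev_image_eqI)
  show "p \<noteq> q"
    using inj_onD [OF embedding_map_interval(2) [OF \<gamma>(1)], of 0 1] \<gamma> by auto
qed

lemma compactin_image_interval:
  assumes "embedding_map (top_of_set {0..1::real}) S \<gamma>" "0 \<le> a" "b \<le> 1"
  shows "compactin S (\<gamma> ` {a..b})"
proof -
  have "compactin (top_of_set {0..1::real}) {a..b}"
    using assms by (auto simp: compactin_subtopology)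
  then show ?thesis
    using embedding_map_interval(1) [OF assms(1)] image_compactin by blast
qed

lemma arc_between_closed:
  assumes "Hausdorff_space S" "arc_between S K p q" shows "compactin S K" "closedin S K"
proof -
  obtain \<gamma> where \<gamma>: "embedding_map (top_of_set {0..1::real}) S \<gamma>" "\<gamma> ` {0..1} = K"
    using assms by (auto simp: arc_between_def)
  then show "compactin S K"
    using compactin_image_interval [of S \<gamma> 0 1] by simp
  then show "closedin S K"
    by (simp add: assms compactin_imp_closedin)
qed

lemma embedding_map_near:
  assumes \<gamma>: "embedding_map (top_of_set {0..1::real}) S \<gamma>" and "r \<in> {0..1}"
    and "\<forall>\<^sub>F x in nhdsin S (\<gamma> r). P x"
  obtains d where "d > 0" "\<And>u. u \<in> {0..1} \<Longrightarrow> \<bar>u - r\<bar> < d \<Longrightarrow> P (\<gamma> u)"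
proof -
  have cont: "continuous_map (top_of_set {0..1}) S \<gamma>"
    using embedding_map_interval [OF \<gamma>] by blast
  then have "\<gamma> r \<in> topspace S"
    using assms(2) embedding_map_interval(3) [OF \<gamma>] by blast
  then obtain N where N: "openin S N" "\<gamma> r \<in> N" "\<forall>x\<in>N. P x"
    using assms(3) by (auto simp: eventually_nhdsin)
  have "openin (top_of_set {0..1}) {u \<in> {0..1}. \<gamma> u \<in> N}"
    using openin_continuous_map_preimage [OF cont N(1)] by simp
  then obtain d where "d > 0" and d: "ball r d \<inter> {0..1} \<subseteq> {u \<in> {0..1}. \<gamma> u \<in> N}"
    using N(2) assms(2) unfolding openin_contains_ball by blast
  have "P (\<gamma> u)" if "u \<in> {0..1}" "\<bar>u - r\<bar> < d" for u
    using N(3) d that by (auto simp: dist_real_def abs_minus_commute subset_iff)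
  then show ?thesis
    using that \<open>d > 0\<close> by blast
qed

text \<open>The tail with parameters from \<open>d\<close> on is compact, hence closed, and misses
  the start. So the arc does not come back near its beginning, and germs at
  \<open>\<gamma> 0\<close> see only small parameters.\<close>

lemma eventually_on_initial_segment:
  assumes H: "Hausdorff_space S" and \<gamma>: "embedding_map (top_of_set {0..1::real}) S \<gamma>" and "0 < d"
  shows "\<forall>\<^sub>F x in nhdsin S (\<gamma> 0). x \<in> \<gamma> ` {0..1} \<longrightarrow> (\<exists>u\<in>{0..1}. u < d \<and> x = \<gamma> u)"
proof -
  have inj: "inj_on \<gamma> {0..1}" and cont: "continuous_map (top_of_set {0..1}) S \<gamma>"
    using embedding_map_interval [OF \<gamma>] by blast+
  define C where "C = \<gamma> ` {d..1}"
  have "closedin S C"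
    using compactin_image_interval [OF \<gamma>, of d 1] \<open>0 < d\<close> H by (simp add: C_def compactin_imp_closedin)
  moreover have "\<gamma> 0 \<notin> C"
  proof
    assume "\<gamma> 0 \<in> C"
    then obtain u where "u \<in> {d..1}" "\<gamma> 0 = \<gamma> u" by (auto simp: C_def)
    then show False
      using inj_onD [OF inj, of 0 u] \<open>0 < d\<close> by auto
  qed
  moreover have "\<gamma> 0 \<in> topspace S"
    using embedding_map_interval(3) [OF \<gamma>, of 0] by simp
  ultimately have "\<forall>\<^sub>F x in nhdsin S (\<gamma> 0). x \<in> topspace S - C"
    by (intro eventually_nhdsin_open) auto
  then show ?thesis
  proof eventually_elim
    case (elim x)
    show ?case
    proof
      assume "x \<in> \<gamma> ` {0..1}"
      then obtain u where "u \<in> {0..1}" "x = \<gamma> u" by blast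
      then show "\<exists>u\<in>{0..1}. u < d \<and> x = \<gamma> u"
        using elim by (intro bexI [of _ u]) (auto simp: C_def not_less)
    qed
  qed
qed

lemma constant_along_embedding:
  assumes \<gamma>: "embedding_map (top_of_set {0..1::real}) S \<gamma>" and I: "connected I" "I \<subseteq> {0..1}"
    and R: "\<And>u. u \<in> I \<Longrightarrow> \<forall>\<^sub>F y in nhdsin S (\<gamma> u). y \<in> \<gamma> ` {0..1} \<longrightarrow> R y = R (\<gamma> u)"
  shows "\<exists>b :: bool. \<forall>u\<in>I. R (\<gamma> u) = b"
proof -
  have "(R \<circ> \<gamma>) constant_on I"
  proof (rule locally_constant_imp_constant [OF I(1)])
    fix u assume u: "u \<in> I"
    then obtain d where "d > 0" and d: "\<And>v. v \<in> {0..1} \<Longrightarrow> \<bar>v - u\<bar> < d \<Longrightarrow>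
        \<gamma> v \<in> \<gamma> ` {0..1} \<longrightarrow> R (\<gamma> v) = R (\<gamma> u)"
      using embedding_map_near [OF \<gamma> _ R [OF u]] I by blast
    show "\<exists>T. openin (top_of_set I) T \<and> u \<in> T \<and> (\<forall>x\<in>T. (R \<circ> \<gamma>) x = (R \<circ> \<gamma>) u)"
    proof (intro exI conjI ballI)
      fix v assume "v \<in> I \<inter> ball u d"
      then have "v \<in> {0..1}" "\<bar>v - u\<bar> < d"
        using I by (auto simp: dist_real_def abs_minus_commute)
      then show "(R \<circ> \<gamma>) v = (R \<circ> \<gamma>) u"
        using d by simp
    qed (use u \<open>d > 0\<close> in auto)
  qed
  then show ?thesis
    by (auto simp: constant_on_def)
qed

text \<open>Close to \<open>p\<close> the arc without \<open>p\<close> is the image of a connected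
  interval of small positive parameters.\<close>

lemma constant_near_endpoint:
  assumes H: "Hausdorff_space S" and K: "arc_between S K p q"
    and R: "\<forall>\<^sub>F x in nhdsin S p. x \<in> K - {p} \<longrightarrow> (\<forall>\<^sub>F y in nhdsin S x. y \<in> K \<longrightarrow> R y = R x)"
  shows "\<exists>b :: bool. \<forall>\<^sub>F x in nhdsin S p. x \<in> K - {p} \<longrightarrow> R x = b"
proof -
  obtain \<gamma> where \<gamma>: "embedding_map (top_of_set {0..1::real}) S \<gamma>" "\<gamma> ` {0..1} = K" "\<gamma> 0 = p"
    using K by (auto simp: arc_between_def)
  have inj: "inj_on \<gamma> {0..1}"
    using embedding_map_interval [OF \<gamma>(1)] by blast
  obtain d where "d > 0" and d: "\<And>u. u \<in> {0..1} \<Longrightarrow> \<bar>u - 0\<bar> < d \<Longrightarrow>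
     \<gamma> u \<in> K - {p} \<longrightarrow> (\<forall>\<^sub>F y in nhdsin S (\<gamma> u). y \<in> K \<longrightarrow> R y = R (\<gamma> u))"
    by (rule embedding_map_near [OF \<gamma>(1), of 0, unfolded \<gamma>(3), OF _ R]) auto
  let ?I = "{0<..<d} \<inter> {0..1}"
  have "connected ?I"
    by (intro convex_connected convex_Int) auto
  moreover have "\<forall>\<^sub>F y in nhdsin S (\<gamma> u). y \<in> \<gamma> ` {0..1} \<longrightarrow> R y = R (\<gamma> u)" if "u \<in> ?I" for u
  proof -
    have "\<gamma> u \<noteq> p"
      using inj_onD [OF inj, of u 0] \<gamma>(3) that by auto
    then show ?thesis
      using d [of u] that \<gamma>(2) by auto
  qed
  ultimately obtain b where b: "\<And>u. u \<in> ?I \<Longrightarrow> R (\<gamma> u) = b"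
    using constant_along_embedding [OF \<gamma>(1), of ?I R] by blast
  have "\<forall>\<^sub>F x in nhdsin S p. x \<in> K - {p} \<longrightarrow> R x = b"
    using eventually_on_initial_segment [OF H \<gamma>(1) \<open>d > 0\<close>] unfolding \<gamma>(3)
  proof eventually_elim
    case (elim x)
    show ?case
    proof
      assume x: "x \<in> K - {p}"
      then obtain u where u: "u \<in> {0..1}" "u < d" "x = \<gamma> u"
        using elim \<gamma>(2) by auto
      then have "u \<noteq> 0"
        using x \<gamma>(3) by auto
      then show "R x = b"
        using b [of u] u by auto
    qed
  qed
  then show ?thesis by blast
qed

lemma constant_on_open_arc:
  assumes K: "arc_between S K p q"
    and R: "\<And>x. x \<in> K - {p, q} \<Longrightarrow> \<forall>\<^sub>F y in nhdsin S x. y \<in> K \<longrightarrow> R y = R x"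
  shows "\<exists>b :: bool. \<forall>x \<in> K - {p, q}. R x = b"
proof -
  obtain \<gamma> where \<gamma>: "embedding_map (top_of_set {0..1::real}) S \<gamma>" "\<gamma> ` {0..1} = K" "\<gamma> 0 = p" "\<gamma> 1 = q"
    using K by (auto simp: arc_between_def)
  have inj: "inj_on \<gamma> {0..1}"
    using embedding_map_interval [OF \<gamma>(1)] by blast
  have ends: "\<gamma> u \<in> K - {p, q}" if "u \<in> {0<..<1}" for u
    using that inj_onD [OF inj, of u 0] inj_onD [OF inj, of u 1] \<gamma> by auto
  have "\<exists>b. \<forall>u\<in>{0<..<1}. R (\<gamma> u) = b"
    using R ends \<gamma>(2) by (intro constant_along_embedding [OF \<gamma>(1)]) auto
  then obtain b where b: "\<And>u. u \<in> {0<..<1} \<Longrightarrow> R (\<gamma> u) = b" by blast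
  have "R x = b" if x: "x \<in> K - {p, q}" for x
  proof -
    obtain u where "u \<in> {0..1}" "x = \<gamma> u"
      using x \<gamma>(2) by blast
    moreover from this have "u \<noteq> 0" "u \<noteq> 1"
      using x \<gamma>(3,4) by auto
    ultimately show ?thesis
      using b [of u] by auto
  qed
  then show ?thesis by (intro exI [of _ b] ballI)
qed

lemma frequently_on_arc:
  assumes "arc_between S K p q"
  shows "\<exists>\<^sub>F x in nhdsin S p. x \<in> K - {p, q}"
  unfolding frequently_def
proof
  assume *: "\<forall>\<^sub>F x in nhdsin S p. x \<notin> K - {p, q}"
  obtain \<gamma> where \<gamma>: "embedding_map (top_of_set {0..1::real}) S \<gamma>" "\<gamma> ` {0..1} = K" "\<gamma> 0 = p" "\<gamma> 1 = q"
    using assms by (auto simp: arc_between_def)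
  have inj: "inj_on \<gamma> {0..1}"
    using embedding_map_interval [OF \<gamma>(1)] by blast
  obtain d where "d > 0" and d: "\<And>u. u \<in> {0..1} \<Longrightarrow> \<bar>u - 0\<bar> < d \<Longrightarrow> \<gamma> u \<notin> K - {p, q}"
    by (rule embedding_map_near [OF \<gamma>(1), of 0, unfolded \<gamma>(3), OF _ *]) auto
  define u where "u = min (d / 2) (1 / 2)"
  have u: "0 < u" "u < 1" "u < d"
    using \<open>d > 0\<close> by (auto simp: u_def min_less_iff_disj)
  then have "\<gamma> u \<in> K - {p, q}"
    using inj_onD [OF inj, of u 0] inj_onD [OF inj, of u 1] \<gamma> by auto
  then show False
    using d [of u] u by auto
qed

text \<open>A chart around \<open>p\<close> need not contain the whole arc, so only an initial piece
  is pulled back. Near \<open>p\<close> nothing else of the arc is visible.\<close>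

lemma arc_in_chart:
  fixes f :: "complex \<Rightarrow> 's"
  assumes H: "Hausdorff_space S" and K: "arc_between S K p q"
    and maps: "homeomorphic_maps euclidean (subtopology S U) f g" and U: "openin S U" "p \<in> U"
  obtains \<delta> where "arc \<delta>" "\<delta> 0 = g p" "path_image \<delta> \<subseteq> f -` K"
    "\<forall>\<^sub>F w in nhds (g p). f w \<in> K \<longleftrightarrow> w \<in> path_image \<delta>"
proof -
  obtain \<gamma> where \<gamma>: "embedding_map (top_of_set {0..1::real}) S \<gamma>" "\<gamma> ` {0..1} = K" "\<gamma> 0 = p"
    using K by (auto simp: arc_between_def)
  have inj: "inj_on \<gamma> {0..1}" and cont: "continuous_map (top_of_set {0..1}) S \<gamma>"
    using embedding_map_interval [OF \<gamma>(1)] by blast+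
  have topU: "topspace (subtopology S U) = U"
    using U openin_subset [of S U] by (simp add: Int_absorb1)
  have fg: "\<And>x. x \<in> U \<Longrightarrow> f (g x) = x" "\<And>w. g (f w) = w"
    and contg: "continuous_map (subtopology S U) euclidean g"
    using maps topU by (auto simp: homeomorphic_maps_def)
  have fU: "f w \<in> U" for w
    using maps topU by (auto simp: homeomorphic_maps_def continuous_map_def Pi_iff)
  obtain d where "d > 0" and d: "\<And>u. u \<in> {0..1} \<Longrightarrow> \<bar>u - 0\<bar> < d \<Longrightarrow> \<gamma> u \<in> U"
    using embedding_map_near [OF \<gamma>(1), of 0 "\<lambda>x. x \<in> U"] eventually_nhdsin_open [OF U] \<gamma>(3) by auto
  define e where "e = min (d / 2) 1"
  have e: "0 < e" "e \<le> 1" "e < d"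
    using \<open>d > 0\<close> by (auto simp: e_def)
  define \<delta> where "\<delta> t = g (\<gamma> (e * t))" for t
  have inU: "\<gamma> u \<in> U" if "0 \<le> u" "u \<le> e" for u
    using d [of u] that e by auto
  have et: "0 \<le> e * t \<and> e * t \<le> e" if "t \<in> {0..1}" for t
    using that e by (auto simp: mult_left_le)
  have "continuous_map (top_of_set {0..1}) (top_of_set {0..1}) (\<lambda>t. e * t)"
  proof -
    have "(\<lambda>t. e * t) ` {0..1} \<subseteq> {0..1}"
      using et e by (intro image_subsetI) (metis atLeastAtMost_iff order_trans)
    then show ?thesis
      by (auto simp: continuous_map_in_subtopology intro!: continuous_intros)
  qed
  then have "continuous_map (top_of_set {0..1}) S (\<gamma> \<circ> (\<lambda>t. e * t))"
    using cont continuous_map_compose by blast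
  then have "continuous_map (top_of_set {0..1}) (subtopology S U) (\<gamma> \<circ> (\<lambda>t. e * t))"
    using inU et by (auto simp: continuous_map_in_subtopology)
  then have "continuous_map (top_of_set {0..1}) euclidean (g \<circ> (\<gamma> \<circ> (\<lambda>t. e * t)))"
    using contg continuous_map_compose by blast
  then have "path \<delta>"
    by (simp add: path_def \<delta>_def [abs_def] comp_def)
  moreover have "inj_on \<delta> {0..1}"
  proof (rule inj_onI)
    fix s t assume st: "s \<in> {0..1}" "t \<in> {0..1}" "\<delta> s = \<delta> t"
    then have "\<gamma> (e * s) = \<gamma> (e * t)"
      using fg(1) inU et by (metis \<delta>_def)
    then have "e * s = e * t"
      using inj_onD [OF inj, of "e * s" "e * t"] et [OF st(1)] et [OF st(2)] e by auto
    then show "s = t"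
      using e by simp
  qed
  ultimately have "arc \<delta>"
    by (simp add: arc_def)
  moreover have "\<delta> 0 = g p"
    by (simp add: \<delta>_def \<gamma>)
  moreover have sub: "path_image \<delta> \<subseteq> f -` K"
  proof
    fix w assume "w \<in> path_image \<delta>"
    then obtain t where t: "t \<in> {0..1}" "w = \<delta> t"
      by (auto simp: path_image_def)
    then have "f w = \<gamma> (e * t)"
      using fg(1) inU et by (simp add: \<delta>_def)
    moreover have "e * t \<in> {0..1}"
      using et [OF t(1)] e by (metis atLeastAtMost_iff order_trans)
    ultimately show "w \<in> f -` K"
      using \<gamma>(2) by auto
  qed
  moreover have "\<forall>\<^sub>F w in nhds (g p). f w \<in> K \<longleftrightarrow> w \<in> path_image \<delta>"
  proof -
    have "homeomorphic_map euclidean (subtopology S U) f"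
      using maps homeomorphic_maps_map by blast
    from nhdsin_homeomorphic_map [OF this U(1), of "g p"]
    have "nhdsin S p = filtermap f (nhds (g p))"
      using fg U by (simp add: nhdsin_euclidean)
    then have "\<forall>\<^sub>F w in nhds (g p). f w \<in> \<gamma> ` {0..1} \<longrightarrow> (\<exists>u\<in>{0..1}. u < e \<and> f w = \<gamma> u)"
      using eventually_on_initial_segment [OF H \<gamma>(1) e(1)] \<gamma>(3) by (simp add: eventually_filtermap)
    then show ?thesis
    proof eventually_elim
      case (elim w)
      show ?case
      proof
        assume "f w \<in> K"
        then obtain u where u: "u \<in> {0..1}" "u < e" "f w = \<gamma> u"
          using elim \<gamma>(2) by blast
        then have "w = \<delta> (u / e)" "u / e \<in> {0..1}"
          using fg(2) [of w] e by (auto simp: \<delta>_def)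
        then show "w \<in> path_image \<delta>"
          by (auto simp: path_image_def)
      qed (use sub in auto)
    qed
  qed
  ultimately show ?thesis
    using that by blast
qed

lemma surface_chart:
  assumes "surface S" "p \<in> topspace S"
  obtains U and f :: "complex \<Rightarrow> 's" and g where "openin S U" "p \<in> U"
    "homeomorphic_maps euclidean (subtopology S U) f g"
  using assms unfolding surface_def homeomorphic_space_def by (metis homeomorphic_maps_sym)

lemma one_sided_at_endpoint:
  fixes S :: "'s topology"
  assumes S: "surface S" and K: "arc_between S K p q"
  shows "one_sided S K p"
proof -
  have H: "Hausdorff_space S" and p: "p \<in> topspace S"
    using S arc_between_topspace [OF K] by (auto simp: surface_def)
  obtain U and f :: "complex \<Rightarrow> 's" and g where U: "openin S U" "p \<in> U"
    and maps: "homeomorphic_maps euclidean (subtopology S U) f g"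
    by (rule surface_chart [OF S p])
  obtain \<delta> where \<delta>: "arc \<delta>" "\<delta> 0 = g p" "path_image \<delta> \<subseteq> f -` K"
      "\<forall>\<^sub>F w in nhds (g p). f w \<in> K \<longleftrightarrow> w \<in> path_image \<delta>"
    by (rule arc_in_chart [OF H K maps U])
  have "one_sided euclidean (path_image \<delta>) (g p)"
    using one_sided_arc_start [OF \<delta>(1)] \<delta>(2) by simp
  then have "one_sided euclidean (f -` K) (g p)"
    by (rule one_sided_cong [rotated]) (use \<delta>(4) in \<open>auto simp: nhdsin_euclidean elim: eventually_mono\<close>)
  moreover have nh: "nhdsin S (f w) = filtermap f (nhdsin euclidean w)" for w
    using nhdsin_homeomorphic_map [of euclidean S U f w] maps U(1) homeomorphic_maps_map by simp blast
  ultimately have "one_sided S K (f (g p))"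
    using one_sided_transfer [OF nh] by simp
  moreover have "f (g p) = p"
    using maps U openin_subset [OF U(1)] by (auto simp: homeomorphic_maps_def)
  ultimately show ?thesis by simp
qed

text \<open>In a chart, the reverse of one initial piece followed by the other is a single planar
  arc, with \<open>g p\<close> at the interior parameter \<open>1 / 2\<close>.\<close>

lemma two_sided_at_junction:
  fixes S :: "'s topology"
  assumes S: "surface S" and K: "arc_between S K p q" and L: "arc_between S L p q'" and KL: "K \<inter> L = {p}"
  shows "two_sided S (K \<union> L) p"
proof -
  have H: "Hausdorff_space S" and p: "p \<in> topspace S"
    using S arc_between_topspace [OF K] by (auto simp: surface_def)
  obtain U and f :: "complex \<Rightarrow> 's" and g where U: "openin S U" "p \<in> U"
    and maps: "homeomorphic_maps euclidean (subtopology S U) f g"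
    by (rule surface_chart [OF S p])
  have hom: "homeomorphic_map euclidean (subtopology S U) f"
    using maps homeomorphic_maps_map by blast
  have nh: "nhdsin S (f w) = filtermap f (nhdsin euclidean w)" for w
    using nhdsin_homeomorphic_map [OF hom U(1), of w] by simp
  have fgp: "f (g p) = p"
    using maps U openin_subset [OF U(1)] by (auto simp: homeomorphic_maps_def)
  have inj: "inj f"
    using homeomorphic_imp_injective_map [OF hom] by simp
  obtain \<delta> where \<delta>: "arc \<delta>" "\<delta> 0 = g p" "path_image \<delta> \<subseteq> f -` K"
      "\<forall>\<^sub>F w in nhds (g p). f w \<in> K \<longleftrightarrow> w \<in> path_image \<delta>"
    by (rule arc_in_chart [OF H K maps U])
  obtain \<epsilon> where \<epsilon>: "arc \<epsilon>" "\<epsilon> 0 = g p" "path_image \<epsilon> \<subseteq> f -` L"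
      "\<forall>\<^sub>F w in nhds (g p). f w \<in> L \<longleftrightarrow> w \<in> path_image \<epsilon>"
    by (rule arc_in_chart [OF H L maps U])
  let ?j = "reversepath \<delta> +++ \<epsilon>"
  have "w = g p" if "w \<in> path_image \<delta> \<inter> path_image \<epsilon>" for w
  proof -
    have "f w = f (g p)"
    proof -
      have "f w \<in> K \<inter> L"
        using that \<delta>(3) \<epsilon>(3) by auto
      then show ?thesis
        using KL fgp by simp
    qed
    then show ?thesis
      using inj by (simp add: inj_eq)
  qed
  then have "arc ?j"
    using \<delta>(1,2) \<epsilon>(1,2) by (intro arc_join arc_reversepath) (auto simp: pathstart_def)
  moreover have "?j (1 / 2) = g p"
    using \<delta>(2) by (simp add: joinpaths_def reversepath_def)
  moreover have "path_image ?j = path_image \<delta> \<union> path_image \<epsilon>"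
    using \<delta>(2) \<epsilon>(2) by (simp add: path_image_join pathstart_def)
  ultimately have "two_sided euclidean (path_image \<delta> \<union> path_image \<epsilon>) (g p)"
    using two_sided_arc_interior [of ?j "1 / 2"] by simp
  moreover have "\<forall>\<^sub>F w in nhds (g p). w \<in> path_image \<delta> \<union> path_image \<epsilon> \<longleftrightarrow> w \<in> f -` (K \<union> L)"
    using \<delta>(4) \<epsilon>(4) by eventually_elim auto
  ultimately have "two_sided euclidean (f -` (K \<union> L)) (g p)"
    using two_sided_cong [where T = euclidean and p = "g p" and K' = "f -` (K \<union> L)", unfolded nhdsin_euclidean]
    by blast
  then have "two_sided S (K \<union> L) (f (g p))"
    using inj two_sided_transfer [OF nh] by simp
  then show ?thesis
    using fgp by simp
qed

lemma two_sided_on_open_arc: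
  assumes S: "surface S" and K: "arc_between S K p q" and x: "x \<in> K - {p, q}"
  shows "two_sided S K x"
proof -
  have "Hausdorff_space S"
    using S by (simp add: surface_def)
  then obtain K1 K2 where "arc_between S K1 x p" "arc_between S K2 x q" "K1 \<union> K2 = K" "K1 \<inter> K2 = {x}"
    using arc_between_split [OF _ K x] by blast
  then show ?thesis
    using two_sided_at_junction [OF S, of K1 x p K2 q] by simp
qed

section \<open>Side functions along an arc\<close>

lemma constant_off_comp: "constant_off S K p \<sigma> \<Longrightarrow> constant_off S K p (\<lambda>x. f (\<sigma> x))"
  unfolding constant_off_def by (auto elim!: eventually_mono)

text \<open>Here and below \<open>\<sigma> x = s\<close> is \<sigma> or its negation, according to
  \<open>s\<close>. This treats preserved and swapped sides at once.\<close>

lemma side_function_negate: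
  assumes "side_function S K p \<sigma>" shows "side_function S K p (\<lambda>x. \<sigma> x = s)"
proof -
  have "\<exists>\<^sub>F x in nhdsin S p. x \<notin> K \<and> (\<sigma> x = s) = b" for b
  proof -
    have "\<exists>\<^sub>F x in nhdsin S p. x \<notin> K \<and> \<sigma> x = (b = s)"
      using assms by (simp add: side_function_def)
    then show ?thesis
      by (rule frequently_elim1) auto
  qed
  then show ?thesis
    using assms constant_off_comp [of S K p \<sigma> "\<lambda>b. b = s"] by (simp add: side_function_def)
qed

lemma side_function_frequently:
  assumes "side_function S K p \<sigma>" "\<forall>\<^sub>F x in nhdsin S p. x \<notin> K \<longrightarrow> P x"
  obtains x where "x \<notin> K" "\<sigma> x = b" "P x"
proof -
  have "\<exists>\<^sub>F x in nhdsin S p. x \<notin> K \<and> \<sigma> x = b"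
    using assms by (simp add: side_function_def)
  from frequently_eventually_conj [OF this assms(2)] show ?thesis
    using that frequently_ex by blast
qed

text \<open>Any side function can replace the witness \<open>\<sigma>0\<close> hidden in
  \<open>two_sided\<close>: it is a function \<psi> of that witness, and since it takes both values,
  \<psi> is invertible, with inverse \<theta>.\<close>

lemma side_function_factor:
  assumes "two_sided S K p" and \<sigma>: "side_function S K p \<sigma>" and \<tau>: "constant_off S K p \<tau>"
  shows "\<exists>\<phi>. \<forall>\<^sub>F x in nhdsin S p. x \<notin> K \<longrightarrow> \<tau> x = \<phi> (\<sigma> x)"
proof -
  obtain \<sigma>0 where "(\<forall>\<^sub>F q in nhdsin S p. q \<in> K \<longrightarrow> side_function S K q \<sigma>0) \<and>
     (\<forall>\<tau>. constant_off S K p \<tau> \<longrightarrow> (\<exists>\<phi>. \<forall>\<^sub>F x in nhdsin S p. x \<notin> K \<longrightarrow> \<tau> x = \<phi> (\<sigma>0 x)))"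
    using assms(1) unfolding two_sided_def ..
  then have uniq: "\<forall>\<tau>. constant_off S K p \<tau> \<longrightarrow> (\<exists>\<phi>. \<forall>\<^sub>F x in nhdsin S p. x \<notin> K \<longrightarrow> \<tau> x = \<phi> (\<sigma>0 x))"
    by (rule conjunct2)
  obtain \<phi> where \<phi>: "\<forall>\<^sub>F x in nhdsin S p. x \<notin> K \<longrightarrow> \<tau> x = \<phi> (\<sigma>0 x)"
    using uniq \<tau> by (elim allE impE exE)
  have "constant_off S K p \<sigma>"
    using \<sigma> by (simp add: side_function_def)
  then obtain \<psi> where \<psi>: "\<forall>\<^sub>F x in nhdsin S p. x \<notin> K \<longrightarrow> \<sigma> x = \<psi> (\<sigma>0 x)"
    using uniq by (elim allE impE exE)
  have "\<exists>a. \<psi> a = b" for b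
    using side_function_frequently [OF \<sigma> \<psi>, of b] by metis
  then obtain a a' where "\<psi> a = True" "\<psi> a' = False" by meson
  then have "\<psi> True \<noteq> \<psi> False"
    by (cases a; cases a') auto
  define \<theta> where "\<theta> b \<longleftrightarrow> b = \<psi> True" for b
  have \<theta>: "\<theta> (\<psi> a) = a" for a
    using \<open>\<psi> True \<noteq> \<psi> False\<close> by (cases a) (auto simp: \<theta>_def)
  have "\<forall>\<^sub>F x in nhdsin S p. x \<notin> K \<longrightarrow> \<tau> x = (\<phi> \<circ> \<theta>) (\<sigma> x)"
    using \<phi> \<psi> by eventually_elim (use \<theta> in auto)
  then show ?thesis by (rule exI [of _ "\<phi> \<circ> \<theta>"])
qed

lemma side_functions_agree_or_differ:
  assumes "two_sided S K p" and \<sigma>: "side_function S K p \<sigma>" and \<tau>: "side_function S K p \<tau>"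
  shows "\<exists>s. \<forall>\<^sub>F x in nhdsin S p. x \<notin> K \<longrightarrow> \<tau> x = (\<sigma> x = s)"
proof -
  have "constant_off S K p \<tau>"
    using \<tau> by (simp add: side_function_def)
  from side_function_factor [OF assms(1) \<sigma> this]
  obtain \<phi> where \<phi>: "\<forall>\<^sub>F x in nhdsin S p. x \<notin> K \<longrightarrow> \<tau> x = \<phi> (\<sigma> x)"
    by blast
  have "\<exists>a. \<phi> a = b" for b
    using side_function_frequently [OF \<tau> \<phi>, of b] by metis
  then have \<phi>F: "\<phi> False = (\<not> \<phi> True)"
    by (metis (full_types))
  then have "\<forall>\<^sub>F x in nhdsin S p. x \<notin> K \<longrightarrow> \<tau> x = (\<sigma> x = \<phi> True)"
    using \<phi>
  proof eventually_elim
    case (elim x)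
    then show ?case
      using \<phi>F by (cases "\<sigma> x") auto
  qed
  then show ?thesis by (rule exI [of _ "\<phi> True"])
qed

lemma side_agreement_unique:
  assumes \<sigma>: "side_function S K x \<sigma>"
    and "\<forall>\<^sub>F y in nhdsin S x. y \<notin> K \<longrightarrow> \<tau> y = (\<sigma> y = s)"
    and "\<forall>\<^sub>F y in nhdsin S x. y \<notin> K \<longrightarrow> \<tau> y = (\<sigma> y = s')"
  shows "s = s'"
proof -
  have "\<forall>\<^sub>F y in nhdsin S x. y \<notin> K \<longrightarrow> s = s'"
    using assms(2,3) by eventually_elim auto
  then show ?thesis
    by (rule side_function_frequently [OF \<sigma>])
qed

lemma side_functions_agree_iff:
  assumes "two_sided S K x" "side_function S K x \<sigma>" "side_function S K x \<tau>"
  shows "\<forall>\<^sub>F y in nhdsin S x. y \<notin> K \<longrightarrow>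
    \<tau> y = (\<sigma> y = (\<forall>\<^sub>F z in nhdsin S x. z \<notin> K \<longrightarrow> \<tau> z = \<sigma> z))"
proof -
  let ?R = "\<forall>\<^sub>F z in nhdsin S x. z \<notin> K \<longrightarrow> \<tau> z = \<sigma> z"
  obtain s where s: "\<forall>\<^sub>F y in nhdsin S x. y \<notin> K \<longrightarrow> \<tau> y = (\<sigma> y = s)"
    using side_functions_agree_or_differ [OF assms] ..
  have "s = True" if ?R
    using side_agreement_unique [OF assms(2) s, of True] that by simp
  moreover have ?R if s
    using s that by simp
  ultimately have "s = ?R" by blast
  then show ?thesis
    using s by simp
qed

text \<open>The sign that compares \<sigma> and \<tau> at \<open>x\<close> is valid on a whole
  neighbourhood of \<open>x\<close>, hence also near the points \<open>q\<close> of \<open>K\<close>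
  close to \<open>x\<close>; and at each \<open>q\<close> the sign is unique.\<close>

lemma agreement_locally_constant:
  assumes two: "two_sided S K x" and x: "x \<in> K" "x \<in> topspace S"
    and \<sigma>: "\<forall>\<^sub>F q in nhdsin S x. q \<in> K \<longrightarrow> side_function S K q \<sigma>"
    and \<tau>: "\<forall>\<^sub>F q in nhdsin S x. q \<in> K \<longrightarrow> side_function S K q \<tau>"
  defines "R q \<equiv> \<forall>\<^sub>F y in nhdsin S q. y \<notin> K \<longrightarrow> \<tau> y = \<sigma> y"
  shows "\<forall>\<^sub>F q in nhdsin S x. q \<in> K \<longrightarrow> R q = R x"
proof -
  have "side_function S K x \<sigma>" "side_function S K x \<tau>"
    using eventually_nhdsin_self \<sigma> \<tau> x by fast+
  from side_functions_agree_iff [OF two this]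
  have "\<forall>\<^sub>F y in nhdsin S x. y \<notin> K \<longrightarrow> \<tau> y = (\<sigma> y = R x)"
    by (simp add: R_def)
  from eventually_eventually_nhdsin [OF this] \<sigma> show ?thesis
  proof eventually_elim
    case (elim q)
    show ?case
    proof
      assume "q \<in> K"
      then have q: "side_function S K q \<sigma>"
        using elim by blast
      have "R x = True" if "R q"
        using side_agreement_unique [OF q, of \<tau> "R x" True] elim that by (simp add: R_def)
      moreover have "R q" if "R x"
        using elim that by (simp add: R_def)
      ultimately show "R q = R x" by blast
    qed
  qed
qed

section \<open>Comparison and gluing of side functions in a surface\<close>

context
  fixes S :: "'s topology"
  assumes S: "surface S"
begin

lemma surface_imp_Hausdorff: "Hausdorff_space S"
  using S by (simp add: surface_def)

lemma eventually_neq: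
  assumes "x \<in> topspace S" "y \<in> topspace S" "x \<noteq> y"
  shows "\<forall>\<^sub>F z in nhdsin S x. z \<noteq> y"
proof -
  have "openin S (topspace S - {y})"
    using surface_imp_Hausdorff assms by (intro openin_diff closedin_Hausdorff_finite) auto
  then have "\<forall>\<^sub>F z in nhdsin S x. z \<in> topspace S - {y}"
    using assms by (intro eventually_nhdsin_open) auto
  then show ?thesis
    by eventually_elim auto
qed

text \<open>Agreement is a locally constant truth value on the open arc, which is connected. The
  main use is with \<tau> the composition of \<sigma> with a homeomorphism that fixes the arc as a
  set.\<close>

lemma side_functions_along_arc:
  assumes K: "arc_between S K p q"
    and \<sigma>: "\<And>x. x \<in> K - {p, q} \<Longrightarrow> side_function S K x \<sigma>"
    and \<tau>: "\<And>x. x \<in> K - {p, q} \<Longrightarrow> side_function S K x \<tau>"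
  shows "\<exists>s. \<forall>x \<in> K - {p, q}. \<forall>\<^sub>F y in nhdsin S x. y \<notin> K \<longrightarrow> \<tau> y = (\<sigma> y = s)"
proof -
  define R where "R x \<longleftrightarrow> (\<forall>\<^sub>F y in nhdsin S x. y \<notin> K \<longrightarrow> \<tau> y = \<sigma> y)" for x
  note top = arc_between_topspace [OF K]
  have "\<exists>b. \<forall>x \<in> K - {p, q}. R x = b"
  proof (rule constant_on_open_arc [OF K])
    fix x assume x: "x \<in> K - {p, q}"
    then have "\<forall>\<^sub>F z in nhdsin S x. z \<noteq> p" "\<forall>\<^sub>F z in nhdsin S x. z \<noteq> q"
      using eventually_neq top by auto
    then have near: "\<forall>\<^sub>F z in nhdsin S x. z \<in> K \<longrightarrow> z \<in> K - {p, q}"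
      by eventually_elim auto
    show "\<forall>\<^sub>F y in nhdsin S x. y \<in> K \<longrightarrow> R y = R x"
      unfolding R_def
    proof (rule agreement_locally_constant [OF two_sided_on_open_arc [OF S K x]])
      show "\<forall>\<^sub>F z in nhdsin S x. z \<in> K \<longrightarrow> side_function S K z \<sigma>"
        "\<forall>\<^sub>F z in nhdsin S x. z \<in> K \<longrightarrow> side_function S K z \<tau>"
        using near by (eventually_elim, use \<sigma> \<tau> in blast)+
    qed (use x top in auto)
  qed
  then obtain b where b: "\<And>x. x \<in> K - {p, q} \<Longrightarrow> R x = b" by blast
  have "\<forall>\<^sub>F y in nhdsin S x. y \<notin> K \<longrightarrow> \<tau> y = (\<sigma> y = b)" if x: "x \<in> K - {p, q}" for x
    using side_functions_agree_iff [OF two_sided_on_open_arc [OF S K x] \<sigma> [OF x] \<tau> [OF x]] b [OF x]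
    by (simp add: R_def)
  then show ?thesis by (intro exI [of _ b] ballI)
qed

text \<open>At \<open>p\<close> itself the arc has just one side, so the comparison has to run over
  the other points of the arc near \<open>p\<close>.\<close>

lemma side_functions_near_endpoint:
  assumes K: "arc_between S K p q"
    and \<sigma>: "\<forall>\<^sub>F x in nhdsin S p. x \<in> K - {p} \<longrightarrow> side_function S K x \<sigma>"
    and \<tau>: "\<forall>\<^sub>F x in nhdsin S p. x \<in> K - {p} \<longrightarrow> side_function S K x \<tau>"
  shows "\<exists>s. \<forall>\<^sub>F x in nhdsin S p. x \<in> K - {p} \<longrightarrow> (\<forall>\<^sub>F y in nhdsin S x. y \<notin> K \<longrightarrow> \<tau> y = (\<sigma> y = s))"
proof -
  define R where "R x \<longleftrightarrow> (\<forall>\<^sub>F y in nhdsin S x. y \<notin> K \<longrightarrow> \<tau> y = \<sigma> y)" for x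
  note top = arc_between_topspace [OF K]
  have pq: "\<forall>\<^sub>F x in nhdsin S p. x \<noteq> q"
    using eventually_neq top by auto
  have "\<exists>b. \<forall>\<^sub>F x in nhdsin S p. x \<in> K - {p} \<longrightarrow> R x = b"
  proof (rule constant_near_endpoint [OF surface_imp_Hausdorff K])
    show "\<forall>\<^sub>F x in nhdsin S p. x \<in> K - {p} \<longrightarrow> (\<forall>\<^sub>F y in nhdsin S x. y \<in> K \<longrightarrow> R y = R x)"
      using eventually_eventually_nhdsin [OF \<sigma>] eventually_eventually_nhdsin [OF \<tau>] pq
    proof eventually_elim
      case (elim x)
      show ?case
      proof
        assume x: "x \<in> K - {p}"
        then have "\<forall>\<^sub>F z in nhdsin S x. z \<noteq> p"
          using eventually_neq top by auto
        moreover have "\<forall>\<^sub>F z in nhdsin S x. z \<in> K - {p} \<longrightarrow> side_function S K z \<sigma>"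
          "\<forall>\<^sub>F z in nhdsin S x. z \<in> K - {p} \<longrightarrow> side_function S K z \<tau>"
          using elim by blast+
        ultimately have "\<forall>\<^sub>F z in nhdsin S x. z \<in> K \<longrightarrow> side_function S K z \<sigma>"
          "\<forall>\<^sub>F z in nhdsin S x. z \<in> K \<longrightarrow> side_function S K z \<tau>"
          by (auto elim: eventually_elim2)
        then show "\<forall>\<^sub>F y in nhdsin S x. y \<in> K \<longrightarrow> R y = R x"
          unfolding R_def using x elim top
          by (intro agreement_locally_constant [OF two_sided_on_open_arc [OF S K, of x]]) auto
      qed
    qed
  qed
  then obtain b where b: "\<forall>\<^sub>F x in nhdsin S p. x \<in> K - {p} \<longrightarrow> R x = b" by blast
  have "\<forall>\<^sub>F x in nhdsin S p. x \<in> K - {p} \<longrightarrow> (\<forall>\<^sub>F y in nhdsin S x. y \<notin> K \<longrightarrow> \<tau> y = (\<sigma> y = b))"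
    using b \<sigma> \<tau> pq
  proof eventually_elim
    case (elim x)
    show ?case
    proof
      assume x: "x \<in> K - {p}"
      then have "two_sided S K x" "side_function S K x \<sigma>" "side_function S K x \<tau>"
        using elim two_sided_on_open_arc [OF S K, of x] by auto
      from side_functions_agree_iff [OF this]
      show "\<forall>\<^sub>F y in nhdsin S x. y \<notin> K \<longrightarrow> \<tau> y = (\<sigma> y = b)"
        using elim x by (simp add: R_def)
    qed
  qed
  then show ?thesis by (rule exI [of _ b])
qed

text \<open>After a change of sign the two functions agree off \<open>K\<close> on a neighbourhood
  \<open>N\<close> of \<open>\<gamma> b\<close>. Outside \<open>N\<close> the two pieces of the arc
  are disjoint and compact, so open sets separate them and tell which function to use.\<close>

lemma glue_side_functions:
  assumes two: "two_sided S K (\<gamma> b)" and K: "\<gamma> ` {0..1} \<subseteq> K"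
    and \<gamma>: "embedding_map (top_of_set {0..1::real}) S \<gamma>" and b: "b \<in> {0..1}"
    and \<sigma>: "\<And>r. r \<in> {a..b} \<inter> {0..1} \<Longrightarrow> side_function S K (\<gamma> r) \<sigma>" "a \<le> b"
    and \<tau>: "\<And>r. r \<in> {b..c} \<inter> {0..1} \<Longrightarrow> side_function S K (\<gamma> r) \<tau>" "b \<le> c"
  shows "\<exists>\<rho>. \<forall>r \<in> {a..c} \<inter> {0..1}. side_function S K (\<gamma> r) \<rho>"
proof -
  have \<sigma>b: "side_function S K (\<gamma> b) \<sigma>" and \<tau>b: "side_function S K (\<gamma> b) \<tau>"
    using \<sigma> \<tau> b by auto
  have inj: "inj_on \<gamma> {0..1}"
    using embedding_map_interval [OF \<gamma>] by blast
  obtain s where s: "\<forall>\<^sub>F x in nhdsin S (\<gamma> b). x \<notin> K \<longrightarrow> \<tau> x = (\<sigma> x = s)"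
    using side_functions_agree_or_differ [OF two \<sigma>b \<tau>b] by blast
  define \<tau>' where "\<tau>' x = (\<tau> x = s)" for x
  have "\<gamma> b \<in> topspace S"
    using embedding_map_interval(3) [OF \<gamma> b] .
  then obtain N where N: "openin S N" "\<gamma> b \<in> N" "\<And>x. x \<in> N - K \<Longrightarrow> \<tau>' x = \<sigma> x"
    using s unfolding eventually_nhdsin \<tau>'_def by auto
  define C1 where "C1 = \<gamma> ` ({a..b} \<inter> {0..1}) - N"
  define C2 where "C2 = \<gamma> ` ({b..c} \<inter> {0..1}) - N"
  have "compactin S (\<gamma> ` ({u..v} \<inter> {0..1}) - N)" for u v
  proof -
    have "{u..v} \<inter> {0..1} = {max u 0..min v 1}" by auto
    then have "compactin S (\<gamma> ` ({u..v} \<inter> {0..1}))"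
      using compactin_image_interval [OF \<gamma>, of "max u 0" "min v 1"] by simp
    moreover have "closedin S (topspace S - N)"
      using N(1) by blast
    ultimately have "compactin S (\<gamma> ` ({u..v} \<inter> {0..1}) \<inter> (topspace S - N))"
      by (rule compact_Int_closedin)
    moreover have "\<gamma> ` ({u..v} \<inter> {0..1}) \<inter> (topspace S - N) = \<gamma> ` ({u..v} \<inter> {0..1}) - N"
      using embedding_map_interval(3) [OF \<gamma>] by auto
    ultimately show ?thesis by simp
  qed
  then have "compactin S C1" "compactin S C2"
    by (simp_all add: C1_def C2_def)
  moreover have "disjnt C1 C2"
  proof -
    have False if "x \<in> C1" "x \<in> C2" for x
    proof -
      obtain u v where uv: "u \<in> {a..b} \<inter> {0..1}" "v \<in> {b..c} \<inter> {0..1}" "x = \<gamma> u" "x = \<gamma> v"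
        using \<open>x \<in> C1\<close> \<open>x \<in> C2\<close> unfolding C1_def C2_def by blast
      then have "u = v"
        using inj_onD [OF inj, of u v] by auto
      then have "x = \<gamma> b"
        using uv by auto
      then show False
        using N(2) \<open>x \<in> C1\<close> by (simp add: C1_def)
    qed
    then show ?thesis
      by (auto simp: disjnt_def)
  qed
  ultimately obtain O1 O2 where O: "openin S O1" "openin S O2" "C1 \<subseteq> O1" "C2 \<subseteq> O2" "disjnt O1 O2"
    using Hausdorff_space_compact_separation [OF surface_imp_Hausdorff] by metis
  \<comment> \<open>At points of the arc in \<open>N\<close> the choice is immaterial; outside
    \<open>N\<close>, \<open>O2\<close> surrounds the second piece and stays away from a
    neighbourhood \<open>O1\<close> of the first.\<close>
  define \<rho> where "\<rho> x = (if x \<in> O2 then \<tau>' x else \<sigma> x)" for x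
  have "side_function S K (\<gamma> r) \<rho>" if r: "r \<in> {a..c} \<inter> {0..1}" for r
  proof -
    have "\<gamma> r \<in> O1" if "r \<le> b" "\<gamma> r \<notin> N"
    proof -
      have "\<gamma> r \<in> C1"
        unfolding C1_def using r that by auto
      then show ?thesis using O(3) by blast
    qed
    moreover have "\<gamma> r \<in> O2" if "b \<le> r" "\<gamma> r \<notin> N"
    proof -
      have "\<gamma> r \<in> C2"
        unfolding C2_def using r that by auto
      then show ?thesis using O(4) by blast
    qed
    ultimately consider "\<gamma> r \<in> N" | "r \<in> {a..b}" "\<gamma> r \<in> O1" | "r \<in> {b..c}" "\<gamma> r \<in> O2"
      using r by fastforce
    then show ?thesis
    proof cases
      case 1
      have near: "\<forall>\<^sub>F x in nhdsin S (\<gamma> r). x \<in> N"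
        using N(1) 1 by (rule eventually_nhdsin_open)
      show ?thesis
      proof (cases "r \<le> b")
        case True
        then have "side_function S K (\<gamma> r) \<sigma>"
          using \<sigma> r by auto
        then show ?thesis
          by (rule side_function_cong [rotated])
            (use near N(3) in \<open>auto simp: \<rho>_def elim!: eventually_mono\<close>)
      next
        case False
        then have "side_function S K (\<gamma> r) \<tau>'"
          unfolding \<tau>'_def using \<tau> r by (auto intro: side_function_negate)
        then show ?thesis
          by (rule side_function_cong [rotated])
            (use near N(3) in \<open>auto simp: \<rho>_def elim!: eventually_mono\<close>)
      qed
    next
      case 2
      then have "side_function S K (\<gamma> r) \<sigma>"
        using \<sigma> r by auto
      then show ?thesis
        by (rule side_function_cong [rotated])
          (use eventually_nhdsin_open [OF O(1) 2(2)] O(5) in \<open>auto simp: \<rho>_def disjnt_iff elim!: eventually_mono\<close>)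
    next
      case 3
      then have "side_function S K (\<gamma> r) \<tau>'"
        unfolding \<tau>'_def using \<tau> r by (auto intro: side_function_negate)
      then show ?thesis
        by (rule side_function_cong [rotated])
          (use eventually_nhdsin_open [OF O(2) 3(2)] in \<open>auto simp: \<rho>_def elim!: eventually_mono\<close>)
    qed
  qed
  then show ?thesis by (intro exI [of _ \<rho>] ballI)
qed

text \<open>Short pieces of \<open>e\<close> have side functions by two-sidedness, and Bolzano
  subdivision glues them. An arc contains no loop around which the sign could change, so this
  succeeds in non-orientable surfaces as well.\<close>

lemma side_function_exists:
  assumes e: "arc_between S e p q" and "e \<subseteq> K" and two: "\<And>x. x \<in> e \<Longrightarrow> two_sided S K x"
  shows "\<exists>\<sigma>. \<forall>x\<in>e. side_function S K x \<sigma>"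
proof -
  obtain \<gamma> where \<gamma>: "embedding_map (top_of_set {0..1::real}) S \<gamma>" "\<gamma> ` {0..1} = e"
    using e by (auto simp: arc_between_def)
  \<comment> \<open>The subdivision argument also considers intervals that stick out of the unit
    interval; they are cut back to it.\<close>
  define P where "P a b \<longleftrightarrow> (\<exists>\<sigma>. \<forall>r \<in> {a..b} \<inter> {0..1}. side_function S K (\<gamma> r) \<sigma>)" for a b
  have "(0::real) \<le> 1" by simp
  then have "P 0 1"
  proof (induction rule: Bolzano)
    case (trans a b c)
    obtain \<sigma> where "\<forall>r\<in>{a..b} \<inter> {0..1}. side_function S K (\<gamma> r) \<sigma>"
      using trans(1) unfolding P_def by blast
    then have \<sigma>: "\<And>r. r \<in> {a..b} \<inter> {0..1} \<Longrightarrow> side_function S K (\<gamma> r) \<sigma>"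
      by blast
    obtain \<tau> where "\<forall>r\<in>{b..c} \<inter> {0..1}. side_function S K (\<gamma> r) \<tau>"
      using trans(2) unfolding P_def by blast
    then have \<tau>: "\<And>r. r \<in> {b..c} \<inter> {0..1} \<Longrightarrow> side_function S K (\<gamma> r) \<tau>"
      by blast
    consider "b < 0" | "b > 1" | "b \<in> {0..1}" by force
    then show ?case
    proof cases
      case 1
      then have "\<forall>r \<in> {a..c} \<inter> {0..1}. side_function S K (\<gamma> r) \<tau>"
        using \<tau> by auto
      then show ?thesis unfolding P_def by blast
    next
      case 2
      then have "\<forall>r \<in> {a..c} \<inter> {0..1}. side_function S K (\<gamma> r) \<sigma>"
        using \<sigma> by auto
      then show ?thesis unfolding P_def by blast
    next
      case 3
      have "two_sided S K (\<gamma> b)"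
        using two 3 \<gamma>(2) by blast
      then show ?thesis
        unfolding P_def using glue_side_functions [OF _ _ \<gamma>(1) 3 \<sigma> trans(3) \<tau> trans(4)] \<gamma>(2) \<open>e \<subseteq> K\<close> by simp
    qed
  next
    case (local x)
    then have "two_sided S K (\<gamma> x)"
      using two \<gamma>(2) by auto
    then obtain \<sigma> where \<sigma>: "\<forall>\<^sub>F y in nhdsin S (\<gamma> x). y \<in> K \<longrightarrow> side_function S K y \<sigma>"
      by (auto simp: two_sided_def)
    obtain d where d: "d > 0" "\<And>u. u \<in> {0..1} \<Longrightarrow> \<bar>u - x\<bar> < d \<Longrightarrow> \<gamma> u \<in> K \<longrightarrow> side_function S K (\<gamma> u) \<sigma>"
      by (rule embedding_map_near [OF \<gamma>(1) _ \<sigma>]) (use local in auto)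
    have "P a b" if "a \<le> x" "x \<le> b" "b - a < d" for a b
      unfolding P_def
    proof (intro exI ballI)
      fix r assume r: "r \<in> {a..b} \<inter> {0..1}"
      then have "\<bar>r - x\<bar> < d" "r \<in> {0..1}" "\<gamma> r \<in> K"
        using that \<gamma>(2) \<open>e \<subseteq> K\<close> by (auto simp: abs_less_iff)
      then show "side_function S K (\<gamma> r) \<sigma>"
        using d(2) by blast
    qed
    then show ?case
      using d(1) by blast
  qed
  then obtain \<sigma> where "\<forall>r \<in> {0..1} \<inter> {0..1}. side_function S K (\<gamma> r) \<sigma>"
    unfolding P_def by blast
  then have "\<forall>x\<in>e. side_function S K x \<sigma>"
    using \<gamma>(2) by auto
  then show ?thesis by (rule exI [of _ \<sigma>])
qed

lemma eventually_notin_arc: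
  assumes "arc_between S K p q" "x \<notin> K" "x \<in> topspace S"
  shows "\<forall>\<^sub>F y in nhdsin S x. y \<notin> K"
proof -
  have "closedin S K"
    using arc_between_closed [OF surface_imp_Hausdorff assms(1)] by blast
  then have "\<forall>\<^sub>F y in nhdsin S x. y \<in> topspace S - K"
    using assms by (intro eventually_nhdsin_open) auto
  then show ?thesis by eventually_elim auto
qed

text \<open>The arcs \<open>b\<close> and \<open>f\<close> continue \<open>e\<close> beyond its endpoints, so that two sides of \<open>e\<close> are also
  distinguished at the endpoints, and the side functions can be glued over the compact arc \<open>e\<close>.\<close>

lemma side_function_on_open_arc_exists:
  assumes e: "arc_between S e p q" and b: "arc_between S b p p'" "e \<inter> b = {p}"
    and f: "arc_between S f q q'" "e \<inter> f = {q}"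
  shows "\<exists>\<sigma>. \<forall>x \<in> e - {p, q}. side_function S e x \<sigma>"
proof -
  \<comment> \<open>\<open>b\<close> and \<open>f\<close> may meet, as in a triangle, but only away
    from \<open>e\<close>. Near a point of \<open>e\<close> the set is therefore \<open>e\<close>
    with at most one of them attached.\<close>
  let ?K = "e \<union> b \<union> f"
  note top = arc_between_topspace [OF e]
  have two: "two_sided S ?K x" if x: "x \<in> e" for x
  proof -
    consider "x = p" | "x = q" | "x \<in> e - {p, q}" using x by blast
    then show ?thesis
    proof cases
      case 1
      have "p \<notin> f" "p \<in> topspace S"
        using f(2) top by auto
      from eventually_notin_arc [OF f(1) this]
      have "\<forall>\<^sub>F y in nhdsin S p. y \<in> e \<union> b \<longleftrightarrow> y \<in> ?K"
        by eventually_elim auto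
      then show ?thesis
        using two_sided_at_junction [OF S e b] two_sided_cong 1 by metis
    next
      case 2
      have "q \<notin> b" "q \<in> topspace S"
        using b(2) top by auto
      from eventually_notin_arc [OF b(1) this]
      have "\<forall>\<^sub>F y in nhdsin S q. y \<in> e \<union> f \<longleftrightarrow> y \<in> ?K"
        by eventually_elim auto
      then show ?thesis
        using two_sided_at_junction [OF S arc_between_commute [OF surface_imp_Hausdorff e] f] two_sided_cong 2 by metis
    next
      case 3
      then have "x \<notin> b" "x \<notin> f" "x \<in> topspace S"
        using b(2) f(2) top by auto
      then have "\<forall>\<^sub>F y in nhdsin S x. y \<notin> b" "\<forall>\<^sub>F y in nhdsin S x. y \<notin> f"
        using eventually_notin_arc b(1) f(1) by blast+
      then have "\<forall>\<^sub>F y in nhdsin S x. y \<in> e \<longleftrightarrow> y \<in> ?K"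
        by eventually_elim auto
      then show ?thesis
        using two_sided_on_open_arc [OF S e 3] two_sided_cong by metis
    qed
  qed
  obtain \<sigma> where \<sigma>: "\<And>x. x \<in> e \<Longrightarrow> side_function S ?K x \<sigma>"
    using side_function_exists [OF e _ two] by blast
  have "side_function S e x \<sigma>" if x: "x \<in> e - {p, q}" for x
  proof -
    have "x \<notin> b" "x \<notin> f" "x \<in> topspace S"
      using b(2) f(2) top x by auto
    then have "\<forall>\<^sub>F y in nhdsin S x. y \<notin> b" "\<forall>\<^sub>F y in nhdsin S x. y \<notin> f"
      using eventually_notin_arc b(1) f(1) by blast+
    then have "\<forall>\<^sub>F y in nhdsin S x. (y \<in> ?K \<longleftrightarrow> y \<in> e) \<and> (y \<notin> ?K \<longrightarrow> \<sigma> y = \<sigma> y)"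
      by eventually_elim auto
    then show ?thesis
      by (rule side_function_cong) (use \<sigma> x in blast)
  qed
  then show ?thesis by (intro exI [of _ \<sigma>] ballI)
qed

end

section \<open>The cyclic order of arcs at a point\<close>

text \<open>\<open>\<sigma>\<close> is a side function of \<open>e\<close> near its endpoint \<open>p\<close>, and \<open>\<tau>\<close> the function of the sides of
  \<open>e \<union> b\<close> that agrees with \<open>\<sigma>\<close> along \<open>e\<close>.\<close>

definition extends_side ::
    "'s topology \<Rightarrow> 's \<Rightarrow> 's set \<Rightarrow> ('s \<Rightarrow> bool) \<Rightarrow> 's set \<Rightarrow> ('s \<Rightarrow> bool) \<Rightarrow> bool" where
  "extends_side S p e \<sigma> b \<tau> \<longleftrightarrow>
     constant_off S (e \<union> b) p \<tau> \<and>
     (\<forall>\<^sub>F q in nhdsin S p. q \<in> e - {p} \<longrightarrow> (\<forall>\<^sub>F x in nhdsin S q. x \<notin> e \<longrightarrow> \<tau> x = \<sigma> x))"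

text \<open>This stands in for the cyclic order of \<open>e\<close>, \<open>b\<close> and
  \<open>c\<close> around \<open>p\<close>: it says that \<open>c\<close> starts in the sector
  between the true side of \<open>e\<close> and \<open>b\<close>.\<close>

definition on_side ::
    "'s topology \<Rightarrow> 's \<Rightarrow> 's set \<Rightarrow> ('s \<Rightarrow> bool) \<Rightarrow> 's set \<Rightarrow> 's set \<Rightarrow> bool" where
  "on_side S p e \<sigma> b c \<longleftrightarrow>
     (\<exists>\<tau>. extends_side S p e \<sigma> b \<tau> \<and> (\<forall>\<^sub>F q in nhdsin S p. q \<in> c - {p} \<longrightarrow> \<tau> q))"

definition arc_from :: "'s topology \<Rightarrow> 's \<Rightarrow> 's set \<Rightarrow> bool" where
  "arc_from S p K \<longleftrightarrow> (\<exists>q. arc_between S K p q)"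

lemma arc_fromD:
  assumes "arc_from S p K" shows "K \<subseteq> topspace S" "p \<in> K" "p \<in> topspace S"
proof -
  obtain q where K: "arc_between S K p q"
    using assms unfolding arc_from_def ..
  show "K \<subseteq> topspace S" "p \<in> K" "p \<in> topspace S"
    using arc_between_topspace [OF K] by auto
qed

section \<open>Extension of a side to a second arc, and the order of arcs at a point\<close>

context
  fixes S :: "'s topology"
  assumes S: "surface S"
begin

lemma eventually_notin_arc_from:
  assumes "arc_from S p K" "x \<notin> K" "x \<in> topspace S"
  shows "\<forall>\<^sub>F y in nhdsin S x. y \<notin> K"
  using assms eventually_notin_arc [OF S] unfolding arc_from_def by blast

lemma frequently_on_arc_from:
  assumes "arc_from S p K" shows "\<exists>\<^sub>F x in nhdsin S p. x \<in> K - {p}"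
proof -
  obtain q where "arc_between S K p q"
    using assms arc_from_def by metis
  from frequently_on_arc [OF this] show ?thesis
    by (rule frequently_elim1) auto
qed

lemma near_one_of_two_arcs:
  assumes b: "arc_from S p b" and eb: "e \<inter> b = {p}" and q: "q \<in> e - {p}" "q \<in> topspace S"
  shows "\<forall>\<^sub>F x in nhdsin S q. x \<in> e \<union> b \<longleftrightarrow> x \<in> e"
proof -
  have "q \<notin> b" using eb q by auto
  from eventually_notin_arc_from [OF b this q(2)] show ?thesis
    by eventually_elim auto
qed

text \<open>A side function of the joined arc at \<open>p\<close> is also one of \<open>e\<close> at
  the nearby points of \<open>e\<close>, where \<open>b\<close> is out of reach. There it equals
  \<sigma> up to one constant sign, which is then corrected.\<close>

lemma extends_side_exists:
  assumes e: "arc_from S p e" and b: "arc_from S p b" and eb: "e \<inter> b = {p}"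
    and \<sigma>: "\<forall>\<^sub>F q in nhdsin S p. q \<in> e - {p} \<longrightarrow> side_function S e q \<sigma>"
  shows "\<exists>\<tau>. extends_side S p e \<sigma> b \<tau> \<and> (\<forall>\<^sub>F q in nhdsin S p. q \<in> e \<union> b \<longrightarrow> side_function S (e \<union> b) q \<tau>)"
proof -
  obtain e' where e': "arc_between S e p e'" using e by (auto simp: arc_from_def)
  obtain b' where b': "arc_between S b p b'" using b by (auto simp: arc_from_def)
  note top = arc_fromD [OF e] arc_fromD [OF b]
  have "two_sided S (e \<union> b) p"
    using two_sided_at_junction [OF S e' b' eb] .
  then obtain \<rho> where \<rho>: "\<forall>\<^sub>F q in nhdsin S p. q \<in> e \<union> b \<longrightarrow> side_function S (e \<union> b) q \<rho>"
    by (auto simp: two_sided_def)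
  have \<rho>e: "\<forall>\<^sub>F q in nhdsin S p. q \<in> e - {p} \<longrightarrow> side_function S e q \<rho>"
    using \<rho>
  proof eventually_elim
    case (elim q)
    show ?case
    proof
      assume q: "q \<in> e - {p}"
      then have "\<forall>\<^sub>F x in nhdsin S q. x \<in> e \<union> b \<longleftrightarrow> x \<in> e"
        using near_one_of_two_arcs [OF b eb] top by blast
      then have "\<forall>\<^sub>F x in nhdsin S q. (x \<in> e \<union> b \<longleftrightarrow> x \<in> e) \<and> (x \<notin> e \<union> b \<longrightarrow> \<rho> x = \<rho> x)"
        by eventually_elim auto
      moreover have "side_function S (e \<union> b) q \<rho>"
        using elim q by blast
      ultimately show "side_function S e q \<rho>"
        by (rule side_function_cong)
    qed
  qed
  obtain s where s: "\<forall>\<^sub>F x in nhdsin S p. x \<in> e - {p} \<longrightarrow> (\<forall>\<^sub>F y in nhdsin S x. y \<notin> e \<longrightarrow> \<sigma> y = (\<rho> y = s))"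
    using side_functions_near_endpoint [OF S e' \<rho>e \<sigma>] by blast
  let ?\<tau> = "\<lambda>x. \<rho> x = s"
  have side: "\<forall>\<^sub>F q in nhdsin S p. q \<in> e \<union> b \<longrightarrow> side_function S (e \<union> b) q ?\<tau>"
    using \<rho> by eventually_elim (auto intro: side_function_negate)
  moreover have "side_function S (e \<union> b) p ?\<tau>"
    using eventually_nhdsin_self [OF side] top by simp
  moreover have "\<forall>\<^sub>F q in nhdsin S p. q \<in> e - {p} \<longrightarrow> (\<forall>\<^sub>F x in nhdsin S q. x \<notin> e \<longrightarrow> ?\<tau> x = \<sigma> x)"
    using s by eventually_elim (auto elim: eventually_mono)
  ultimately show ?thesis
    unfolding extends_side_def side_function_def by blast
qed

text \<open>Every extension is a function \<phi> of a fixed extension that is a side function at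
  \<open>p\<close>. Agreement with \<sigma> along \<open>e\<close>, where \<sigma> takes both
  values, forces \<phi> to be the identity.\<close>

lemma extends_side_unique:
  assumes e: "arc_from S p e" and b: "arc_from S p b" and eb: "e \<inter> b = {p}"
    and \<sigma>: "\<forall>\<^sub>F q in nhdsin S p. q \<in> e - {p} \<longrightarrow> side_function S e q \<sigma>"
    and \<tau>: "extends_side S p e \<sigma> b \<tau>" and \<tau>': "extends_side S p e \<sigma> b \<tau>'"
  shows "\<forall>\<^sub>F x in nhdsin S p. x \<notin> e \<union> b \<longrightarrow> \<tau> x = \<tau>' x"
proof -
  obtain e' where e': "arc_between S e p e'" using e by (auto simp: arc_from_def)
  obtain b' where b': "arc_between S b p b'" using b by (auto simp: arc_from_def)
  note top = arc_fromD [OF e] arc_fromD [OF b]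
  have two: "two_sided S (e \<union> b) p"
    using two_sided_at_junction [OF S e' b' eb] .
  obtain \<rho> where \<rho>: "extends_side S p e \<sigma> b \<rho>"
    and "\<forall>\<^sub>F q in nhdsin S p. q \<in> e \<union> b \<longrightarrow> side_function S (e \<union> b) q \<rho>"
    using extends_side_exists [OF e b eb \<sigma>] by blast
  from eventually_nhdsin_self [OF this(2)] have side: "side_function S (e \<union> b) p \<rho>"
    using top by simp
  have *: "\<forall>\<^sub>F x in nhdsin S p. x \<notin> e \<union> b \<longrightarrow> \<tau> x = \<rho> x" if \<tau>: "extends_side S p e \<sigma> b \<tau>" for \<tau>
  proof -
    obtain \<phi> where \<phi>: "\<forall>\<^sub>F x in nhdsin S p. x \<notin> e \<union> b \<longrightarrow> \<tau> x = \<phi> (\<rho> x)"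
      using side_function_factor [OF two side] \<tau> unfolding extends_side_def by blast
    have near: "\<forall>\<^sub>F q in nhdsin S p. q \<in> e - {p} \<longrightarrow> (\<forall>\<^sub>F x in nhdsin S q. x \<notin> e \<longrightarrow> \<sigma> x = \<phi> (\<sigma> x))"
    proof -
      have 1: "\<forall>\<^sub>F q in nhdsin S p. q \<in> e - {p} \<longrightarrow> (\<forall>\<^sub>F x in nhdsin S q. x \<notin> e \<longrightarrow> \<tau> x = \<sigma> x)"
        "\<forall>\<^sub>F q in nhdsin S p. q \<in> e - {p} \<longrightarrow> (\<forall>\<^sub>F x in nhdsin S q. x \<notin> e \<longrightarrow> \<rho> x = \<sigma> x)"
        using \<tau> \<rho> by (simp_all add: extends_side_def)
      show ?thesis
        using 1 eventually_eventually_nhdsin [OF \<phi>]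
      proof eventually_elim
        case (elim q)
        show ?case
        proof
          assume q: "q \<in> e - {p}"
          then have "\<forall>\<^sub>F x in nhdsin S q. x \<in> e \<union> b \<longleftrightarrow> x \<in> e"
            using near_one_of_two_arcs [OF b eb] top by blast
          moreover have "\<forall>\<^sub>F x in nhdsin S q. x \<notin> e \<longrightarrow> \<tau> x = \<sigma> x" "\<forall>\<^sub>F x in nhdsin S q. x \<notin> e \<longrightarrow> \<rho> x = \<sigma> x"
            "\<forall>\<^sub>F x in nhdsin S q. x \<notin> e \<union> b \<longrightarrow> \<tau> x = \<phi> (\<rho> x)"
            using elim q by blast+
          ultimately show "\<forall>\<^sub>F x in nhdsin S q. x \<notin> e \<longrightarrow> \<sigma> x = \<phi> (\<sigma> x)"
          proof eventually_elim
            case (elim x)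
            show ?case
            proof
              assume "x \<notin> e"
              then have "\<tau> x = \<sigma> x" "\<rho> x = \<sigma> x" "\<tau> x = \<phi> (\<rho> x)"
                using elim by blast+
              then show "\<sigma> x = \<phi> (\<sigma> x)" by simp
            qed
          qed
        qed
      qed
    qed
    from frequently_eventually_conj [OF frequently_on_arc_from [OF e] eventually_conj [OF near \<sigma>]]
    obtain q where q: "side_function S e q \<sigma>" "\<forall>\<^sub>F x in nhdsin S q. x \<notin> e \<longrightarrow> \<sigma> x = \<phi> (\<sigma> x)"
      using frequently_ex by blast
    have "b = \<phi> b" for b
      by (rule side_function_frequently [OF q, of b]) simp
    then have "\<phi> True" "\<not> \<phi> False"
      by auto
    then have "\<phi> b = b" for b
      by (cases b) auto
    then show ?thesis
      using \<phi> by simp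
  qed
  show ?thesis
    using * [OF \<tau>] * [OF \<tau>'] by eventually_elim auto
qed

lemma extends_side_constant_on_arc:
  assumes e: "arc_from S p e" and b: "arc_from S p b" and c: "arc_from S p c" "c \<inter> (e \<union> b) = {p}"
    and \<tau>: "extends_side S p e \<sigma> b \<tau>"
  shows "\<exists>v. \<forall>\<^sub>F q in nhdsin S p. q \<in> c - {p} \<longrightarrow> \<tau> q = v"
proof -
  obtain c' where c': "arc_between S c p c'" using c by (auto simp: arc_from_def)
  have "\<forall>\<^sub>F x in nhdsin S p. x \<notin> e \<union> b \<longrightarrow> (\<forall>\<^sub>F y in nhdsin S x. y \<notin> e \<union> b \<longrightarrow> \<tau> y = \<tau> x)"
    using \<tau> by (simp add: extends_side_def constant_off_def)
  then have "\<forall>\<^sub>F x in nhdsin S p. x \<in> c - {p} \<longrightarrow> (\<forall>\<^sub>F y in nhdsin S x. y \<in> c \<longrightarrow> \<tau> y = \<tau> x)"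
  proof eventually_elim
    case (elim x)
    show ?case
    proof
      assume x: "x \<in> c - {p}"
      then have "x \<notin> e" "x \<notin> b" "x \<in> topspace S"
        using c(2) arc_fromD [OF c(1)] by auto
      then have "\<forall>\<^sub>F y in nhdsin S x. y \<notin> e" "\<forall>\<^sub>F y in nhdsin S x. y \<notin> b"
        using eventually_notin_arc_from e b by blast+
      moreover have "\<forall>\<^sub>F y in nhdsin S x. y \<notin> e \<union> b \<longrightarrow> \<tau> y = \<tau> x"
        using elim \<open>x \<notin> e\<close> \<open>x \<notin> b\<close> by simp
      ultimately show "\<forall>\<^sub>F y in nhdsin S x. y \<in> c \<longrightarrow> \<tau> y = \<tau> x"
        by eventually_elim simp
    qed
  qed
  then show ?thesis
    by (rule constant_near_endpoint [OF surface_imp_Hausdorff [OF S] c'])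
qed

text \<open>By uniqueness the existential quantifier in \<open>on_side\<close> may be read with any
  extension at hand; since \<open>c\<close> keeps accumulating at \<open>p\<close>, the constant
  value along it is determined.\<close>

lemma on_side_iff:
  assumes e: "arc_from S p e" and b: "arc_from S p b" and eb: "e \<inter> b = {p}"
    and c: "arc_from S p c" "c \<inter> (e \<union> b) = {p}"
    and \<sigma>: "\<forall>\<^sub>F q in nhdsin S p. q \<in> e - {p} \<longrightarrow> side_function S e q \<sigma>"
    and \<tau>: "extends_side S p e \<sigma> b \<tau>"
  shows "\<forall>\<^sub>F q in nhdsin S p. q \<in> c - {p} \<longrightarrow> \<tau> q = on_side S p e \<sigma> b c"
proof -
  obtain v where v: "\<forall>\<^sub>F q in nhdsin S p. q \<in> c - {p} \<longrightarrow> \<tau> q = v"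
    using extends_side_constant_on_arc [OF e b c \<tau>] by blast
  have "on_side S p e \<sigma> b c \<longleftrightarrow> v"
  proof
    assume "on_side S p e \<sigma> b c"
    then obtain \<tau>' where \<tau>': "extends_side S p e \<sigma> b \<tau>'" "\<forall>\<^sub>F q in nhdsin S p. q \<in> c - {p} \<longrightarrow> \<tau>' q"
      by (auto simp: on_side_def)
    have "\<forall>\<^sub>F q in nhdsin S p. q \<in> c - {p} \<longrightarrow> v"
      using v \<tau>'(2) extends_side_unique [OF e b eb \<sigma> \<tau> \<tau>'(1)]
      by eventually_elim (use c(2) in blast)
    from frequently_eventually_conj [OF frequently_on_arc_from [OF c(1)] this] show v
      using frequently_ex by blast
  next
    assume v
    then have "\<forall>\<^sub>F q in nhdsin S p. q \<in> c - {p} \<longrightarrow> \<tau> q"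
      using v by simp
    then show "on_side S p e \<sigma> b c"
      unfolding on_side_def using \<tau> by blast
  qed
  then show ?thesis
    using v by simp
qed

lemma extends_side_negate:
  assumes "extends_side S p e \<sigma> b \<tau>"
  shows "extends_side S p e (\<lambda>x. \<sigma> x = s) b (\<lambda>x. \<tau> x = s)"
  unfolding extends_side_def
proof
  show "constant_off S (e \<union> b) p (\<lambda>x. \<tau> x = s)"
    using assms constant_off_comp [of S "e \<union> b" p \<tau> "\<lambda>b. b = s"] by (simp add: extends_side_def)
  have "\<forall>\<^sub>F q in nhdsin S p. q \<in> e - {p} \<longrightarrow> (\<forall>\<^sub>F x in nhdsin S q. x \<notin> e \<longrightarrow> \<tau> x = \<sigma> x)"
    using assms by (simp add: extends_side_def)
  then show "\<forall>\<^sub>F q in nhdsin S p. q \<in> e - {p} \<longrightarrow> (\<forall>\<^sub>F x in nhdsin S q. x \<notin> e \<longrightarrow> (\<tau> x = s) = (\<sigma> x = s))"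
    by eventually_elim (auto elim: eventually_mono)
qed

lemma on_side_negate:
  assumes e: "arc_from S p e" and b: "arc_from S p b" and eb: "e \<inter> b = {p}"
    and c: "arc_from S p c" "c \<inter> (e \<union> b) = {p}"
    and \<sigma>: "\<forall>\<^sub>F q in nhdsin S p. q \<in> e - {p} \<longrightarrow> side_function S e q \<sigma>"
  shows "on_side S p e (\<lambda>x. \<sigma> x = s) b c \<longleftrightarrow> on_side S p e \<sigma> b c = s"
proof -
  obtain \<tau> where \<tau>: "extends_side S p e \<sigma> b \<tau>"
    using extends_side_exists [OF e b eb \<sigma>] by blast
  have \<sigma>s: "\<forall>\<^sub>F q in nhdsin S p. q \<in> e - {p} \<longrightarrow> side_function S e q (\<lambda>x. \<sigma> x = s)"
    using \<sigma> by eventually_elim (auto intro: side_function_negate)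
  have "\<forall>\<^sub>F q in nhdsin S p. q \<in> c - {p} \<longrightarrow>
      on_side S p e (\<lambda>x. \<sigma> x = s) b c = (on_side S p e \<sigma> b c = s)"
    using on_side_iff [OF e b eb c \<sigma> \<tau>] on_side_iff [OF e b eb c \<sigma>s extends_side_negate [OF \<tau>]]
    by eventually_elim auto
  from frequently_eventually_conj [OF frequently_on_arc_from [OF c(1)] this] show ?thesis
    using frequently_ex by blast
qed

text \<open>The conjunction of the functions \<open>\<tau> c\<close>, for \<open>c \<in> P\<close>, would otherwise be constant off \<open>e\<close> near
  \<open>p\<close>, although it takes both values on the two sides of \<open>e\<close>.\<close>

lemma exists_extremal_arc:
  assumes e: "arc_from S p e" and P: "finite P" "P \<noteq> {}"
    and arcs: "\<And>b. b \<in> P \<Longrightarrow> arc_from S p b \<and> e \<inter> b = {p}"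
    and disj: "\<And>b c. b \<in> P \<Longrightarrow> c \<in> P \<Longrightarrow> b \<noteq> c \<Longrightarrow> b \<inter> c = {p}"
    and \<sigma>: "\<forall>\<^sub>F q in nhdsin S p. q \<in> e - {p} \<longrightarrow> side_function S e q \<sigma>"
  shows "\<exists>b\<in>P. \<forall>c\<in>P - {b}. on_side S p e \<sigma> c b"
proof (rule ccontr)
  assume neg: "\<not> ?thesis"
  note top = arc_fromD [OF e]
  have "\<exists>\<tau>. extends_side S p e \<sigma> b \<tau>" if "b \<in> P" for b
    using extends_side_exists [OF e _ _ \<sigma>, of b] arcs [OF that] by blast
  then obtain \<tau> where \<tau>: "\<And>b. b \<in> P \<Longrightarrow> extends_side S p e \<sigma> b (\<tau> b)"
    by metis
  define f where "f x \<longleftrightarrow> (\<forall>c\<in>P. \<tau> c x)" for x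
  have "\<exists>c\<in>P - {b}. \<forall>\<^sub>F q in nhdsin S p. q \<in> b - {p} \<longrightarrow> \<not> \<tau> c q" if b: "b \<in> P" for b
  proof -
    obtain c where c: "c \<in> P - {b}" "\<not> on_side S p e \<sigma> c b"
      using neg b by blast
    have "b \<inter> (e \<union> c) = {p}"
      using arcs [OF b] disj [OF b, of c] c by blast
    then have "\<forall>\<^sub>F q in nhdsin S p. q \<in> b - {p} \<longrightarrow> \<tau> c q = on_side S p e \<sigma> c b"
      using on_side_iff [OF e _ _ _ _ \<sigma> \<tau>, of c b] arcs b c by blast
    then show ?thesis
      using c by (intro bexI [of _ c]) auto
  qed
  \<comment> \<open>\<open>k b\<close> is chosen so that \<open>b\<close> starts on the false side
    of \<open>\<tau> (k b)\<close>. This function is false around the points of \<open>b\<close>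
    near \<open>p\<close>, so \<open>f\<close> is false on both sides of \<open>b\<close> and does
    not jump there.\<close>
  then obtain k where k: "\<And>b. b \<in> P \<Longrightarrow> k b \<in> P - {b}"
    and kval: "\<And>b. b \<in> P \<Longrightarrow> \<forall>\<^sub>F q in nhdsin S p. q \<in> b - {p} \<longrightarrow> \<not> \<tau> (k b) q"
    by metis
  have kval': "\<forall>\<^sub>F q in nhdsin S p. \<forall>b\<in>P. q \<in> b - {p} \<longrightarrow> \<not> \<tau> (k b) q"
    using kval P(1) by (simp add: eventually_ball_finite)
  have const: "\<forall>\<^sub>F x in nhdsin S p. \<forall>c\<in>P. x \<notin> e \<union> c \<longrightarrow> (\<forall>\<^sub>F y in nhdsin S x. y \<notin> e \<union> c \<longrightarrow> \<tau> c y = \<tau> c x)"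
    using \<tau> P(1) by (simp add: eventually_ball_finite extends_side_def constant_off_def)
  have clear: "\<forall>\<^sub>F y in nhdsin S x. y \<notin> c" if "c \<in> P" "x \<notin> c" "x \<in> topspace S" for x c
    using eventually_notin_arc_from arcs that by blast
  have "constant_off S e p f"
    unfolding constant_off_def
    using const kval' eventually_nhdsin_topspace
  proof eventually_elim
    case (elim x)
    have near: "\<forall>\<^sub>F y in nhdsin S x. y \<notin> e \<longrightarrow> \<tau> c y = \<tau> c x"
      if "c \<in> P" "x \<notin> e" "x \<notin> c" for c
    proof -
      have "\<forall>\<^sub>F y in nhdsin S x. y \<notin> e \<union> c \<longrightarrow> \<tau> c y = \<tau> c x"
        using elim(1) that by blast
      moreover have "\<forall>\<^sub>F y in nhdsin S x. y \<notin> c"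
        using clear that elim by blast
      ultimately show ?thesis
        by eventually_elim auto
    qed
    show ?case
    proof
      assume xe: "x \<notin> e"
      show "\<forall>\<^sub>F y in nhdsin S x. y \<notin> e \<longrightarrow> f y = f x"
      proof (cases "\<exists>b\<in>P. x \<in> b")
        case True
        then obtain b where b: "b \<in> P" "x \<in> b" by blast
        have "x \<noteq> p"
          using xe top by blast
        have kb: "k b \<in> P" "\<not> \<tau> (k b) x"
          using k [OF b(1)] elim(2) b \<open>x \<noteq> p\<close> by auto
        have "b \<inter> k b = {p}"
          using disj [OF b(1) kb(1)] k [OF b(1)] by auto
        then have "x \<notin> k b"
          using b \<open>x \<noteq> p\<close> by blast
        from near [OF kb(1) xe this] show ?thesis
          by eventually_elim (use kb in \<open>auto simp: f_def\<close>)
      next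
        case False
        then have "\<forall>\<^sub>F y in nhdsin S x. \<forall>c\<in>P. y \<notin> e \<longrightarrow> \<tau> c y = \<tau> c x"
          using near xe by (intro eventually_ball_finite [OF P(1)] ballI) blast
        then show ?thesis
          by eventually_elim (auto simp: f_def)
      qed
    qed
  qed
  moreover obtain e' where "arc_between S e p e'"
    using e by (auto simp: arc_from_def)
  ultimately obtain v where v: "\<forall>\<^sub>F x in nhdsin S p. x \<notin> e \<longrightarrow> f x = v"
    using one_sided_at_endpoint [OF S] unfolding one_sided_def by blast
  have agree: "\<forall>\<^sub>F q in nhdsin S p. \<forall>c\<in>P. q \<in> e - {p} \<longrightarrow> (\<forall>\<^sub>F x in nhdsin S q. x \<notin> e \<longrightarrow> \<tau> c x = \<sigma> x)"
    by (intro eventually_ball_finite [OF P(1)] ballI) (use \<tau> in \<open>simp add: extends_side_def\<close>)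
  from frequently_eventually_conj [OF frequently_on_arc_from [OF e]
      eventually_conj [OF eventually_conj [OF agree \<sigma>] eventually_eventually_nhdsin [OF v]]]
  obtain q where q: "side_function S e q \<sigma>" "\<forall>\<^sub>F x in nhdsin S q. x \<notin> e \<longrightarrow> f x = v"
    "\<forall>c\<in>P. \<forall>\<^sub>F x in nhdsin S q. x \<notin> e \<longrightarrow> \<tau> c x = \<sigma> x"
    using frequently_ex by blast
  have "\<forall>\<^sub>F x in nhdsin S q. \<forall>c\<in>P. x \<notin> e \<longrightarrow> \<tau> c x = \<sigma> x"
    using q(3) by (intro eventually_ball_finite [OF P(1)]) simp
  with q(2) have "\<forall>\<^sub>F x in nhdsin S q. x \<notin> e \<longrightarrow> \<sigma> x = v"
    by eventually_elim (use P(2) in \<open>auto simp: f_def\<close>)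
  then show False
    using side_function_frequently [OF q(1), of "\<lambda>x. \<sigma> x = v" "\<not> v"] by metis
qed

end

text \<open>The quantifier over all side functions of the open arc avoids a choice of one. That one
  exists is a separate premise wherever it is used.\<close>

definition preserves_sides :: "'s topology \<Rightarrow> ('s \<Rightarrow> 's) \<Rightarrow> 's set \<Rightarrow> 's \<Rightarrow> 's \<Rightarrow> bool" where
  "preserves_sides S h e p q \<longleftrightarrow>
     (\<forall>\<sigma>. (\<forall>x \<in> e - {p, q}. side_function S e x \<sigma>) \<longrightarrow>
        (\<forall>x \<in> e - {p, q}. \<forall>\<^sub>F y in nhdsin S x. y \<notin> e \<longrightarrow> \<sigma> (h y) = \<sigma> y))"

lemma preserves_sides_commute: "preserves_sides S h e p q \<longleftrightarrow> preserves_sides S h e q p"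
  by (simp add: preserves_sides_def insert_commute)

section \<open>Homeomorphisms that fix arcs at a point\<close>

context
  fixes S :: "'s topology" and h :: "'s \<Rightarrow> 's"
  assumes S: "surface S" and h: "homeomorphic_map S S h"
begin

lemma self_homeomorphism_inj: "inj_on h (topspace S)"
  using homeomorphic_imp_injective_map [OF h] .

lemma self_homeomorphism_nhdsin: "x \<in> topspace S \<Longrightarrow> nhdsin S (h x) = filtermap h (nhdsin S x)"
  using nhdsin_homeomorphic_map [of S S "topspace S" h x] h by simp

lemma self_homeomorphism_mem_image: "K \<subseteq> topspace S \<Longrightarrow> x \<in> topspace S \<Longrightarrow> h x \<in> h ` K \<longleftrightarrow> x \<in> K"
  using inj_on_image_mem_iff [OF self_homeomorphism_inj] by blast

lemma open_arc_image:
  assumes "e \<subseteq> topspace S" "h ` e = e" "h p = p" "h q = q" "p \<in> e" "q \<in> e" and x: "x \<in> e - {p, q}"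
  shows "h x \<in> e - {p, q}"
proof -
  have "h x \<in> e"
    using assms by blast
  moreover have "h x \<noteq> h p" "h x \<noteq> h q"
    using inj_on_eq_iff [OF self_homeomorphism_inj, of x p] inj_on_eq_iff [OF self_homeomorphism_inj, of x q] assms by blast+
  ultimately show ?thesis
    using assms by simp
qed

lemma side_function_self_homeomorphism:
  assumes e: "e \<subseteq> topspace S" "h ` e = e" and x: "x \<in> topspace S"
    and \<sigma>: "side_function S e (h x) \<sigma>"
  shows "side_function S e x (\<lambda>y. \<sigma> (h y))"
proof -
  have "side_function S (h -` e) x (\<sigma> \<circ> h)"
    using \<sigma> side_function_transfer [OF self_homeomorphism_nhdsin x] by blast
  moreover have "\<forall>\<^sub>F y in nhdsin S x. (y \<in> h -` e \<longleftrightarrow> y \<in> e) \<and> (y \<notin> h -` e \<longrightarrow> (\<sigma> \<circ> h) y = \<sigma> (h y))"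
    using eventually_nhdsin_topspace
    by eventually_elim (use self_homeomorphism_mem_image [OF e(1)] e(2) in auto)
  ultimately show ?thesis
    by (rule side_function_cong [rotated])
qed

text \<open>The composition of \<sigma> with \<open>h\<close> is again a side function of
  \<open>e\<close>, because \<open>h\<close> maps the open arc into itself; two such functions
  differ by one sign along the whole arc.\<close>

lemma sides_preserved_or_swapped:
  assumes e: "arc_between S e p q" "h ` e = e" and p: "h p = p" "h q = q"
    and \<sigma>: "\<forall>x\<in>e - {p, q}. side_function S e x \<sigma>"
  shows "\<exists>s. \<forall>x\<in>e - {p, q}. \<forall>\<^sub>F y in nhdsin S x. y \<notin> e \<longrightarrow> \<sigma> (h y) = (\<sigma> y = s)"
proof -
  note top = arc_between_topspace [OF e(1)]
  have "side_function S e x (\<lambda>y. \<sigma> (h y))" if x: "x \<in> e - {p, q}" for x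
    using \<sigma> x open_arc_image [OF top(1) e(2) p top(2,3) x]
      side_function_self_homeomorphism [OF top(1) e(2)] top(1) by blast
  then show ?thesis
    using side_functions_along_arc [OF S e(1), of \<sigma> "\<lambda>y. \<sigma> (h y)"] \<sigma> by blast
qed

text \<open>The extension is pushed forward by the inverse \<open>k\<close> of \<open>h\<close>. The
  sign \<open>s\<close> records whether \<open>h\<close> keeps or swaps the sides of
  \<open>e\<close>.\<close>

lemma on_side_image:
  assumes p: "p \<in> topspace S" "h p = p"
    and sub: "e \<subseteq> topspace S" "b \<subseteq> topspace S" "c \<subseteq> topspace S" and e: "h ` e = e"
    and pres: "\<forall>\<^sub>F q in nhdsin S p. q \<in> e - {p} \<longrightarrow> (\<forall>\<^sub>F x in nhdsin S q. x \<notin> e \<longrightarrow> \<sigma> (h x) = (\<sigma> x = s))"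
    and on: "on_side S p e \<sigma> b c"
  shows "on_side S p e (\<lambda>x. \<sigma> x = s) (h ` b) (h ` c)"
proof -
  obtain \<tau> where \<tau>: "constant_off S (e \<union> b) p \<tau>"
    "\<forall>\<^sub>F q in nhdsin S p. q \<in> e - {p} \<longrightarrow> (\<forall>\<^sub>F x in nhdsin S q. x \<notin> e \<longrightarrow> \<tau> x = \<sigma> x)"
    "\<forall>\<^sub>F q in nhdsin S p. q \<in> c - {p} \<longrightarrow> \<tau> q"
    using on unfolding on_side_def extends_side_def by blast
  define k where "k = inv_into (topspace S) h"
  have kh: "k (h x) = x" if "x \<in> topspace S" for x
    using that self_homeomorphism_inj by (simp add: k_def)
  have nhp: "nhdsin S p = filtermap h (nhdsin S p)"
    using self_homeomorphism_nhdsin [OF p(1)] p(2) by simp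
  have he: "h x \<in> e \<longleftrightarrow> x \<in> e" if "x \<in> topspace S" for x
    using self_homeomorphism_mem_image [OF sub(1) that] e by simp
  have hp: "h x = p \<longleftrightarrow> x = p" if "x \<in> topspace S" for x
    using inj_onD [OF self_homeomorphism_inj, of x p] that p by auto
  let ?\<tau> = "\<tau> \<circ> k"
  have "constant_off S (h -` (e \<union> h ` b)) p (?\<tau> \<circ> h)"
  proof (rule constant_off_cong [OF _ \<tau>(1)])
    show "\<forall>\<^sub>F x in nhdsin S p. (x \<in> e \<union> b \<longleftrightarrow> x \<in> h -` (e \<union> h ` b)) \<and>
        (x \<notin> e \<union> b \<longrightarrow> \<tau> x = (?\<tau> \<circ> h) x)"
      using eventually_nhdsin_topspace
      by eventually_elim (use he kh self_homeomorphism_mem_image [OF sub(2)] in auto)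
  qed
  then have "constant_off S (e \<union> h ` b) p ?\<tau>"
    using constant_off_transfer [OF self_homeomorphism_nhdsin p(1), of "e \<union> h ` b" ?\<tau>] p(2) by simp
  moreover have "\<forall>\<^sub>F q in nhdsin S p. q \<in> e - {p} \<longrightarrow> (\<forall>\<^sub>F x in nhdsin S q. x \<notin> e \<longrightarrow> ?\<tau> x = (\<sigma> x = s))"
  proof (subst nhp, unfold eventually_filtermap)
    show "\<forall>\<^sub>F q in nhdsin S p. h q \<in> e - {p} \<longrightarrow> (\<forall>\<^sub>F x in nhdsin S (h q). x \<notin> e \<longrightarrow> ?\<tau> x = (\<sigma> x = s))"
      using \<tau>(2) pres eventually_nhdsin_topspace
    proof eventually_elim
      case (elim q)
      show ?case
      proof
        assume "h q \<in> e - {p}"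
        then have "q \<in> e - {p}"
          using he hp elim(3) by auto
        then have "\<forall>\<^sub>F x in nhdsin S q. x \<notin> e \<longrightarrow> \<tau> x = \<sigma> x"
          "\<forall>\<^sub>F x in nhdsin S q. x \<notin> e \<longrightarrow> \<sigma> (h x) = (\<sigma> x = s)"
          using elim by blast+
        then have "\<forall>\<^sub>F x in nhdsin S q. h x \<notin> e \<longrightarrow> ?\<tau> (h x) = (\<sigma> (h x) = s)"
          using eventually_nhdsin_topspace
          by eventually_elim (use he kh in auto)
        then show "\<forall>\<^sub>F x in nhdsin S (h q). x \<notin> e \<longrightarrow> ?\<tau> x = (\<sigma> x = s)"
          by (simp only: self_homeomorphism_nhdsin [OF elim(3)] eventually_filtermap)
      qed
    qed
  qed
  moreover have "\<forall>\<^sub>F q in nhdsin S p. q \<in> h ` c - {p} \<longrightarrow> ?\<tau> q"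
  proof (subst nhp, unfold eventually_filtermap)
    show "\<forall>\<^sub>F q in nhdsin S p. h q \<in> h ` c - {p} \<longrightarrow> ?\<tau> (h q)"
      using \<tau>(3) eventually_nhdsin_topspace
      by eventually_elim (use hp kh self_homeomorphism_mem_image [OF sub(3)] in auto)
  qed
  ultimately show ?thesis
    unfolding on_side_def extends_side_def by blast
qed

text \<open>Since \<open>h\<close> keeps the order of the arcs as seen from the true side of
  \<open>e\<close>, it cannot permute the moved ones: the first of them would have to precede its
  own image and, being itself the image of a later one, also come after it.\<close>

lemma arcs_at_point_fixed:
  assumes p: "h p = p" and e: "arc_from S p e" "h ` e = e" and P: "finite P"
    and arcs: "\<And>b. b \<in> P \<Longrightarrow> arc_from S p b \<and> e \<inter> b = {p}"
    and disj: "\<And>b c. b \<in> P \<Longrightarrow> c \<in> P \<Longrightarrow> b \<noteq> c \<Longrightarrow> b \<inter> c = {p}"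
    and hP: "\<And>b. b \<in> P \<Longrightarrow> h ` b \<in> P"
    and \<sigma>: "\<forall>\<^sub>F q in nhdsin S p. q \<in> e - {p} \<longrightarrow> side_function S e q \<sigma>"
    and pres: "\<forall>\<^sub>F q in nhdsin S p. q \<in> e - {p} \<longrightarrow> (\<forall>\<^sub>F x in nhdsin S q. x \<notin> e \<longrightarrow> \<sigma> (h x) = \<sigma> x)"
    and b: "b \<in> P"
  shows "h ` b = b"
proof (rule ccontr)
  assume "h ` b \<noteq> b"
  let ?M = "{b\<in>P. h ` b \<noteq> b}"
  note top = arc_fromD [OF e(1)]
  have sub: "b \<subseteq> topspace S" if "b \<in> P" for b
    using arcs [OF that] arc_fromD(1) [of S p b] by simp
  have inj: "inj_on ((`) h) P"
  proof (rule inj_onI)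
    fix b c assume "b \<in> P" "c \<in> P" "h ` b = h ` c"
    then show "b = c"
      using inj_on_image_eq_iff [OF self_homeomorphism_inj sub sub] by blast
  qed
  have hM: "(`) h ` ?M \<subseteq> ?M"
    using hP inj by (auto dest: inj_onD)
  have "inj_on ((`) h) ?M"
    using inj by (rule inj_on_subset) auto
  then have surj: "(`) h ` ?M = ?M"
    using P hM by (intro endo_inj_surj) auto
  have "?M \<noteq> {}"
    using b \<open>h ` b \<noteq> b\<close> by blast
  \<comment> \<open>The first moved arc met when turning from the true side of
    \<open>e\<close>.\<close>
  have "\<exists>b\<in>?M. \<forall>c\<in>?M - {b}. on_side S p e \<sigma> c b"
  proof (rule exists_extremal_arc [OF S e(1) _ \<open>?M \<noteq> {}\<close> _ _ \<sigma>])
    show "finite ?M" using P by simp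
    show "arc_from S p b \<and> e \<inter> b = {p}" if "b \<in> ?M" for b
      using arcs that by simp
    show "b \<inter> c = {p}" if "b \<in> ?M" "c \<in> ?M" "b \<noteq> c" for b c
      using disj that by simp
  qed
  then obtain b where b: "b \<in> ?M" and ext': "\<forall>c\<in>?M - {b}. on_side S p e \<sigma> c b"
    by (rule bexE)
  have ext: "on_side S p e \<sigma> c b" if "c \<in> ?M - {b}" for c
    using ext' that by (rule bspec)
  define b1 where "b1 = h ` b"
  have b1: "b1 \<in> ?M" "b1 \<noteq> b"
    using b hM by (auto simp: b1_def)
  have on1: "on_side S p e \<sigma> b1 b"
    using b1 by (intro ext) simp
  have "b \<in> (`) h ` ?M"
    using b by (subst surj)
  then obtain c where c: "c \<in> ?M" "b = h ` c"
    by (rule imageE)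
  then have "c \<noteq> b"
    using b by auto
  then have "on_side S p e \<sigma> c b"
    using c(1) by (intro ext) simp
  moreover have pres': "\<forall>\<^sub>F q in nhdsin S p. q \<in> e - {p} \<longrightarrow>
      (\<forall>\<^sub>F x in nhdsin S q. x \<notin> e \<longrightarrow> \<sigma> (h x) = (\<sigma> x = True))"
    using pres by simp
  ultimately have "on_side S p e (\<lambda>x. \<sigma> x = True) (h ` c) (h ` b)"
    using b c by (intro on_side_image [OF top(3) p top(1) sub sub e(2) pres']) auto
  then have on2: "on_side S p e \<sigma> b b1"
    using c by (simp add: b1_def)
  have \<sigma>': "\<forall>\<^sub>F q in nhdsin S p. q \<in> e - {p} \<longrightarrow> side_function S e q (\<lambda>x. \<sigma> x = False)"
    using \<sigma> by eventually_elim (intro impI side_function_negate, blast)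
  \<comment> \<open>Antisymmetry of the order on two arcs: one of them comes first from the other
    side of \<open>e\<close>, which contradicts that each precedes the other from the true
    side.\<close>
  have "\<exists>d\<in>{b, b1}. \<forall>c\<in>{b, b1} - {d}. on_side S p e (\<lambda>x. \<sigma> x = False) c d"
  proof (rule exists_extremal_arc [OF S e(1) _ _ _ _ \<sigma>'])
    show "arc_from S p d \<and> e \<inter> d = {p}" if "d \<in> {b, b1}" for d
      using arcs that b b1 by blast
    show "c \<inter> d = {p}" if "c \<in> {b, b1}" "d \<in> {b, b1}" "c \<noteq> d" for c d
      using disj [of c d] that b b1 by blast
  qed auto
  then have "on_side S p e (\<lambda>x. \<sigma> x = False) b1 b \<or> on_side S p e (\<lambda>x. \<sigma> x = False) b b1"
    using b1(2) by auto
  moreover have "b \<inter> b1 = {p}" "arc_from S p b" "e \<inter> b = {p}" "arc_from S p b1" "e \<inter> b1 = {p}"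
    using disj [of b b1] arcs [of b] arcs [of b1] b b1 by auto
  moreover from this have "b \<inter> (e \<union> b1) = {p}" "b1 \<inter> (e \<union> b) = {p}"
    by blast+
  ultimately show False
    using on_side_negate [OF S e(1) _ _ _ _ \<sigma>, of b1 b False] on_side_negate [OF S e(1) _ _ _ _ \<sigma>, of b b1 False]
      on1 on2 by blast
qed

text \<open>If \<open>h\<close> swapped the sides of \<open>e\<close>, it would exchange the two
  sectors that \<open>e\<close> and \<open>b\<close> cut out at \<open>p\<close>, although
  \<open>c\<close> lies in one of them and is fixed.\<close>

lemma preserves_sides_of_fixed_arcs:
  assumes p: "h p = p" "h q = q" and e: "arc_between S e p q" "h ` e = e"
    and b: "arc_from S p b" "e \<inter> b = {p}" "h ` b = b"
    and c: "arc_from S p c" "e \<inter> c = {p}" "h ` c = c" and bc: "b \<inter> c = {p}"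
  shows "preserves_sides S h e p q"
  unfolding preserves_sides_def
proof (intro allI impI)
  fix \<sigma> assume \<sigma>: "\<forall>x\<in>e - {p, q}. side_function S e x \<sigma>"
  have e': "arc_from S p e"
    using e(1) by (auto simp: arc_from_def)
  note top = arc_between_topspace [OF e(1)]
  obtain s where s: "\<forall>x\<in>e - {p, q}. \<forall>\<^sub>F y in nhdsin S x. y \<notin> e \<longrightarrow> \<sigma> (h y) = (\<sigma> y = s)"
    using sides_preserved_or_swapped [OF e p \<sigma>] ..
  have off: "\<forall>\<^sub>F x in nhdsin S p. x \<noteq> q"
    using eventually_neq [OF S] top by auto
  have \<sigma>': "\<forall>\<^sub>F x in nhdsin S p. x \<in> e - {p} \<longrightarrow> side_function S e x (\<lambda>y. \<sigma> y = t)" for t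
    using off by eventually_elim (use \<sigma> in \<open>auto intro: side_function_negate\<close>)
  have pres: "\<forall>\<^sub>F x in nhdsin S p. x \<in> e - {p} \<longrightarrow>
      (\<forall>\<^sub>F y in nhdsin S x. y \<notin> e \<longrightarrow> (\<sigma> (h y) = t) = ((\<sigma> y = t) = s))" for t
    using off
  proof eventually_elim
    case (elim x)
    show ?case
    proof
      assume "x \<in> e - {p}"
      then have "\<forall>\<^sub>F y in nhdsin S x. y \<notin> e \<longrightarrow> \<sigma> (h y) = (\<sigma> y = s)"
        using s elim by blast
      then show "\<forall>\<^sub>F y in nhdsin S x. y \<notin> e \<longrightarrow> (\<sigma> (h y) = t) = ((\<sigma> y = t) = s)"
        by eventually_elim auto
    qed
  qed
  have cc: "c \<inter> (e \<union> b) = {p}"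
    using b c bc by blast
  \<comment> \<open>With this sign \<open>c\<close> lies on the true side, which is the case that
    \<open>on_side_image\<close> handles.\<close>
  define t where "t = on_side S p e \<sigma> b c"
  have \<sigma>0: "\<forall>\<^sub>F x in nhdsin S p. x \<in> e - {p} \<longrightarrow> side_function S e x \<sigma>"
    using \<sigma>' [of True] by simp
  have "on_side S p e (\<lambda>x. \<sigma> x = t) b c"
    using on_side_negate [OF S e' b(1,2) c(1) cc \<sigma>0] by (simp add: t_def)
  then have "on_side S p e (\<lambda>x. (\<sigma> x = t) = s) (h ` b) (h ` c)"
    using top arc_fromD [OF b(1)] arc_fromD [OF c(1)]
    by (intro on_side_image [OF _ p(1) _ _ _ e(2) pres]) auto
  then have "on_side S p e (\<lambda>x. (\<sigma> x = t) = s) b c"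
    using b c by simp
  then have "(on_side S p e \<sigma> b c = t) = s"
    using on_side_negate [OF S e' b(1,2) c(1) cc \<sigma>' [of t], of s]
      on_side_negate [OF S e' b(1,2) c(1) cc \<sigma>0, of t] by simp
  then have s
    by (simp add: t_def)
  then show "\<forall>x\<in>e - {p, q}. \<forall>\<^sub>F y in nhdsin S x. y \<notin> e \<longrightarrow> \<sigma> (h y) = \<sigma> y"
    using s by simp
qed

text \<open>Sides are carried from \<open>e\<close> to \<open>b\<close> around their common
  endpoint. If \<tau> extends a side function of \<open>e\<close> to both arcs, then so does \<tau>
  composed with \<open>h\<close>, since \<open>h\<close> preserves the sides of \<open>e\<close>. By
  uniqueness the two agree near \<open>p\<close>, and read along \<open>b\<close> this says that
  \<open>h\<close> preserves the sides of \<open>b\<close>.\<close>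

lemma preserves_sides_transfer:
  assumes p: "h p = p" "h r = r" and e: "arc_between S e p q" "h ` e = e"
    and b: "arc_between S b p r" "e \<inter> b = {p}" "h ` b = b"
    and pres: "preserves_sides S h e p q" and ex: "\<exists>\<sigma>. \<forall>x\<in>e - {p, q}. side_function S e x \<sigma>"
  shows "preserves_sides S h b p r"
  unfolding preserves_sides_def
proof (intro allI impI)
  fix \<sigma> assume \<sigma>: "\<forall>x\<in>b - {p, r}. side_function S b x \<sigma>"
  obtain \<eta> where \<eta>: "\<forall>x\<in>e - {p, q}. side_function S e x \<eta>"
    using ex by blast
  then have \<eta>h: "\<forall>x\<in>e - {p, q}. \<forall>\<^sub>F y in nhdsin S x. y \<notin> e \<longrightarrow> \<eta> (h y) = \<eta> y"
    using pres unfolding preserves_sides_def by blast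
  have e': "arc_from S p e" and b': "arc_from S p b"
    using e(1) b(1) by (auto simp: arc_from_def)
  note top = arc_between_topspace [OF e(1)] arc_between_topspace [OF b(1)]
  obtain s where s: "\<forall>x\<in>b - {p, r}. \<forall>\<^sub>F y in nhdsin S x. y \<notin> b \<longrightarrow> \<sigma> (h y) = (\<sigma> y = s)"
    using sides_preserved_or_swapped [OF b(1,3) p \<sigma>] ..
  have offq: "\<forall>\<^sub>F x in nhdsin S p. x \<noteq> q" and offr: "\<forall>\<^sub>F x in nhdsin S p. x \<noteq> r"
    using eventually_neq [OF S] top by auto
  have \<eta>0: "\<forall>\<^sub>F x in nhdsin S p. x \<in> e - {p} \<longrightarrow> side_function S e x \<eta>"
    using offq by eventually_elim (use \<eta> in auto)
  have \<sigma>0: "\<forall>\<^sub>F x in nhdsin S p. x \<in> b - {p} \<longrightarrow> side_function S b x \<sigma>"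
    using offr by eventually_elim (use \<sigma> in auto)
  have nhp: "nhdsin S p = filtermap h (nhdsin S p)"
    using self_homeomorphism_nhdsin [of p] top p by auto
  obtain \<tau> where \<tau>: "extends_side S p e \<eta> b \<tau>"
    and \<tau>side: "\<forall>\<^sub>F x in nhdsin S p. x \<in> e \<union> b \<longrightarrow> side_function S (e \<union> b) x \<tau>"
    using extends_side_exists [OF S e' b' b(2) \<eta>0] by blast
  have mem: "h x \<in> e \<longleftrightarrow> x \<in> e" "h x \<in> b \<longleftrightarrow> x \<in> b" "h x = p \<longleftrightarrow> x = p" if "x \<in> topspace S" for x
    using self_homeomorphism_mem_image [OF top(1) that] self_homeomorphism_mem_image [OF top(5) that] e(2) b(3)
      inj_onD [OF self_homeomorphism_inj, of x p] p top that by auto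
  have "extends_side S p e \<eta> b (\<lambda>x. \<tau> (h x))"
    unfolding extends_side_def
  proof
    have "constant_off S (e \<union> b) (h p) \<tau>"
      using \<tau> p by (simp add: extends_side_def)
    then have "constant_off S (h -` (e \<union> b)) p (\<tau> \<circ> h)"
      using constant_off_transfer [OF self_homeomorphism_nhdsin, of p] top by blast
    then show "constant_off S (e \<union> b) p (\<lambda>x. \<tau> (h x))"
    proof (rule constant_off_cong [rotated])
      show "\<forall>\<^sub>F x in nhdsin S p. (x \<in> h -` (e \<union> b) \<longleftrightarrow> x \<in> e \<union> b) \<and>
          (x \<notin> h -` (e \<union> b) \<longrightarrow> (\<tau> \<circ> h) x = \<tau> (h x))"
        using eventually_nhdsin_topspace by eventually_elim (use mem in auto)
    qed
    have "\<forall>\<^sub>F x in nhdsin S p. x \<in> e - {p} \<longrightarrow> (\<forall>\<^sub>F y in nhdsin S x. y \<notin> e \<longrightarrow> \<tau> y = \<eta> y)"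
      using \<tau> by (simp add: extends_side_def)
    then have "\<forall>\<^sub>F x in nhdsin S p. h x \<in> e - {p} \<longrightarrow> (\<forall>\<^sub>F y in nhdsin S (h x). y \<notin> e \<longrightarrow> \<tau> y = \<eta> y)"
      by (subst (asm) nhp) (simp only: eventually_filtermap)
    then show "\<forall>\<^sub>F x in nhdsin S p. x \<in> e - {p} \<longrightarrow> (\<forall>\<^sub>F y in nhdsin S x. y \<notin> e \<longrightarrow> \<tau> (h y) = \<eta> y)"
      using offq eventually_nhdsin_topspace
    proof eventually_elim
      case (elim x)
      show ?case
      proof
        assume x: "x \<in> e - {p}"
        then have "\<forall>\<^sub>F y in nhdsin S (h x). y \<notin> e \<longrightarrow> \<tau> y = \<eta> y"
          using elim mem by auto
        then have "\<forall>\<^sub>F y in nhdsin S x. h y \<notin> e \<longrightarrow> \<tau> (h y) = \<eta> (h y)"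
          by (simp only: self_homeomorphism_nhdsin [OF elim(3)] eventually_filtermap)
        moreover have "\<forall>\<^sub>F y in nhdsin S x. y \<notin> e \<longrightarrow> \<eta> (h y) = \<eta> y"
          using \<eta>h x elim by blast
        ultimately show "\<forall>\<^sub>F y in nhdsin S x. y \<notin> e \<longrightarrow> \<tau> (h y) = \<eta> y"
          using eventually_nhdsin_topspace by eventually_elim (use mem in auto)
      qed
    qed
  qed
  from extends_side_unique [OF S e' b' b(2) \<eta>0 \<tau> this]
  have inv: "\<forall>\<^sub>F x in nhdsin S p. x \<notin> e \<union> b \<longrightarrow> \<tau> x = \<tau> (h x)" .
  have near_b: "\<forall>\<^sub>F y in nhdsin S x. y \<in> b \<union> e \<longleftrightarrow> y \<in> b" if "x \<in> b - {p}" for x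
    using near_one_of_two_arcs [OF S e', of b x] b(2) that top by (auto simp: Int_commute)
  have \<tau>b: "\<forall>\<^sub>F x in nhdsin S p. x \<in> b - {p} \<longrightarrow> side_function S b x \<tau>"
    using \<tau>side
  proof eventually_elim
    case (elim x)
    show ?case
    proof
      assume x: "x \<in> b - {p}"
      have "\<forall>\<^sub>F y in nhdsin S x. (y \<in> e \<union> b \<longleftrightarrow> y \<in> b) \<and> (y \<notin> e \<union> b \<longrightarrow> \<tau> y = \<tau> y)"
        using near_b [OF x] by eventually_elim auto
      then show "side_function S b x \<tau>"
        by (rule side_function_cong) (use elim x in blast)
    qed
  qed
  obtain t where t: "\<forall>\<^sub>F x in nhdsin S p. x \<in> b - {p} \<longrightarrow> (\<forall>\<^sub>F y in nhdsin S x. y \<notin> b \<longrightarrow> \<sigma> y = (\<tau> y = t))"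
    using side_functions_near_endpoint [OF S b(1) \<tau>b \<sigma>0] by blast
  have th: "\<forall>\<^sub>F x in nhdsin S p. h x \<in> b - {p} \<longrightarrow> (\<forall>\<^sub>F y in nhdsin S (h x). y \<notin> b \<longrightarrow> \<sigma> y = (\<tau> y = t))"
    using t by (subst (asm) nhp) (simp only: eventually_filtermap)
  \<comment> \<open>Near \<open>p\<close> the given \<sigma> is \<tau> up to the sign
    \<open>t\<close>, which cancels because \<tau> is invariant under \<open>h\<close>. So the sign
    \<open>s\<close> is true near some point of \<open>b\<close>, and it is the same along all of
    \<open>b\<close>.\<close>
  have "\<forall>\<^sub>F x in nhdsin S p. x \<in> b - {p} \<longrightarrow> side_function S b x \<sigma> \<and> (\<forall>\<^sub>F y in nhdsin S x. y \<notin> b \<longrightarrow> s)"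
    using t th \<sigma>0 eventually_eventually_nhdsin [OF inv] offr eventually_nhdsin_topspace
  proof eventually_elim
    case (elim x)
    show ?case
    proof
      assume x: "x \<in> b - {p}"
      then have "h x \<in> b - {p}"
        using mem elim(6) by auto
      then have "\<forall>\<^sub>F y in nhdsin S (h x). y \<notin> b \<longrightarrow> \<sigma> y = (\<tau> y = t)"
        using elim by blast
      then have "\<forall>\<^sub>F y in nhdsin S x. h y \<notin> b \<longrightarrow> \<sigma> (h y) = (\<tau> (h y) = t)"
        by (simp only: self_homeomorphism_nhdsin [OF elim(6)] eventually_filtermap)
      moreover have "\<forall>\<^sub>F y in nhdsin S x. y \<notin> b \<longrightarrow> \<sigma> y = (\<tau> y = t)"
        "\<forall>\<^sub>F y in nhdsin S x. y \<notin> e \<union> b \<longrightarrow> \<tau> y = \<tau> (h y)"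
        "\<forall>\<^sub>F y in nhdsin S x. y \<notin> b \<longrightarrow> \<sigma> (h y) = (\<sigma> y = s)"
        using elim x s by blast+
      ultimately have "\<forall>\<^sub>F y in nhdsin S x. y \<notin> b \<longrightarrow> s"
        using near_b [OF x] eventually_nhdsin_topspace
        by eventually_elim (use mem in auto)
      then show "side_function S b x \<sigma> \<and> (\<forall>\<^sub>F y in nhdsin S x. y \<notin> b \<longrightarrow> s)"
        using elim x by blast
    qed
  qed
  from frequently_eventually_conj [OF frequently_on_arc_from [OF S b'] this]
  obtain x where x: "side_function S b x \<sigma>" "\<forall>\<^sub>F y in nhdsin S x. y \<notin> b \<longrightarrow> s"
    using frequently_ex by blast
  have s
    by (rule side_function_frequently [OF x])
  then show "\<forall>x\<in>b - {p, r}. \<forall>\<^sub>F y in nhdsin S x. y \<notin> b \<longrightarrow> \<sigma> (h y) = \<sigma> y"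
    using s by simp
qed

lemma arcs_fixed_of_preserves_sides:
  assumes p: "h p = p" and e: "arc_between S e p q" "h ` e = e" and P: "finite P"
    and arcs: "\<And>b. b \<in> P \<Longrightarrow> arc_from S p b \<and> e \<inter> b = {p}"
    and disj: "\<And>b c. b \<in> P \<Longrightarrow> c \<in> P \<Longrightarrow> b \<noteq> c \<Longrightarrow> b \<inter> c = {p}"
    and hP: "\<And>b. b \<in> P \<Longrightarrow> h ` b \<in> P"
    and pres: "preserves_sides S h e p q" and ex: "\<exists>\<sigma>. \<forall>x\<in>e - {p, q}. side_function S e x \<sigma>"
    and b: "b \<in> P"
  shows "h ` b = b"
proof -
  obtain \<sigma> where \<sigma>: "\<forall>x\<in>e - {p, q}. side_function S e x \<sigma>"
    using ex by blast
  then have \<sigma>h: "\<forall>x\<in>e - {p, q}. \<forall>\<^sub>F y in nhdsin S x. y \<notin> e \<longrightarrow> \<sigma> (h y) = \<sigma> y"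
    using pres unfolding preserves_sides_def by blast
  note top = arc_between_topspace [OF e(1)]
  have off: "\<forall>\<^sub>F x in nhdsin S p. x \<noteq> q"
    using eventually_neq [OF S] top by auto
  have "\<forall>\<^sub>F x in nhdsin S p. x \<in> e - {p} \<longrightarrow> side_function S e x \<sigma>"
    using off by eventually_elim (use \<sigma> in auto)
  moreover have "\<forall>\<^sub>F x in nhdsin S p. x \<in> e - {p} \<longrightarrow> (\<forall>\<^sub>F y in nhdsin S x. y \<notin> e \<longrightarrow> \<sigma> (h y) = \<sigma> y)"
    using off by eventually_elim (use \<sigma>h in auto)
  moreover have "arc_from S p e"
    using e(1) by (auto simp: arc_from_def)
  ultimately show ?thesis
    using arcs_at_point_fixed [OF p _ e(2) P arcs disj hP _ _ b] by blast
qed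

end

section \<open>Locally finite connected graphs\<close>

definition adjacency :: "'v set set \<Rightarrow> ('v \<times> 'v) set" where
  "adjacency E = {(a, b). {a, b} \<in> E}"

context simple_graph
begin

lemma adjacent_vertices: "{u, w} \<in> E \<Longrightarrow> u \<in> V \<and> w \<in> V \<and> u \<noteq> w"
  using edge_ends [of "{u, w}"] by (auto simp: doubleton_eq_iff)

lemma edge_subset: "e \<in> E \<Longrightarrow> e \<subseteq> V"
  using edge_ends by blast

text \<open>The relation power counts walks of length exactly \<open>n\<close>, which may backtrack.
  Such walks are preserved by automorphisms just as distances are.\<close>

lemma finite_sphere:
  assumes "locally_finite_graph V E"
  shows "finite {w. (x, w) \<in> adjacency E ^^ n}"
proof (induction n)
  case (Suc n)
  have nbrs: "finite {w. {v, w} \<in> E}" for v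
  proof (cases "v \<in> V")
    case True
    have "inj_on (\<lambda>w. {v, w}) {w. {v, w} \<in> E}"
      by (auto simp: inj_on_def doubleton_eq_iff)
    moreover have "(\<lambda>w. {v, w}) ` {w. {v, w} \<in> E} \<subseteq> {e\<in>E. v \<in> e}"
      by auto
    moreover have "finite {e\<in>E. v \<in> e}"
      using assms True by (simp add: locally_finite_graph_def)
    ultimately show ?thesis
      by (meson finite_imageD finite_subset)
  next
    case False
    then have "{w. {v, w} \<in> E} = {}"
      using adjacent_vertices by blast
    then show ?thesis by (metis finite.emptyI)
  qed
  have "{w. (x, w) \<in> adjacency E ^^ Suc n} = (\<Union>v\<in>{v. (x, v) \<in> adjacency E ^^ n}. {w. {v, w} \<in> E})"
    by (auto simp: adjacency_def relcomp_unfold)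
  then show ?case
    using Suc nbrs by simp
qed simp

lemma reachable:
  assumes "connected_graph V E" "x \<in> V" "y \<in> V"
  obtains n where "(x, y) \<in> adjacency E ^^ n"
  using assms rtrancl_imp_relpow unfolding connected_graph_def adjacency_def by blast

lemma countable_vertices:
  assumes "locally_finite_graph V E" "connected_graph V E"
  shows "countable V"
proof -
  obtain x where "x \<in> V"
    using assms by (auto simp: connected_graph_def)
  have "V \<subseteq> (\<Union>n. {w. (x, w) \<in> adjacency E ^^ n})"
  proof
    fix y assume "y \<in> V"
    then obtain n where "(x, y) \<in> adjacency E ^^ n"
      using reachable [OF assms(2) \<open>x \<in> V\<close>] by metis
    then show "y \<in> (\<Union>n. {w. (x, w) \<in> adjacency E ^^ n})" by blast
  qed
  moreover have "countable (\<Union>n. {w. (x, w) \<in> adjacency E ^^ n})"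
    using countable_finite [OF finite_sphere [OF assms(1)]] by simp
  ultimately show ?thesis
    by (rule countable_subset)
qed

text \<open>An automorphism that fixes \<open>x\<close> permutes the walks of length
  \<open>n\<close> from \<open>x\<close>, so the orbit of \<open>y\<close> stays among their
  finitely many endpoints.\<close>

lemma subdegree_finite_automorphisms:
  assumes "locally_finite_graph V E" "connected_graph V E" and A: "A \<subseteq> graph_automorphisms V E"
  shows "subdegree_finite (perm_group V A) V (\<lambda>a. a)"
  unfolding subdegree_finite_def
proof (intro ballI)
  fix x y assume "x \<in> V" "y \<in> V"
  then obtain n where n: "(x, y) \<in> adjacency E ^^ n"
    using reachable [OF assms(2)] by blast
  have step: "(a u, a w) \<in> adjacency E" if "a \<in> A" "(u, w) \<in> adjacency E" for a u w
    using that A adjacent_vertices by (auto simp: adjacency_def graph_automorphisms_def)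
  have "(a u, a w) \<in> adjacency E ^^ m" if "a \<in> A" "(u, w) \<in> adjacency E ^^ m" for a u w m
    using that(2)
  proof (induction m arbitrary: w)
    case (Suc m)
    then show ?case
      using step [OF that(1)] by (auto simp: relcomp_unfold)
  qed simp
  then have "orbit ((perm_group V A)\<lparr>carrier := stabilizer (perm_group V A) (\<lambda>a. a) x\<rparr>) (\<lambda>a. a) y
      \<subseteq> {w. (x, w) \<in> adjacency E ^^ n}"
    using n by (force simp: orbit_def stabilizer_def)
  then show "finite (orbit ((perm_group V A)\<lparr>carrier := stabilizer (perm_group V A) (\<lambda>a. a) x\<rparr>) (\<lambda>a. a) y)"
    using finite_sphere [OF assms(1)] finite_subset by blast
qed

end

section \<open>Automorphisms of maps\<close>

context cellular_map
begin

definition induces :: "('s \<Rightarrow> 's) \<Rightarrow> ('v \<Rightarrow> 'v) \<Rightarrow> bool" where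
  "induces h g \<longleftrightarrow> homeomorphic_map S S h \<and>
     (\<forall>v\<in>V. h (pt v) = pt (g v)) \<and> (\<forall>e\<in>E. h ` ar e = ar (g ` e)) \<and>
     (\<forall>F\<in>map_faces S V E pt ar. h ` F \<in> map_faces S V E pt ar)"

definition automorphisms :: "('v \<Rightarrow> 'v) set" where
  "automorphisms = {g \<in> graph_automorphisms V E. \<exists>h. induces h g}"

lemma map_automorphism_group_eq: "map_automorphism_group S V E pt ar = perm_group V automorphisms"
  by (simp add: map_automorphism_group_def automorphisms_def induces_def)

lemma Hausdorff_S: "Hausdorff_space S"
  using surface by (simp add: surface_def)

lemma edge_arc:
  assumes e: "{u, w} \<in> E" shows "arc_between S (ar {u, w}) (pt u) (pt w)"
proof -
  obtain \<gamma> where \<gamma>: "embedding_map (top_of_set {0..1::real}) S \<gamma>" "\<gamma> ` {0..1} = ar {u, w}"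
      "\<gamma> ` {0, 1} = pt ` {u, w}"
    using edge_arcs [OF e] by blast
  then have "{\<gamma> 0, \<gamma> 1} = {pt u, pt w}"
    by simp
  then consider "\<gamma> 0 = pt u" "\<gamma> 1 = pt w" | "\<gamma> 0 = pt w" "\<gamma> 1 = pt u"
    by (auto simp: doubleton_eq_iff)
  then show ?thesis
  proof cases
    case 1
    then show ?thesis
      using \<gamma> by (auto simp: arc_between_def)
  next
    case 2
    then have "arc_between S (ar {u, w}) (pt w) (pt u)"
      using \<gamma> by (auto simp: arc_between_def)
    then show ?thesis
      by (rule arc_between_commute [OF Hausdorff_S])
  qed
qed

lemma incident_edge:
  assumes "e \<in> E" "v \<in> e" obtains w where "e = {v, w}"
  using edge_ends [OF assms(1)] assms(2) by auto

lemma edge_arc_from: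
  assumes "e \<in> E" "v \<in> e" shows "arc_from S (pt v) (ar e)"
  using incident_edge [OF assms] edge_arc assms unfolding arc_from_def by metis

lemma incident_arcs_meet:
  assumes "e \<in> E" "f \<in> E" "v \<in> e" "v \<in> f" "e \<noteq> f"
  shows "ar e \<inter> ar f = {pt v}"
proof -
  obtain u w where "e = {v, u}" "f = {v, w}"
    using assms incident_edge by metis
  then have "e \<inter> f = {v}"
    using assms by auto
  then show ?thesis
    using arcs_meet [OF assms(1,2,5)] by simp
qed

lemma ar_subset: "e \<in> E \<Longrightarrow> ar e \<subseteq> topspace S"
  using edge_arc_from arc_fromD(1) edge_ends by (metis insertI1)

lemma ar_eq_iff:
  assumes "e \<in> E" "f \<in> E" shows "ar e = ar f \<longleftrightarrow> e = f"
proof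
  assume "ar e = ar f"
  then have "pt ` e = pt ` f"
    using arc_meets_vertices assms by metis
  then show "e = f"
    using inj_on_image_eq_iff [OF vertex_points(1)] edge_subset assms by blast
qed simp

lemma map_faces_subset: "F \<in> map_faces S V E pt ar \<Longrightarrow> F \<subseteq> topspace S - graph_image V E pt ar"
  using connected_components_of_subset [of F "subtopology S (topspace S - graph_image V E pt ar)"]
  by (auto simp: map_faces_def)

lemma map_face_connected: "F \<in> map_faces S V E pt ar \<Longrightarrow> connectedin S F"
  using connectedin_connected_components_of connectedin_subtopology unfolding map_faces_def by blast

lemma map_face_maximal:
  assumes "F \<in> map_faces S V E pt ar" "connectedin S C" "C \<inter> graph_image V E pt ar = {}" "C \<inter> F \<noteq> {}"
  shows "C \<subseteq> F"
proof (rule connected_components_of_maximal)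
  show "F \<in> connected_components_of (subtopology S (topspace S - graph_image V E pt ar))"
    using assms by (simp add: map_faces_def)
  show "connectedin (subtopology S (topspace S - graph_image V E pt ar)) C"
    using assms connectedin_subset_topspace by (fastforce simp: connectedin_subtopology)
  show "\<not> disjnt F C"
    using assms by (auto simp: disjnt_def)
qed

lemma map_face_exists:
  assumes "x \<in> topspace S - graph_image V E pt ar" obtains F where "F \<in> map_faces S V E pt ar" "x \<in> F"
proof -
  have "\<Union> (map_faces S V E pt ar) = topspace S - graph_image V E pt ar"
    by (auto simp: map_faces_def Union_connected_components_of)
  then show ?thesis
    using assms that by blast
qed

text \<open>The condition on faces goes in one direction only, so for the inverse \<open>k\<close>
  it has to be derived. \<open>k\<close>
  F\<open>is connected and misses the graph, hence lies in a face\<close>F'\<open>. The face\<close>h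
  \<open>F'\<close> meets \<open>F\<close>, hence lies in it, and the two inclusions give
  equality.\<close>

lemma induces_inverse:
  assumes g: "g \<in> graph_automorphisms V E" and h: "induces h g"
    and g': "\<And>v. v \<in> V \<Longrightarrow> g' v \<in> V \<and> g (g' v) = v" "\<And>e. e \<in> E \<Longrightarrow> g' ` e \<in> E"
  shows "\<exists>k. induces k g'"
proof -
  have "homeomorphic_map S S h"
    using h by (simp add: induces_def)
  then obtain k where hk: "homeomorphic_maps S S h k"
    unfolding homeomorphic_map_maps ..
  have kh: "k (h x) = x" "h (k x) = x" "k x \<in> topspace S" "h x \<in> topspace S" if "x \<in> topspace S" for x
    using hk that by (auto simp: homeomorphic_maps_def continuous_map_def Pi_iff)
  have image: "k ` C = D" if "h ` D = C" "D \<subseteq> topspace S" for C D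
    using that kh by (force simp: image_iff subset_iff)
  have hom_k: "homeomorphic_map S S k"
    using hk homeomorphic_maps_sym homeomorphic_maps_map by blast
  have pts: "k (pt v) = pt (g' v)" if "v \<in> V" for v
  proof -
    have "h (pt (g' v)) = pt v"
      using h g' that by (simp add: induces_def)
    then show ?thesis
      using kh g' that vertex_points(2) by (metis image_subset_iff)
  qed
  have arcs: "k ` ar e = ar (g' ` e)" if "e \<in> E" for e
  proof (rule image)
    have "g ` g' ` e = e"
      using g'(1) edge_subset [OF that] by (force simp: image_iff subset_iff)
    then show "h ` ar (g' ` e) = ar e"
      using h g'(2) [OF that] by (simp add: induces_def)
    show "ar (g' ` e) \<subseteq> topspace S"
      using ar_subset g'(2) [OF that] by blast
  qed
  \<comment> \<open>If \<open>h\<close> keeps the graph inside itself, then \<open>k\<close> cannot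
    carry a point of a face into the graph.\<close>
  have hG: "h ` graph_image V E pt ar \<subseteq> graph_image V E pt ar"
  proof -
    have "g v \<in> V" if "v \<in> V" for v
      using g that by (auto simp: graph_automorphisms_def Bij_def bij_betw_def)
    moreover have "g ` e \<in> E" if e: "e \<in> E" for e
    proof -
      obtain u w where "u \<in> V" "w \<in> V" "e = {u, w}"
        using edge_ends [OF e] by blast
      then show ?thesis
        using g e by (auto simp: graph_automorphisms_def)
    qed
    ultimately have *: "h ` pt ` V \<subseteq> pt ` V" "\<And>e. e \<in> E \<Longrightarrow> h ` ar e \<subseteq> (\<Union>e\<in>E. ar e)"
      using h by (auto simp: induces_def)
    show ?thesis
      unfolding graph_image_def image_Un image_UN by (intro Un_mono UN_least *)
  qed
  have "k ` F \<in> map_faces S V E pt ar" if F: "F \<in> map_faces S V E pt ar" for F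
  proof -
    have sub: "F \<subseteq> topspace S - graph_image V E pt ar"
      using map_faces_subset [OF F] .
    have kF: "k ` F \<inter> graph_image V E pt ar = {}"
    proof -
      have "x \<in> graph_image V E pt ar" if "x \<in> F" "k x \<in> graph_image V E pt ar" for x
        using hG that kh(2) [of x] sub by (metis DiffD1 image_subset_iff subsetD)
      then show ?thesis
        using sub by blast
    qed
    have "F \<noteq> {}"
      using F nonempty_connected_components_of unfolding map_faces_def by blast
    then obtain x where x: "x \<in> F" by blast
    then have "k x \<in> topspace S - graph_image V E pt ar"
      using kF kh(3) sub by blast
    then obtain F' where F': "F' \<in> map_faces S V E pt ar" "k x \<in> F'"
      using map_face_exists by blast
    have conn: "connectedin S (k ` F)"
      using map_face_connected [OF F] homeomorphic_imp_continuous_map [OF hom_k] connectedin_continuous_map_image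
      by blast
    have "k ` F \<subseteq> F'"
      using map_face_maximal [OF F'(1) conn kF] F' x by blast
    moreover have "h ` F' \<subseteq> F"
    proof (rule map_face_maximal [OF F])
      have hF': "h ` F' \<in> map_faces S V E pt ar"
        using h F' by (simp add: induces_def)
      then show "connectedin S (h ` F')" "h ` F' \<inter> graph_image V E pt ar = {}"
        using map_face_connected map_faces_subset by blast+
      have "x \<in> h ` F'"
        using F'(2) kh(2) [of x] sub x by (metis DiffD1 image_eqI subsetD)
      then show "h ` F' \<inter> F \<noteq> {}"
        using x by blast
    qed
    then have "F' \<subseteq> k ` F"
      using kh(1) map_faces_subset [OF F'(1)] by (force simp: image_iff subset_iff)
    ultimately show ?thesis
      using F'(1) by simp
  qed
  then show ?thesis
    using hom_k pts arcs unfolding induces_def by blast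
qed

lemma subgroup_automorphisms: "subgroup automorphisms (BijGroup V)"
proof (unfold subgroup_def, intro conjI allI impI)
  show "automorphisms \<subseteq> carrier (BijGroup V)"
    by (auto simp: automorphisms_def graph_automorphisms_def BijGroup_def)
  have Bij: "g \<in> Bij V" and gV: "\<And>v. v \<in> V \<Longrightarrow> g v \<in> V"
    and gE: "\<And>u w. u \<in> V \<Longrightarrow> w \<in> V \<Longrightarrow> {g u, g w} \<in> E \<longleftrightarrow> {u, w} \<in> E"
    if "g \<in> graph_automorphisms V E" for g
    using that by (auto simp: graph_automorphisms_def Bij_def bij_betw_def)
  have gE': "g ` e \<in> E" if g: "g \<in> graph_automorphisms V E" and e: "e \<in> E" for g e
  proof -
    obtain u w where "u \<in> V" "w \<in> V" "e = {u, w}"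
      using edge_ends [OF e] by blast
    then show ?thesis
      using gE [OF g] e by simp
  qed
  show "a \<otimes>\<^bsub>BijGroup V\<^esub> b \<in> automorphisms" if ab: "a \<in> automorphisms" "b \<in> automorphisms" for a b
  proof -
    obtain h k where hk: "a \<in> graph_automorphisms V E" "induces h a" "b \<in> graph_automorphisms V E" "induces k b"
      using ab by (auto simp: automorphisms_def)
    have ab': "a \<otimes>\<^bsub>BijGroup V\<^esub> b = compose V a b"
      using Bij hk by (simp add: BijGroup_def)
    have img: "compose V a b ` e = a ` b ` e" if "e \<in> E" for e
      using edge_subset [OF that] by (force simp: compose_def)
    have "compose V a b \<in> graph_automorphisms V E"
      using Bij [OF hk(1)] Bij [OF hk(3)] gE [OF hk(1)] gE [OF hk(3)] gV [OF hk(3)]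
      by (simp add: graph_automorphisms_def compose_Bij compose_eq)
    moreover have "induces (h \<circ> k) (compose V a b)"
      unfolding induces_def
    proof (intro conjI ballI)
      show "homeomorphic_map S S (h \<circ> k)"
        using hk by (intro homeomorphic_map_compose [of S S k S h]) (simp_all add: induces_def)
      show "(h \<circ> k) (pt v) = pt (compose V a b v)" if "v \<in> V" for v
        using hk gV [OF hk(3)] that by (simp add: induces_def compose_eq)
      show "(h \<circ> k) ` ar e = ar (compose V a b ` e)" if "e \<in> E" for e
        unfolding image_comp [symmetric] using hk gE' [OF hk(3)] that by (simp add: induces_def img)
      show "(h \<circ> k) ` F \<in> map_faces S V E pt ar" if "F \<in> map_faces S V E pt ar" for F
        unfolding image_comp [symmetric] using hk that by (simp add: induces_def)
    qed
    ultimately show ?thesis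
      unfolding ab' automorphisms_def by blast
  qed
  show "\<one>\<^bsub>BijGroup V\<^esub> \<in> automorphisms"
  proof -
    have "induces id (\<lambda>v\<in>V. v)"
      using edge_subset by (auto simp: induces_def subset_iff cong: image_cong_simp)
    moreover have "(\<lambda>v\<in>V. v) \<in> graph_automorphisms V E"
      by (auto simp: graph_automorphisms_def id_Bij)
    ultimately show ?thesis
      by (auto simp: BijGroup_def automorphisms_def)
  qed
  show "inv\<^bsub>BijGroup V\<^esub> g \<in> automorphisms" if g: "g \<in> automorphisms" for g
  proof -
    obtain h where h: "g \<in> graph_automorphisms V E" "induces h g"
      using g by (auto simp: automorphisms_def)
    let ?g = "\<lambda>v\<in>V. inv_into V g v"
    have bij: "bij_betw g V V"
      using Bij [OF h(1)] by (simp add: Bij_def)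
    have g': "?g v \<in> V \<and> g (?g v) = v" if "v \<in> V" for v
      using that bij by (auto simp: bij_betw_inv_into_right bij_betw_def inv_into_into)
    have gE'': "{?g u, ?g w} \<in> E \<longleftrightarrow> {u, w} \<in> E" if "u \<in> V" "w \<in> V" for u w
      using gE [OF h(1), of "?g u" "?g w"] g' [OF that(1)] g' [OF that(2)] by simp
    have "?g \<in> graph_automorphisms V E"
      using restrict_inv_into_Bij [OF Bij [OF h(1)]] gE'' unfolding graph_automorphisms_def by blast
    moreover have "?g ` e \<in> E" if e: "e \<in> E" for e
    proof -
      obtain u w where uw: "u \<in> V" "w \<in> V" "e = {u, w}"
        using edge_ends [OF e] by blast
      then show ?thesis
        using gE'' [OF uw(1,2)] e by simp
    qed
    moreover from this have "\<exists>k. induces k ?g"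
      using induces_inverse [OF h, of ?g] g' by blast
    ultimately show ?thesis
      unfolding inv_BijGroup [OF Bij [OF h(1)]] automorphisms_def by blast
  qed
qed

text \<open>An automorphism is rigid at \<open>v\<close> if it fixes the rotation at \<open>v\<close> and does not reflect it.\<close>

definition rigid_at :: "('s \<Rightarrow> 's) \<Rightarrow> ('v \<Rightarrow> 'v) \<Rightarrow> 'v \<Rightarrow> bool" where
  "rigid_at h g v \<longleftrightarrow> g v = v \<and>
     (\<forall>w. {v, w} \<in> E \<longrightarrow> g w = w \<and> preserves_sides S h (ar {v, w}) (pt v) (pt w))"

text \<open>Valence 3 supplies two fixed arcs besides the given one. With a single one, as at
  valence 2, a reflection could fix the vertex and all its neighbours and still swap the
  sides.\<close>

lemma rigid_at_of_valence_3:
  assumes h: "induces h g" and v: "v \<in> V" "valence E v \<ge> 3"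
    and fix_: "g v = v" "\<And>w. {v, w} \<in> E \<Longrightarrow> g w = w"
  shows "rigid_at h g v"
  unfolding rigid_at_def
proof (intro conjI allI impI fix_)
  have hom: "homeomorphic_map S S h"
    using h by (simp add: induces_def)
  fix w assume w: "{v, w} \<in> E"
  let ?I = "{e\<in>E. v \<in> e}"
  have fixed: "h ` ar e = ar e" if e: "e \<in> ?I" for e
  proof -
    obtain u where "e = {v, u}"
      using incident_edge [of e v] e by blast
    then have "g ` e = e"
      using fix_ e by auto
    then show ?thesis
      using h e by (simp add: induces_def)
  qed
  have "finite ?I" "card ?I \<ge> 3"
    using v card.infinite [of ?I] by (fastforce simp: valence_def)+
  then have "card (?I - {{v, w}}) \<ge> 2"
    using w by (simp add: card_Diff_singleton)
  then obtain D where "D \<subseteq> ?I - {{v, w}}" "card D = 2"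
    by (rule obtain_subset_with_card_n)
  then obtain b c where bc: "b \<in> ?I - {{v, w}}" "c \<in> ?I - {{v, w}}" "b \<noteq> c"
    unfolding card_2_iff by blast
  show "preserves_sides S h (ar {v, w}) (pt v) (pt w)"
  proof (rule preserves_sides_of_fixed_arcs [OF surface hom])
    show "h (pt v) = pt v" "h (pt w) = pt w"
      using h fix_ w adjacent_vertices [OF w] by (auto simp: induces_def)
    show "arc_between S (ar {v, w}) (pt v) (pt w)"
      using edge_arc [OF w] .
    show "h ` ar {v, w} = ar {v, w}" "h ` ar b = ar b" "h ` ar c = ar c"
      using fixed w bc by auto
    show "arc_from S (pt v) (ar b)" "arc_from S (pt v) (ar c)"
      using bc edge_arc_from by auto
    show "ar {v, w} \<inter> ar b = {pt v}" "ar {v, w} \<inter> ar c = {pt v}" "ar b \<inter> ar c = {pt v}"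
      using bc w by (intro incident_arcs_meet; auto)+
  qed
qed

text \<open>The edge to \<open>u\<close> continues the edge between \<open>v\<close> and
  \<open>w\<close> beyond \<open>v\<close>, and a second edge at \<open>w\<close> continues it
  beyond \<open>w\<close>, so it has a side function. Its preserved sides fix the other arcs at
  \<open>w\<close>, and are then transferred to them. If \<open>w\<close> is a leaf, its single edge
  is already known to be rigid from \<open>v\<close>.\<close>

lemma rigid_at_adjacent:
  assumes lf: "locally_finite_graph V E" and g: "g \<in> graph_automorphisms V E" and h: "induces h g"
    and rigid: "rigid_at h g v" and e: "{v, w} \<in> E"
    and b: "{v, u} \<in> E" "u \<noteq> w"
  shows "rigid_at h g w"
proof (cases "\<exists>x. {w, x} \<in> E \<and> x \<noteq> v")
  case False
  have gw: "g w = w" "g v = v" and pres: "preserves_sides S h (ar {w, v}) (pt w) (pt v)"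
    using rigid e preserves_sides_commute [of S h "ar {v, w}" "pt v" "pt w"]
    by (auto simp: rigid_at_def insert_commute)
  have "x = v" if "{w, x} \<in> E" for x
    using False that by blast
  then show ?thesis
    unfolding rigid_at_def using gw pres by blast
next
  case True
  then obtain f where f: "{w, f} \<in> E" "f \<noteq> v" by blast
  have hom: "homeomorphic_map S S h" and hpt: "\<And>v. v \<in> V \<Longrightarrow> h (pt v) = pt (g v)"
    and har: "\<And>e. e \<in> E \<Longrightarrow> h ` ar e = ar (g ` e)"
    using h by (auto simp: induces_def)
  have gv: "g v = v" and gw: "g w = w" and pres: "preserves_sides S h (ar {w, v}) (pt w) (pt v)"
    using rigid e preserves_sides_commute [of S h "ar {v, w}" "pt v" "pt w"]
    by (auto simp: rigid_at_def insert_commute)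
  have e': "{w, v} \<in> E" using e by (simp add: insert_commute)
  have V: "v \<in> V" "w \<in> V" "v \<noteq> w" using adjacent_vertices [OF e] by auto
  have arc: "arc_between S (ar {w, v}) (pt w) (pt v)"
    using edge_arc [OF e'] .
  have fixe: "h ` ar {w, v} = ar {w, v}"
    using har [OF e'] gv gw by simp
  have ends: "h (pt w) = pt w" "h (pt v) = pt v"
    using hpt V gv gw by auto
  have ex: "\<exists>\<sigma>. \<forall>x\<in>ar {w, v} - {pt w, pt v}. side_function S (ar {w, v}) x \<sigma>"
  proof (rule side_function_on_open_arc_exists [OF surface arc edge_arc [OF f(1)] _ edge_arc [OF b(1)]])
    show "ar {w, v} \<inter> ar {w, f} = {pt w}"
      using e' f by (intro incident_arcs_meet) (auto simp: doubleton_eq_iff)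
    show "ar {w, v} \<inter> ar {v, u} = {pt v}"
      using e' b by (intro incident_arcs_meet) (auto simp: doubleton_eq_iff)
  qed
  let ?P = "ar ` ({e\<in>E. w \<in> e} - {{w, v}})"
  have fixb: "h ` ar {w, x} = ar {w, x}" if x: "{w, x} \<in> E" "x \<noteq> v" for x
  proof (rule arcs_fixed_of_preserves_sides [OF surface hom ends(1) arc fixe _ _ _ _ pres ex])
    show "finite ?P"
      using lf V(2) by (simp add: locally_finite_graph_def)
    show "arc_from S (pt w) c \<and> ar {w, v} \<inter> c = {pt w}" if "c \<in> ?P" for c
      using that e' incident_arcs_meet [OF e'] edge_arc_from by auto
    show "c \<inter> d = {pt w}" if "c \<in> ?P" "d \<in> ?P" "c \<noteq> d" for c d
      using that incident_arcs_meet by auto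
    show "h ` c \<in> ?P" if c: "c \<in> ?P" for c
    proof -
      obtain f where f: "f \<in> E" "w \<in> f" "f \<noteq> {w, v}" "c = ar f"
        using c by blast
      then obtain y where y: "f = {w, y}"
        using incident_edge by blast
      have "y \<in> V" "y \<noteq> v"
        using f y adjacent_vertices by auto
      then have "g ` f = {w, g y}" "g y \<noteq> g v"
        using g gw y V by (auto simp: graph_automorphisms_def Bij_def bij_betw_def dest: inj_onD)
      moreover have "{w, g y} \<in> E"
        using g f(1) y gw V \<open>y \<in> V\<close> unfolding graph_automorphisms_def by (metis (mono_tags, lifting) mem_Collect_eq)
      ultimately show ?thesis
        using f har [OF f(1)] gv by (auto simp: doubleton_eq_iff)
    qed
    show "ar {w, x} \<in> ?P"
      using x by (auto simp: doubleton_eq_iff)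
  qed
  show ?thesis
    unfolding rigid_at_def
  proof (intro conjI allI impI gw)
    fix x assume x: "{w, x} \<in> E"
    have "x \<in> V" using adjacent_vertices [OF x] by blast
    show gx: "g x = x"
    proof (cases "x = v")
      case False
      have "{w, g x} \<in> E"
        using g x gw V \<open>x \<in> V\<close> unfolding graph_automorphisms_def by (metis (mono_tags, lifting) mem_Collect_eq)
      moreover have "ar {w, g x} = ar {w, x}"
        using fixb [OF x False] har [OF x] gw by simp
      ultimately show ?thesis
        using ar_eq_iff x by (auto simp: doubleton_eq_iff)
    qed (use gv in simp)
    show "preserves_sides S h (ar {w, x}) (pt w) (pt x)"
    proof (cases "x = v")
      case False
      show ?thesis
      proof (rule preserves_sides_transfer [OF surface hom ends(1) _ arc fixe edge_arc [OF x] _ fixb [OF x False] pres ex])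
        show "h (pt x) = pt x"
          using hpt gx \<open>x \<in> V\<close> by simp
        show "ar {w, v} \<inter> ar {w, x} = {pt w}"
          using e' x False by (intro incident_arcs_meet) (auto simp: doubleton_eq_iff)
      qed
    qed (use pres in simp)
  qed
qed

lemma rigid_everywhere:
  assumes lf: "locally_finite_graph V E" and conn: "connected_graph V E"
    and g: "g \<in> graph_automorphisms V E" and h: "induces h g"
    and v: "v \<in> V" "valence E v \<ge> 3" and rigid: "rigid_at h g v" and x: "x \<in> V"
  shows "g x = x"
proof -
  have "(v, x) \<in> {(a, b). {a, b} \<in> E}\<^sup>*"
    using conn v x by (simp add: connected_graph_def)
  \<comment> \<open>The walk may enter a leaf and turn back, and a leaf has no second edge from
    which to continue. The invariant therefore remembers that all neighbours of a vertex with a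
    single neighbour are rigid.\<close>
  then have "rigid_at h g x \<and> ((\<exists>u u'. {x, u} \<in> E \<and> {x, u'} \<in> E \<and> u \<noteq> u') \<or> (\<forall>w. {x, w} \<in> E \<longrightarrow> rigid_at h g w))"
  proof (induction rule: rtrancl_induct)
    case base
    have "card {e\<in>E. v \<in> e} \<ge> 3"
      using v by (simp add: valence_def)
    then have "2 \<le> card {e\<in>E. v \<in> e}" by simp
    then obtain D where "D \<subseteq> {e\<in>E. v \<in> e}" "card D = 2"
      by (rule obtain_subset_with_card_n)
    then obtain b c where "b \<in> {e\<in>E. v \<in> e}" "c \<in> {e\<in>E. v \<in> e}" "b \<noteq> c"
      unfolding card_2_iff by blast
    then obtain u u' where "{v, u} \<in> E" "{v, u'} \<in> E" "u \<noteq> u'"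
      using incident_edge by (metis (mono_tags, lifting) mem_Collect_eq)
    then show ?case
      using rigid by blast
  next
    case (step y z)
    then have yz: "{y, z} \<in> E" by simp
    have z: "rigid_at h g z"
    proof (cases "\<exists>u u'. {y, u} \<in> E \<and> {y, u'} \<in> E \<and> u \<noteq> u'")
      case True
      then obtain u where "{y, u} \<in> E" "u \<noteq> z" by metis
      then show ?thesis
        using rigid_at_adjacent [OF lf g h _ yz] step by blast
    next
      case False
      then show ?thesis
        using step yz by blast
    qed
    moreover have "rigid_at h g w" if "\<not> (\<exists>u u'. {z, u} \<in> E \<and> {z, u'} \<in> E \<and> u \<noteq> u')" "{z, w} \<in> E" for w
    proof -
      have "{z, y} \<in> E"
        using yz by (simp add: insert_commute)
      then have "w = y"
        using that by blast
      then show ?thesis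
        using step by blast
    qed
    ultimately show ?case by blast
  qed
  then show ?thesis
    by (simp add: rigid_at_def)
qed

lemma two_distinguishable_map:
  assumes lf: "locally_finite_graph V E" and conn: "connected_graph V E"
    and v: "v \<in> V" "valence E v \<ge> 3"
    and inf: "infinite (carrier (map_automorphism_group S V E pt ar))"
  shows "two_distinguishable (map_automorphism_group S V E pt ar) V (\<lambda>a. a)"
proof -
  interpret perm: permutation_group V automorphisms
    by (rule permutation_group.intro) (rule subgroup_automorphisms)
  let ?Y = "insert v {w. {v, w} \<in> E}"
  have "finite {w. (v, w) \<in> adjacency E ^^ 1}"
    by (rule finite_sphere [OF lf])
  then have fin: "finite ?Y"
    by (simp add: adjacency_def)
  have "is_base (perm_group V automorphisms) V (\<lambda>a. a) ?Y"
  proof (rule perm.is_baseI)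
    show "?Y \<subseteq> V"
      using v adjacent_vertices by auto
    fix g x assume g: "g \<in> automorphisms" and Y: "\<forall>y\<in>?Y. g y = y" and "x \<in> V"
    then obtain h where h: "g \<in> graph_automorphisms V E" "induces h g"
      by (auto simp: automorphisms_def)
    have "rigid_at h g v"
      using rigid_at_of_valence_3 [OF h(2) v] Y by simp
    then show "g x = x"
      using rigid_everywhere [OF lf conn h v _ \<open>x \<in> V\<close>] by blast
  qed
  moreover have "automorphisms \<subseteq> graph_automorphisms V E"
    by (auto simp: automorphisms_def)
  ultimately show ?thesis
    unfolding map_automorphism_group_eq
    using inf fin countable_vertices [OF lf conn] subdegree_finite_automorphisms [OF lf conn]
    by (intro perm.two_distinguishable_of_finite_base) (auto simp: map_automorphism_group_eq)
qed

end

section \<open>The six instances\<close>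

theorem theorem3p4:
  fixes G :: "('g, 'm) monoid_scheme"
    and smul :: "'k::field \<Rightarrow> 'v::ab_group_add \<Rightarrow> 'v" and B :: "'v set"
    and S :: "'s topology" and V :: "'n set" and E :: "'n set set"
    and pt :: "'n \<Rightarrow> 's" and ar :: "'n set \<Rightarrow> 's set"
    and X :: "'x set" and A :: "('x \<Rightarrow> 'x) set"
  shows
    "(finitely_generated_group G \<and> infinite (carrier G) \<longrightarrow>
        two_distinguishable (AutoGroup G) (carrier G) (\<lambda>a. a)) \<and>
     (infinite (UNIV :: 'k set) \<and> finite_dimensional_vector_space smul B \<longrightarrow>
        two_distinguishable (general_linear_group smul) (UNIV :: 'v set) (\<lambda>a. a)) \<and>
     (countable X \<and> subgroup A (BijGroup X) \<and> infinite A \<and>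
      subdegree_finite (perm_group X A) X (\<lambda>a. a) \<and>
      (\<exists>Y. finite Y \<and> is_base (perm_group X A) X (\<lambda>a. a) Y) \<longrightarrow>
        two_distinguishable (perm_group X A) X (\<lambda>a. a)) \<and>
     (cellular_map S V E pt ar \<and> locally_finite_graph V E \<and> connected_graph V E \<and>
      (\<exists>v\<in>V. valence E v \<ge> 3) \<and> infinite (carrier (map_automorphism_group S V E pt ar)) \<longrightarrow>
        two_distinguishable (map_automorphism_group S V E pt ar) V (\<lambda>a. a)) \<and>
     (countable X \<and> subgroup A (BijGroup X) \<and> infinite A \<and>
      subdegree_finite (perm_group X A) X (\<lambda>a. a) \<and>
      (\<exists>x\<in>X. cyclic_group ((perm_group X A)\<lparr>carrier := stabilizer (perm_group X A) (\<lambda>a. a) x\<rparr>)) \<longrightarrow>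
        two_distinguishable (perm_group X A) X (\<lambda>a. a)) \<and>
     (countable X \<and> subgroup A (BijGroup X) \<and> infinite A \<and>
      subdegree_finite (perm_group X A) X (\<lambda>a. a) \<and>
      frobenius_action (perm_group X A) X (\<lambda>a. a) \<longrightarrow>
        two_distinguishable (perm_group X A) X (\<lambda>a. a))"
proof (intro conjI impI; elim conjE)
  show "two_distinguishable (AutoGroup G) (carrier G) (\<lambda>a. a)"
    if "finitely_generated_group G" "infinite (carrier G)"
    using that by (rule two_distinguishable_AutoGroup)
  show "two_distinguishable (general_linear_group smul) (UNIV :: 'v set) (\<lambda>a. a)"
    if "infinite (UNIV :: 'k set)" "finite_dimensional_vector_space smul B"
    using that by (rule two_distinguishable_general_linear_group)
  show "two_distinguishable (perm_group X A) X (\<lambda>a. a)"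
    if "countable X" "subgroup A (BijGroup X)" "infinite A" "subdegree_finite (perm_group X A) X (\<lambda>a. a)"
      "\<exists>Y. finite Y \<and> is_base (perm_group X A) X (\<lambda>a. a) Y"
    using that(5) permutation_group.two_distinguishable_of_finite_base [OF permutation_group.intro, OF that(2,1,3,4)]
    by (elim exE conjE)
  show "two_distinguishable (map_automorphism_group S V E pt ar) V (\<lambda>a. a)"
    if M: "cellular_map S V E pt ar" "locally_finite_graph V E" "connected_graph V E"
      and val: "\<exists>v\<in>V. valence E v \<ge> 3" and inf: "infinite (carrier (map_automorphism_group S V E pt ar))"
  proof -
    obtain v where "v \<in> V" "valence E v \<ge> 3"
      using val by (rule bexE)
    then show ?thesis
      by (rule cellular_map.two_distinguishable_map [OF M _ _ inf])
  qed
  show "two_distinguishable (perm_group X A) X (\<lambda>a. a)"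
    if "countable X" "subgroup A (BijGroup X)" "infinite A" "subdegree_finite (perm_group X A) X (\<lambda>a. a)"
      "\<exists>x\<in>X. cyclic_group ((perm_group X A)\<lparr>carrier := stabilizer (perm_group X A) (\<lambda>a. a) x\<rparr>)"
    using that(5) permutation_group.two_distinguishable_of_cyclic_stabilizer [OF permutation_group.intro, OF that(2,1,3,4)]
    by (elim bexE)
  show "two_distinguishable (perm_group X A) X (\<lambda>a. a)"
    if "countable X" "subgroup A (BijGroup X)" "infinite A" "subdegree_finite (perm_group X A) X (\<lambda>a. a)"
      "frobenius_action (perm_group X A) X (\<lambda>a. a)"
    by (rule permutation_group.two_distinguishable_of_frobenius [OF permutation_group.intro, OF that(2,1,3,4,5)])
qed

end
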